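(* Let $\alpha>0$ be real, let $m$ be a nonnegative integer, let $d\in\mathbb{R}$, let $A>0$, and let $B,C\in\mathbb{R}$. Consider the equation $$\frac{\partial^\alpha}{\partial t^\alpha}u(x,t)=t^m\left(Ax^{d}\frac{\partial^2}{\partial x^2}u(x,t)+Bx^{d-1}\frac{\partial}{\partial x}u(x,t)+Cx^{d-2}u(x,t)\right),\qquad x>0,\ t>0. \qquad ( * )$$ Let $a$ be any real number, put $K=Aa^2-Aa+Ba+C$ and, when $d\neq 2$, $$s_{1,2}=\frac{\alpha+m}{2(2-d)}\left(\frac{B}{A}+2a-1\pm\sqrt{\left(1-\frac{B}{A}\right)^2-\frac{4C}{A}}\right).$$ Let $c_1,c_2,\dots$ denote arbitrary constants. 1. If $0<\alpha<2$ and $d\neq2$, then $( * )$ has the solution $$u(x,t)=c_1x^aH_{1,m+2}^{m+2,0}\left[\frac{x^{2-d}}{A(d-2)^2(\alpha+m)^{m}t^{\alpha+m}}\;\middle|\;\begin{matrix}(1,\alpha+m)\\ \left(-\frac{s_1}{\alpha+m},1\right),\left(-\frac{s_2}{\alpha+m},1\right),\left(\frac{j}{\alpha+m},1\right)_{1,m}\end{matrix}\right].$$ 2. If $\alpha>2$ and $d\neq2$, then $( * )$ has the solution $$u(x,t)=x^a\sum_{k=1}^{[\alpha]+1}c_k\,x^{\frac{(d-2)(\alpha-k)}{\alpha+m}}t^{\alpha-k}\;{}_{m+3}\Psi_1\left[A(d-2)^2(\alpha+m)^{m}x^{d-2}t^{\alpha+m}\;\middle|\;\begin{matrix}\left(\frac{\alpha-k-s_1}{\alpha+m},1\right),\left(\frac{\alpha-k-s_2}{\alpha+m},1\right),\left(\frac{\alpha-k+i}{\alpha+m},1\right)_{1,m},(1,1)\\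 (1+\alpha-k,\alpha+m)\end{matrix}\right].$$ 3. If $d=2$, then $( * )$ has the solution $$u(x,t)=x^a\sum_{k=1}^{[\alpha]+1}c_k\,t^{\alpha-k}\;{}_{m+1}\Psi_1\left[K(\alpha+m)^m t^{\alpha+m}\;\middle|\;\begin{matrix}\left(\frac{\alpha-k+i}{\alpha+m},1\right)_{1,m},(1,1)\\ (1+\alpha-k,\alpha+m)\end{matrix}\right].$$ In parts 2 and 3 the sum is over those $k$ for which the corresponding generalized Wright function is defined.
   Context: Fractional derivative: $\frac{\partial^\alpha}{\partial t^\alpha}$ is the Riemann–Liouville derivative in $t$ with base point $0$: $\frac{d^\alpha f}{dt^\alpha}(t)=\frac{d^N}{dt^N}\frac{1}{\Gamma(N-\alpha)}\int_0^t(t-\tau)^{N-\alpha-1}f(\tau)\,d\tau$ with $N=[\alpha]+1$; for integer $\alpha$ it is the ordinary derivative of order $\alpha$. Here $[\alpha]$ is the integer part of $\alpha$. Notation: $(a_j,\alpha_j)_{r,q}$ denotes the list of pairs $(a_r,\alpha_r),\dots,(a_q,\alpha_q)$ (empty if $q<r$); e.g. $\left(\frac{j}{\alpha+m},1\right)_{1,m}$ is the list for $j=1,\dots,m$, and in $\left(\frac{\alpha-k+i}{\alpha+m},1\right)_{1,m}$ the running index is $i=1,\dots,m$. Fox H-function: for $0\le M\le q$, $0\le l\le p$, $(M,l)\ne(0,0)$, $\alpha_i,\beta_j>0$, $$H_{p,q}^{M,l}\left[z\;\middle|\;\begin{matrix}(a_i,\alpha_i)_{1,p}\\(b_j,\beta_j)_{1,q}\end{matrix}\right]=\frac{1}{2\pi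 i}\int_{L}\frac{\prod_{j=1}^M\Gamma(b_j-\beta_js)\prod_{i=1}^l\Gamma(1-a_i+\alpha_is)}{\prod_{i=l+1}^p\Gamma(a_i-\alpha_is)\prod_{j=M+1}^q\Gamma(1-b_j+\beta_js)}z^{s}\,ds,$$ where $L$ is a suitable contour from $\gamma-i\infty$ to $\gamma+i\infty$, $\gamma\in\mathbb{R}$, having the poles of $\Gamma(b_j-\beta_js)$, $1\le j\le M$, on its right and those of $\Gamma(1-a_i+\alpha_is)$, $1\le i\le l$, on its left (when $l=0$ one can take the vertical line $\operatorname{Re}s=\gamma$ with $\gamma<\min_{j\le M}\operatorname{Re}(b_j)/\beta_j$). The integral converges if $\omega=\sum_{i=1}^{l}\alpha_i-\sum_{i=l+1}^{p}\alpha_i+\sum_{j=1}^{M}\beta_j-\sum_{j=M+1}^{q}\beta_j>0$ and $|\arg z|<\pi\omega/2$. The parameters $a_i,b_j$ may be complex. Generalized Wright function: for $a_i,b_j\in\mathbb{C}$ and $\alpha_i,\beta_j\in\mathbb{R}\setminus\{0\}$, $${}_p\Psi_q\left[z\;\middle|\;\begin{matrix}(a_i,\alpha_i)_{1,p}\\(b_j,\beta_j)_{1,q}\end{matrix}\right]=\sum_{k=0}^\infty\frac{\prod_{i=1}^p\Gamma(a_i+\alpha_ik)}{\prod_{j=1}^q\Gamma(b_j+\beta_jk)}\frac{z^k}{k!},$$ with $1/\Gamma$ taken as $0$ at the poles of $\Gamma$; it is defined when no numerator argument $a_i+\alpha_ik$ ($k\ge 0$) is a nonpositive integer, and the series converges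 absolutely for all $z\in\mathbb{C}$ if $\sum_j\beta_j-\sum_i\alpha_i>-1$. *)

theory Defs
  imports "HOL-Analysis.Analysis"
begin

section \<open>Iterated derivatives of functions of a real variable\<close>

definition nth_vderiv :: "nat \<Rightarrow> (real \<Rightarrow> 'a::real_normed_vector) \<Rightarrow> real \<Rightarrow> 'a" where
  "nth_vderiv n f = ((\<lambda>g t. vector_derivative g (at t)) ^^ n) f"

text \<open>
  Meant for open \<open>S\<close>. Since \<^const>\<open>vector_derivative\<close> is total, existence of the derivatives has to
  be stated separately.
\<close>

definition times_differentiable_on ::
    "nat \<Rightarrow> (real \<Rightarrow> 'a::real_normed_vector) \<Rightarrow> real set \<Rightarrow> bool" where
  "times_differentiable_on n f S \<longleftrightarrow>
     (\<forall>k<n. \<forall>t\<in>S. nth_vderiv k f differentiable (at t))"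

section \<open>The Riemann--Liouville derivative with base point 0\<close>

definition RL_integral :: "real \<Rightarrow> (real \<Rightarrow> 'a::banach) \<Rightarrow> real \<Rightarrow> 'a" where
  "RL_integral \<beta> f t =
     (1 / Gamma \<beta>) *\<^sub>R integral {0..t} (\<lambda>\<tau>. (t - \<tau>) powr (\<beta> - 1) *\<^sub>R f \<tau>)"

definition RL_deriv :: "real \<Rightarrow> (real \<Rightarrow> 'a::banach) \<Rightarrow> real \<Rightarrow> 'a" where
  "RL_deriv \<alpha> f t =
     (if \<alpha> \<in> \<int> then nth_vderiv (nat \<lfloor>\<alpha>\<rfloor>) f t
      else let N = nat \<lfloor>\<alpha>\<rfloor> + 1 in nth_vderiv N (RL_integral (real N - \<alpha>) f) t)"

text \<open>
  The derivative \<^const>\<open>RL_deriv\<close> of order \<open>\<alpha>\<close> exists at every \<open>t > 0\<close>. The integral defining it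
  is required to converge absolutely.
\<close>

definition RL_differentiable :: "real \<Rightarrow> (real \<Rightarrow> 'a::euclidean_space) \<Rightarrow> bool" where
  "RL_differentiable \<alpha> f \<longleftrightarrow>
     (if \<alpha> \<in> \<int> then times_differentiable_on (nat \<lfloor>\<alpha>\<rfloor>) f {0<..}
      else let N = nat \<lfloor>\<alpha>\<rfloor> + 1 in
        (\<forall>t>0. (\<lambda>\<tau>. (t - \<tau>) powr (real N - \<alpha> - 1) *\<^sub>R f \<tau>) absolutely_integrable_on {0..t}) \<and>
        times_differentiable_on N (RL_integral (real N - \<alpha>) f) {0<..})"

section \<open>The fractional equation\<close>

text \<open>
  A solution is complex-valued, because the special functions below have complex parameters;
  all derivatives in the equation have to exist for all \<open>x > 0\<close> and \<open>t > 0\<close>.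
\<close>

definition fractional_eq_solution ::
    "real \<Rightarrow> nat \<Rightarrow> real \<Rightarrow> real \<Rightarrow> real \<Rightarrow> real \<Rightarrow> (real \<Rightarrow> real \<Rightarrow> complex) \<Rightarrow> bool" where
  "fractional_eq_solution \<alpha> m d A B C u \<longleftrightarrow>
     (\<forall>x>0. RL_differentiable \<alpha> (\<lambda>t. u x t)) \<and>
     (\<forall>t>0. times_differentiable_on 2 (\<lambda>x. u x t) {0<..}) \<and>
     (\<forall>x>0. \<forall>t>0.
        RL_deriv \<alpha> (\<lambda>t. u x t) t =
        t ^ m *\<^sub>R ((A * x powr d) *\<^sub>R nth_vderiv 2 (\<lambda>x. u x t) x
                 + (B * x powr (d - 1)) *\<^sub>R nth_vderiv 1 (\<lambda>x. u x t) x
                 + (C * x powr (d - 2)) *\<^sub>R u x t))"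

section \<open>Fox H-function\<close>

text \<open>
  A parameter list \<open>(a\<^sub>i, \<alpha>\<^sub>i)\<^bsub>1,p\<^esub>\<close> is a list of pairs of length \<open>p\<close>; the upper indices \<open>M\<close>, \<open>l\<close>
  split the lists by \<^const>\<open>take\<close> and \<^const>\<open>drop\<close>. Reciprocal Gamma factors are written with the entire
  function \<^const>\<open>rGamma\<close>, and \<open>z\<^sup>s\<close> is the principal power.
\<close>

definition fox_integrand ::
    "nat \<Rightarrow> nat \<Rightarrow> (complex \<times> real) list \<Rightarrow> (complex \<times> real) list \<Rightarrow> complex \<Rightarrow> complex \<Rightarrow> complex"
  where
  "fox_integrand M l as bs z s =
     (\<Prod>(b, \<beta>)\<leftarrow>take M bs. Gamma (b - of_real \<beta> * s)) *
     (\<Prod>(a, \<alpha>)\<leftarrow>take l as. Gamma (1 - a + of_real \<alpha> * s)) *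
     (\<Prod>(a, \<alpha>)\<leftarrow>drop l as. rGamma (a - of_real \<alpha> * s)) *
     (\<Prod>(b, \<beta>)\<leftarrow>drop M bs. rGamma (1 - b + of_real \<beta> * s)) * z powr s"

text \<open>
  Contours from \<open>\<gamma> - i\<infinity>\<close> to \<open>\<gamma> + i\<infinity>\<close>: piecewise smooth, and equal to the vertical line
  \<open>Re s = \<gamma>\<close> outside a compact parameter interval.
\<close>

definition infinite_contour :: "(real \<Rightarrow> complex) \<Rightarrow> bool" where
  "infinite_contour L \<longleftrightarrow>
     (\<exists>\<gamma> T. T > 0 \<and> L piecewise_C1_differentiable_on {-T..T} \<and>
            (\<forall>t. \<bar>t\<bar> \<ge> T \<longrightarrow> L t = Complex \<gamma> t))"

text \<open>
  The points to the left (right) of \<open>L\<close> are those that can be joined, without crossing \<open>L\<close>, to real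
  numbers near \<open>-\<infinity>\<close> (near \<open>+\<infinity>\<close>).
\<close>

definition left_side :: "(real \<Rightarrow> complex) \<Rightarrow> complex set" where
  "left_side L = {s. eventually (\<lambda>r. connected_component (- range L) s (of_real r)) at_bot}"

definition right_side :: "(real \<Rightarrow> complex) \<Rightarrow> complex set" where
  "right_side L = {s. eventually (\<lambda>r. connected_component (- range L) s (of_real r)) at_top}"

definition fox_contour ::
    "nat \<Rightarrow> nat \<Rightarrow> (complex \<times> real) list \<Rightarrow> (complex \<times> real) list \<Rightarrow> (real \<Rightarrow> complex) \<Rightarrow> bool" where
  "fox_contour M l as bs L \<longleftrightarrow>
     infinite_contour L \<and>
     (\<forall>(b, \<beta>)\<in>set (take M bs). \<forall>s. b - of_real \<beta> * s \<in> \<int>\<^sub>\<le>\<^sub>0 \<longrightarrow> s \<in> right_side L) \<and>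
     (\<forall>(a, \<alpha>)\<in>set (take l as). \<forall>s. 1 - a + of_real \<alpha> * s \<in> \<int>\<^sub>\<le>\<^sub>0 \<longrightarrow> s \<in> left_side L)"

text \<open>
  \<open>fox_H M l as bs z\<close> is \<open>H\<^bsub>p,q\<^esub>\<^bsup>M,l\<^esup>\<close> with \<open>p = length as\<close> and \<open>q = length bs\<close>. It is meaningful for
  \<open>M \<le> q\<close>, \<open>l \<le> p\<close>, \<open>(M, l) \<noteq> (0, 0)\<close> and positive \<open>\<alpha>\<^sub>i\<close>, \<open>\<beta>\<^sub>j\<close>; by Cauchy's theorem the value
  does not depend on the choice of the contour when the integral converges under the usual
  condition \<open>\<bar>arg z\<bar> < \<pi>\<omega>/2\<close>.
\<close>

definition fox_H ::
    "nat \<Rightarrow> nat \<Rightarrow> (complex \<times> real) list \<Rightarrow> (complex \<times> real) list \<Rightarrow> complex \<Rightarrow> complex" where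
  "fox_H M l as bs z =
     (let L = (SOME L. fox_contour M l as bs L)
      in 1 / (2 * of_real pi * \<i>) *
         integral UNIV (\<lambda>t. fox_integrand M l as bs z (L t) * vector_derivative L (at t)))"

lemma fox_contour_vertical_line:
  assumes "\<And>b \<beta>. (b, \<beta>) \<in> set (take M bs) \<Longrightarrow> \<beta> > 0 \<and> \<gamma> < Re b / \<beta>"
  shows   "fox_contour M 0 as bs (\<lambda>t. Complex \<gamma> t)"
proof -
  let ?L = "\<lambda>t. Complex \<gamma> t"
  have L_eq: "?L = (\<lambda>t. of_real \<gamma> + \<i> * of_real t)"
    by (auto simp: complex_eq_iff)
  have "?L C1_differentiable_on {-1..1}"
    unfolding L_eq C1_differentiable_on_def
    by (rule exI[of _ "\<lambda>_. \<i>"]) (auto intro!: derivative_eq_intros)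
  hence "infinite_contour ?L"
    unfolding infinite_contour_def
    by (intro exI[of _ \<gamma>] exI[of _ 1]) (auto intro: C1_differentiable_imp_piecewise)
  moreover have "s \<in> right_side ?L"
    if b: "(b, \<beta>) \<in> set (take M bs)" and s: "b - of_real \<beta> * s \<in> \<int>\<^sub>\<le>\<^sub>0" for b \<beta> s
  proof -
    from s obtain n :: nat where "b - of_real \<beta> * s = - of_nat n"
      by (auto elim: nonpos_Ints_cases')
    hence "Re b - \<beta> * Re s = - real n"
      by (auto simp: complex_eq_iff)
    with assms[OF b] have s_gt: "\<gamma> < Re s"
      by (auto simp: field_simps) (smt (verit) mult.commute mult_less_cancel_left_pos of_nat_0_le_iff)
    have conv: "connected {w. \<gamma> < Re w}"
      by (rule convex_connected) (rule convex_halfspace_Re_gt)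
    have "connected_component (- range ?L) s (of_real r)" if "r > \<gamma>" for r
      unfolding connected_component_def
      by (rule exI[of _ "{w. \<gamma> < Re w}"]) (use conv s_gt that in auto)
    thus ?thesis
      unfolding right_side_def mem_Collect_eq
      by (rule eventually_mono[OF eventually_gt_at_top[of \<gamma>]])
  qed
  ultimately show ?thesis
    by (auto simp: fox_contour_def)
qed

section \<open>Generalized Wright function\<close>

definition wright ::
    "(complex \<times> real) list \<Rightarrow> (complex \<times> real) list \<Rightarrow> complex \<Rightarrow> complex" where
  "wright as bs z =
     (\<Sum>n. (\<Prod>(a, \<alpha>)\<leftarrow>as. Gamma (a + of_real (\<alpha> * real n))) *
          (\<Prod>(b, \<beta>)\<leftarrow>bs. rGamma (b + of_real (\<beta> * real n))) * z ^ n / fact n)"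

definition wright_defined :: "(complex \<times> real) list \<Rightarrow> bool" where
  "wright_defined as \<longleftrightarrow>
     (\<forall>(a, \<alpha>)\<in>set as. \<forall>n::nat. a + of_real (\<alpha> * real n) \<notin> \<int>\<^sub>\<le>\<^sub>0)"

end

(*
  All the candidate solutions are superpositions u(x,t) = INT w rGamma(1 + sigma) t^sigma x^rho of power
  functions: over the counting measure for the Wright series, over a vertical line (sigma = -mu s,
  mu = alpha + m) for the H-function. Differentiation under the integral sign and the complex Beta
  integral show that the derivative of order alpha just replaces sigma by sigma - alpha, while the right
  hand side multiplies by the indicial polynomial. The recurrence of the Gamma factors then identifies
  the two sides after a shift of the index n by 1, respectively of the line of integration by 1.
  The second shift, and the freedom in the choice of the contour of the H-function, rest on
  Cauchy's theorem and on the exponential decay of Gamma along vertical lines.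
*)
theory Submission
  imports Defs "HOL-Complex_Analysis.Complex_Analysis" "HOL-Real_Asymp.Real_Asymp"
begin

text \<open>The split at \<alpha> = 2 comes from m + 2 Gamma factors of slope 1 competing with one
  reciprocal Gamma factor of slope \<mu> = \<alpha> + m. On a vertical line the product behaves like
  exp(- (pi / 2) (2 - \<alpha>) |Im s|), so the integral converges for \<alpha> < 2; consecutive
  terms of the series have a quotient of order n^(2 - \<alpha>), so it converges for \<alpha> > 2.
  For d = 2 the indicial polynomial is the constant K, the two root factors disappear, and the order
  becomes n^(- \<alpha>). The decay of Gamma is obtained without Stirling's formula: reflection
  gives |Gamma(1/2 + iy)| exactly, and monotonicity in the real part together with the recurrence
  carries this to every strip. The obstacle in part 1 is that \<open>fox_H\<close> integrates over a
  contour fixed only by the choice operator. Nothing is known of it beyond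
  \<open>fox_contour\<close>, so the passage to a straight line has to work for every such contour;
  it goes through winding numbers. Afterwards all lines used lie to the left of every pole, so no
  residue appears.\<close>

section \<open>Growth of the Gamma function in vertical strips\<close>

text \<open>Every factor of Euler's product has this monotonicity in the real part.\<close>

lemma norm_Gamma_ratio_mono:
  assumes "0 < x" "x \<le> x'"
  shows "norm (Gamma (Complex x y)) * Gamma x' \<le> norm (Gamma (Complex x' y)) * Gamma x"
proof -
  let ?z = "Complex x y" and ?z' = "Complex x' y"
  have factor: "norm (?z' + of_nat k) * (x + real k) \<le> norm (?z + of_nat k) * (x' + real k)" for k :: nat
  proof -
    \<comment> \<open>Divided by x + k and squared, the claim is that 1 + y^2 / (x + k)^2 decreases
      in x.\<close>
    have "(x + real k)\<^sup>2 * y\<^sup>2 \<le> (x' + real k)\<^sup>2 * y\<^sup>2"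
      using assms by (intro mult_right_mono power_mono) auto
    hence "(norm (?z' + of_nat k) * (x + real k))\<^sup>2 \<le> (norm (?z + of_nat k) * (x' + real k))\<^sup>2"
      unfolding power_mult_distrib cmod_power2 by (simp add: algebra_simps)
    thus ?thesis
      using assms by (rule_tac power2_le_imp_le) auto
  qed
  have poch: "norm (pochhammer ?z' n) * pochhammer x n \<le> norm (pochhammer ?z n) * pochhammer x' n" for n
    unfolding pochhammer_prod prod_norm [symmetric] prod.distrib [symmetric]
    using assms factor by (intro prod_mono) auto
  have pos: "pochhammer x n > 0" "pochhammer x' n > 0" for n
    using assms by (auto intro!: pochhammer_pos)
  have nz: "?z + of_nat n \<noteq> 0" "?z' + of_nat n \<noteq> 0" for n
    using assms by (auto simp: complex_eq_iff)
  have "pochhammer ?z n \<noteq> 0 \<and> pochhammer ?z' n \<noteq> 0" for n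
    using nz by (auto simp: pochhammer_prod)
  hence npos: "norm (pochhammer ?z n) > 0" "norm (pochhammer ?z' n) > 0" for n
    by auto
  \<comment> \<open>Since |n^z| = n^x, both sides carry the power n^(x + x'), and only the
    comparison of Pochhammer symbols is left.\<close>
  have ser: "norm (Gamma_series ?z n) * Gamma_series x' n \<le> norm (Gamma_series ?z' n) * Gamma_series x n" for n
  proof -
    let ?E = "fact n * exp (x * ln (real n)) * (fact n * exp (x' * ln (real n)))"
    have "norm (Gamma_series ?z n) * Gamma_series x' n
        = ?E / (norm (pochhammer ?z (n+1)) * pochhammer x' (n+1))"
      by (simp add: Gamma_series_def norm_mult norm_divide)
    also have "\<dots> \<le> ?E / (norm (pochhammer ?z' (n+1)) * pochhammer x (n+1))"
      using pos[of "n+1"] npos[of "n+1"] poch[of "n+1"]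
      by (intro divide_left_mono mult_pos_pos) auto
    also have "\<dots> = norm (Gamma_series ?z' n) * Gamma_series x n"
      by (simp add: Gamma_series_def norm_mult norm_divide)
    finally show ?thesis .
  qed
  show ?thesis
    by (rule LIMSEQ_le[OF tendsto_mult[OF tendsto_norm[OF Gamma_series_LIMSEQ] Gamma_series_LIMSEQ]
          tendsto_mult[OF tendsto_norm[OF Gamma_series_LIMSEQ] Gamma_series_LIMSEQ]])
      (use ser in auto)
qed

text \<open>For z = 1/2 + iy the reflected argument 1 - z is the conjugate of z, so the reflection
  formula evaluates a squared modulus. All growth bounds below are transported from this
  line.\<close>

lemma norm_Gamma_half: "(norm (Gamma (Complex (1/2) y)))\<^sup>2 = pi / cosh (pi * y)"
proof -
  let ?z = "Complex (1/2) y"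
  have "1 - ?z = cnj ?z" by (simp add: complex_eq_iff)
  hence "of_real ((norm (Gamma ?z))\<^sup>2) = Gamma ?z * Gamma (1 - ?z)"
    by (simp only: complex_norm_square cnj_Gamma)
  also have "\<dots> = of_real pi / sin (of_real pi * ?z)" by (rule Gamma_reflection_complex)
  also have "of_real pi * ?z = of_real (pi/2) - (- (\<i> * of_real (pi * y)))"
    by (simp add: complex_eq_iff)
  also have "sin \<dots> = cos (- (\<i> * of_real (pi * y)))"
    by (metis cos_sin_eq of_real_numeral of_real_divide)
  also have "\<dots> = of_real (cosh (pi * y))"
    by (simp add: cosh_conv_cos[symmetric] cosh_def scaleR_conv_of_real exp_of_real del: of_real_mult flip: of_real_minus)
  finally show ?thesis
    by (metis of_real_divide of_real_eq_iff)
qed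

text \<open>\<open>cosh (pi * y)\<close> lies between exp(pi |y|) / 2 and exp(pi |y|); the square
  root halves the rate pi and turns the factor 2 into sqrt 2.\<close>

lemma norm_Gamma_half_bounds:
  shows "sqrt pi * exp (- (pi / 2) * \<bar>y\<bar>) \<le> norm (Gamma (Complex (1/2) y))"
    and "norm (Gamma (Complex (1/2) y)) \<le> sqrt (2 * pi) * exp (- (pi / 2) * \<bar>y\<bar>)"
proof -
  have cosh: "cosh (pi * y) = (exp (pi * \<bar>y\<bar>) + exp (- (pi * \<bar>y\<bar>))) / 2"
    by (auto simp: cosh_def abs_if field_simps)
  have le: "cosh (pi * y) \<le> exp (pi * \<bar>y\<bar>)" "exp (pi * \<bar>y\<bar>) / 2 \<le> cosh (pi * y)"
    unfolding cosh by auto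
  have sq: "(exp (- (pi / 2) * \<bar>y\<bar>))\<^sup>2 = 1 / exp (pi * \<bar>y\<bar>)"
    by (simp add: exp_minus field_simps flip: exp_double)
  have cpos: "cosh (pi * y) > 0" by (rule cosh_real_pos)
  have "(sqrt pi * exp (- (pi / 2) * \<bar>y\<bar>))\<^sup>2 \<le> (norm (Gamma (Complex (1/2) y)))\<^sup>2"
    unfolding power_mult_distrib sq norm_Gamma_half using le cpos
    by (auto intro!: divide_left_mono)
  thus "sqrt pi * exp (- (pi / 2) * \<bar>y\<bar>) \<le> norm (Gamma (Complex (1/2) y))"
    by (rule power2_le_imp_le) auto
  have "(norm (Gamma (Complex (1/2) y)))\<^sup>2 \<le> (sqrt (2*pi) * exp (- (pi / 2) * \<bar>y\<bar>))\<^sup>2"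
    unfolding power_mult_distrib sq norm_Gamma_half using le cpos
    by (auto simp: field_simps)
  thus "norm (Gamma (Complex (1/2) y)) \<le> sqrt (2 * pi) * exp (- (pi / 2) * \<bar>y\<bar>)"
    by (rule power2_le_imp_le) auto
qed

text \<open>Growth like \<open>exp (\<kappa> \<bar>Im z\<bar>)\<close>; the slack \<open>\<epsilon>\<close> absorbs polynomial factors.\<close>

definition exp_type :: "real \<Rightarrow> (complex \<Rightarrow> complex) \<Rightarrow> complex set \<Rightarrow> bool" where
  "exp_type \<kappa> f S \<longleftrightarrow> (\<forall>\<epsilon>>0. \<exists>C. \<forall>z\<in>S. norm (f z) \<le> C * exp ((\<kappa> + \<epsilon>) * \<bar>Im z\<bar>))"

section \<open>Calculus of exponential type\<close>

lemma exp_typeI: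
  assumes "\<And>\<epsilon>. \<epsilon> > 0 \<Longrightarrow> \<exists>C. \<forall>z\<in>S. norm (f z) \<le> C * exp ((\<kappa> + \<epsilon>) * \<bar>Im z\<bar>)"
  shows "exp_type \<kappa> f S"
  using assms by (auto simp: exp_type_def)

lemma exp_typeE:
  assumes "exp_type \<kappa> f S" "\<kappa> < \<delta>"
  obtains C where "C \<ge> 0" "\<And>z. z \<in> S \<Longrightarrow> norm (f z) \<le> C * exp (\<delta> * \<bar>Im z\<bar>)"
proof -
  obtain C where C: "\<forall>z\<in>S. norm (f z) \<le> C * exp ((\<kappa> + (\<delta> - \<kappa>)) * \<bar>Im z\<bar>)"
    using assms unfolding exp_type_def by (metis diff_gt_0_iff_gt)
  show ?thesis
  \<comment> \<open>On an empty \<open>S\<close> the given constant may be negative; products of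
    bounds rely on its sign.\<close>
  proof (rule that[of "max C 0"])
    show "norm (f z) \<le> max C 0 * exp (\<delta> * \<bar>Im z\<bar>)" if "z \<in> S" for z
    proof -
      have "norm (f z) \<le> C * exp (\<delta> * \<bar>Im z\<bar>)" using C that by simp
      also have "\<dots> \<le> max C 0 * exp (\<delta> * \<bar>Im z\<bar>)" by (intro mult_right_mono) auto
      finally show ?thesis .
    qed
  qed auto
qed

lemma exp_type_bounded:
  assumes "\<And>z. z \<in> S \<Longrightarrow> norm (f z) \<le> C * exp (\<kappa> * \<bar>Im z\<bar>)"
  shows "exp_type \<kappa> f S"
proof (rule exp_typeI)
  fix \<epsilon> :: real assume "\<epsilon> > 0"
  show "\<exists>C. \<forall>z\<in>S. norm (f z) \<le> C * exp ((\<kappa> + \<epsilon>) * \<bar>Im z\<bar>)"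
  proof (intro exI ballI)
    fix z assume "z \<in> S"
    hence le: "norm (f z) \<le> C * exp (\<kappa> * \<bar>Im z\<bar>)" by (rule assms)
    moreover have "C \<ge> 0"
    proof -
      have "0 \<le> C * exp (\<kappa> * \<bar>Im z\<bar>)" using le norm_ge_zero order_trans by blast
      thus ?thesis by (simp add: zero_le_mult_iff)
    qed
    ultimately show "norm (f z) \<le> C * exp ((\<kappa> + \<epsilon>) * \<bar>Im z\<bar>)"
      using \<open>\<epsilon> > 0\<close> by (elim order_trans) (auto intro!: mult_left_mono mult_right_mono)
  qed
qed

text \<open>Each factor is given half of the slack.\<close>

lemma exp_type_mult:
  assumes "exp_type \<kappa> f S" "exp_type \<kappa>' g S"
  shows "exp_type (\<kappa> + \<kappa>') (\<lambda>z. f z * g z) S"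
proof (rule exp_typeI)
  fix \<epsilon> :: real assume "\<epsilon> > 0"
  obtain C where C: "C \<ge> 0" "\<And>z. z \<in> S \<Longrightarrow> norm (f z) \<le> C * exp ((\<kappa> + \<epsilon>/2) * \<bar>Im z\<bar>)"
    using exp_typeE[OF assms(1), of "\<kappa> + \<epsilon>/2"] \<open>\<epsilon> > 0\<close> by auto
  obtain C' where C': "C' \<ge> 0" "\<And>z. z \<in> S \<Longrightarrow> norm (g z) \<le> C' * exp ((\<kappa>' + \<epsilon>/2) * \<bar>Im z\<bar>)"
    using exp_typeE[OF assms(2), of "\<kappa>' + \<epsilon>/2"] \<open>\<epsilon> > 0\<close> by auto
  show "\<exists>C. \<forall>z\<in>S. norm (f z * g z) \<le> C * exp ((\<kappa> + \<kappa>' + \<epsilon>) * \<bar>Im z\<bar>)"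
  proof (intro exI ballI)
    fix z assume "z \<in> S"
    hence "norm (f z * g z) \<le> (C * exp ((\<kappa> + \<epsilon>/2) * \<bar>Im z\<bar>)) * (C' * exp ((\<kappa>' + \<epsilon>/2) * \<bar>Im z\<bar>))"
      unfolding norm_mult using C C' by (intro mult_mono) auto
    also have "\<dots> = (C * C') * exp ((\<kappa> + \<kappa>' + \<epsilon>) * \<bar>Im z\<bar>)"
      by (simp add: exp_add[symmetric] algebra_simps)
    finally show "norm (f z * g z) \<le> (C * C') * exp ((\<kappa> + \<kappa>' + \<epsilon>) * \<bar>Im z\<bar>)" .
  qed
qed

lemma exp_type_const: "exp_type 0 (\<lambda>_. c) S"
  by (rule exp_type_bounded[where C = "norm c"]) auto

text \<open>In a strip the norm grows linearly in |Im z|, and \<epsilon> y \<le> exp(\<epsilon> y)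
  hides this in the slack at the price of a constant 1 / \<epsilon>. Polynomial factors enter
  through this lemma.\<close>

lemma exp_type_ident:
  assumes "\<And>z. z \<in> S \<Longrightarrow> \<bar>Re z\<bar> \<le> R"
  shows "exp_type 0 (\<lambda>z. z) S"
proof (rule exp_typeI)
  fix \<epsilon> :: real assume \<epsilon>: "\<epsilon> > 0"
  show "\<exists>C. \<forall>z\<in>S. norm z \<le> C * exp ((0 + \<epsilon>) * \<bar>Im z\<bar>)"
  proof (intro exI ballI)
    fix z assume "z \<in> S"
    have "norm z \<le> \<bar>Re z\<bar> + \<bar>Im z\<bar>" by (rule cmod_le)
    also have "\<dots> \<le> \<bar>R\<bar> * exp (\<epsilon> * \<bar>Im z\<bar>) + (1 / \<epsilon>) * exp (\<epsilon> * \<bar>Im z\<bar>)"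
    proof (rule add_mono)
      have "\<bar>Re z\<bar> \<le> \<bar>R\<bar> * 1" using assms[OF \<open>z \<in> S\<close>] by simp
      also have "\<dots> \<le> \<bar>R\<bar> * exp (\<epsilon> * \<bar>Im z\<bar>)"
        using \<epsilon> by (intro mult_left_mono) auto
      finally show "\<bar>Re z\<bar> \<le> \<bar>R\<bar> * exp (\<epsilon> * \<bar>Im z\<bar>)" .
      have "\<epsilon> * \<bar>Im z\<bar> \<le> exp (\<epsilon> * \<bar>Im z\<bar>)"
        using exp_ge_add_one_self[of "\<epsilon> * \<bar>Im z\<bar>"] by linarith
      thus "\<bar>Im z\<bar> \<le> 1 / \<epsilon> * exp (\<epsilon> * \<bar>Im z\<bar>)" using \<epsilon> by (simp add: field_simps)
    qed
    finally show "norm z \<le> (\<bar>R\<bar> + 1 / \<epsilon>) * exp ((0 + \<epsilon>) * \<bar>Im z\<bar>)"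
      by (simp add: algebra_simps)
  qed
qed

text \<open>Only imaginary parts count: a real slope stretches them by |r|, and the offset b costs a
  constant factor.\<close>

lemma exp_type_affine:
  assumes "exp_type \<kappa> f T" "\<And>z. z \<in> S \<Longrightarrow> b + of_real r * z \<in> T"
  shows "exp_type (\<kappa> * \<bar>r\<bar>) (\<lambda>z. f (b + of_real r * z)) S"
proof (cases "r = 0")
  case True
  thus ?thesis using exp_type_const by simp
next
  case False
  show ?thesis
  proof (rule exp_typeI)
    fix \<epsilon> :: real assume \<epsilon>: "\<epsilon> > 0"
    \<comment> \<open>Chosen so that \<delta> |r| = \<kappa> |r| + \<epsilon>.\<close>
    define \<delta> where "\<delta> = \<kappa> + \<epsilon> / \<bar>r\<bar>"
    obtain C where C: "C \<ge> 0" "\<And>z. z \<in> T \<Longrightarrow> norm (f z) \<le> C * exp (\<delta> * \<bar>Im z\<bar>)"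
      using exp_typeE[OF assms(1), of \<delta>] \<epsilon> False by (auto simp: \<delta>_def)
    show "\<exists>C. \<forall>z\<in>S. norm (f (b + of_real r * z)) \<le> C * exp ((\<kappa> * \<bar>r\<bar> + \<epsilon>) * \<bar>Im z\<bar>)"
    proof (intro exI ballI)
      fix z assume "z \<in> S"
      hence "norm (f (b + of_real r * z)) \<le> C * exp (\<delta> * \<bar>Im b + r * Im z\<bar>)"
        using C(2)[OF assms(2)] by simp
      also have "\<dots> \<le> C * exp (\<bar>\<delta>\<bar> * \<bar>Im b\<bar> + \<delta> * \<bar>r\<bar> * \<bar>Im z\<bar>)"
      proof -
        \<comment> \<open>\<delta> may be negative, for decaying functions. Hence the triangle
          inequality is applied to the difference of the two moduli, which serves both
          signs.\<close>
        have "\<delta> * (\<bar>Im b + r * Im z\<bar> - \<bar>r * Im z\<bar>) \<le> \<bar>\<delta>\<bar> * \<bar>Im b\<bar>"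
        proof -
          have "\<delta> * (\<bar>Im b + r * Im z\<bar> - \<bar>r * Im z\<bar>)
              \<le> \<bar>\<delta>\<bar> * \<bar>\<bar>Im b + r * Im z\<bar> - \<bar>r * Im z\<bar>\<bar>"
            by (metis abs_ge_self abs_mult)
          also have "\<dots> \<le> \<bar>\<delta>\<bar> * \<bar>Im b\<bar>"
            by (intro mult_left_mono) linarith+
          finally show ?thesis .
        qed
        hence "\<delta> * \<bar>Im b + r * Im z\<bar> \<le> \<bar>\<delta>\<bar> * \<bar>Im b\<bar> + \<delta> * \<bar>r\<bar> * \<bar>Im z\<bar>"
          by (simp add: algebra_simps abs_mult)
        thus ?thesis using C(1) by (intro mult_left_mono) auto
      qed
      also have "\<dots> = C * exp (\<bar>\<delta>\<bar> * \<bar>Im b\<bar>) * exp ((\<kappa> * \<bar>r\<bar> + \<epsilon>) * \<bar>Im z\<bar>)"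
        using False by (simp add: exp_add \<delta>_def algebra_simps)
      finally show "norm (f (b + of_real r * z))
          \<le> C * exp (\<bar>\<delta>\<bar> * \<bar>Im b\<bar>) * exp ((\<kappa> * \<bar>r\<bar> + \<epsilon>) * \<bar>Im z\<bar>)" .
    qed
  qed
qed

lemma exp_type_linear:
  assumes "\<And>z. z \<in> S \<Longrightarrow> \<bar>Re z\<bar> \<le> R"
  shows "exp_type 0 (\<lambda>z. b + of_real r * z) S"
proof -
  have "exp_type (0 * \<bar>r\<bar>) (\<lambda>z. b + of_real r * z) S"
  proof (rule exp_type_affine[where f = "\<lambda>z. z" and T = "{z. \<bar>Re z\<bar> \<le> \<bar>Re b\<bar> + \<bar>r\<bar> * \<bar>R\<bar>}"])
    fix z assume "z \<in> S"
    have "\<bar>Re b + r * Re z\<bar> \<le> \<bar>Re b\<bar> + \<bar>r\<bar> * \<bar>Re z\<bar>"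
      by (metis abs_mult abs_triangle_ineq)
    also have "\<dots> \<le> \<bar>Re b\<bar> + \<bar>r\<bar> * \<bar>R\<bar>"
      using assms[OF \<open>z \<in> S\<close>] by (intro add_left_mono mult_left_mono) auto
    finally show "b + of_real r * z \<in> {z. \<bar>Re z\<bar> \<le> \<bar>Re b\<bar> + \<bar>r\<bar> * \<bar>R\<bar>}" by simp
  qed (rule exp_type_ident, auto)
  thus ?thesis by simp
qed

lemma exp_type_pochhammer:
  assumes "\<And>z. z \<in> S \<Longrightarrow> \<bar>Re z\<bar> \<le> R"
  shows "exp_type 0 (\<lambda>z. pochhammer z n) S"
proof (induction n)
  case 0
  show ?case by (simp add: exp_type_const)
next
  case (Suc n)
  have "exp_type (0 + 0) (\<lambda>z. pochhammer z n * (of_nat n + of_real 1 * z)) S"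
    by (intro exp_type_mult Suc exp_type_linear[OF assms])
  thus ?case by (simp add: pochhammer_Suc add_ac)
qed

section \<open>Gamma and its reciprocal in vertical strips\<close>

text \<open>To the right of 1/2, monotonicity against the line Re z = 1/2 bounds |Gamma| from below.
  A shift by N brings the whole strip there, and the recurrence returns through a Pochhammer factor
  of type 0.\<close>

lemma exp_type_rGamma: "exp_type (pi / 2) rGamma {z. \<bar>Re z\<bar> \<le> R}"
proof -
  obtain N :: nat where N: "R + 1/2 \<le> real N" using real_arch_simple by blast
  obtain K where K: "\<And>x. x \<in> {1/2..R + real N} \<Longrightarrow> norm (rGamma x) \<le> (K::real)"
  proof -
    have "compact (rGamma ` {1/2..R + real N})"
      by (intro compact_continuous_image continuous_intros) auto
    thus ?thesis using that unfolding compact_eq_bounded_closed bounded_iff by blast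
  qed
  have "exp_type (pi / 2) rGamma {z. Re z \<in> {1/2..R + real N}}"
  proof (rule exp_type_bounded)
    fix z assume "z \<in> {z. Re z \<in> {1/2..R + real N}}"
    hence z: "Re z \<ge> 1/2" "Re z \<in> {1/2..R + real N}" by auto
    have pos: "Gamma (Re z) > 0" using z by (intro Gamma_real_pos) auto
    have nz: "Gamma z \<noteq> 0" using z by (auto simp: Gamma_eq_zero_iff elim!: nonpos_Ints_cases')
    have "sqrt pi * exp (- (pi / 2) * \<bar>Im z\<bar>) * Gamma (Re z)
        \<le> norm (Gamma (Complex (1/2) (Im z))) * Gamma (Re z)"
      using pos by (intro mult_right_mono norm_Gamma_half_bounds) auto
    also have "\<dots> \<le> norm (Gamma z) * sqrt pi"
      using norm_Gamma_ratio_mono[of "1/2" "Re z" "Im z"] z by (simp add: Gamma_one_half_real)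
    finally have "exp (- (pi / 2) * \<bar>Im z\<bar>) * Gamma (Re z) \<le> norm (Gamma z)" by simp
    hence "norm (rGamma z) \<le> 1 / (exp (- (pi / 2) * \<bar>Im z\<bar>) * Gamma (Re z))"
      unfolding rGamma_inverse_Gamma inverse_eq_divide norm_divide norm_one using pos nz
      by (intro divide_left_mono mult_pos_pos) (auto intro: less_le_trans[OF mult_pos_pos])
    also have "\<dots> = rGamma (Re z) * exp (pi / 2 * \<bar>Im z\<bar>)"
      by (simp add: rGamma_inverse_Gamma exp_minus field_simps)
    also have "\<dots> \<le> K * exp (pi / 2 * \<bar>Im z\<bar>)"
      using K[OF z(2)] by (intro mult_right_mono) auto
    finally show "norm (rGamma z) \<le> K * exp (pi / 2 * \<bar>Im z\<bar>)" .
  qed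
  hence "exp_type (pi / 2 * \<bar>1\<bar>) (\<lambda>z. rGamma (of_nat N + of_real 1 * z)) {z. \<bar>Re z\<bar> \<le> R}"
    by (rule exp_type_affine) (use N in auto)
  hence "exp_type (0 + pi / 2) (\<lambda>z. pochhammer z N * rGamma (z + of_nat N)) {z. \<bar>Re z\<bar> \<le> R}"
    by (intro exp_type_mult exp_type_pochhammer) (auto simp: add_ac)
  thus ?thesis by (simp flip: pochhammer_rGamma)
qed

text \<open>An upper bound needs the comparison from the other side: with a line to the right of the
  strip, where the recurrence down to Re z = 1/2 gives the decay. The domain stays clear of the
  poles, so returning from z + N to z divides only by factors of norm at least 1/2.\<close>

lemma exp_type_Gamma:
  "exp_type (- (pi / 2)) Gamma {z. \<bar>Re z\<bar> \<le> R \<and> (1/2 \<le> Re z \<or> 1 \<le> \<bar>Im z\<bar>)}"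
proof -
  obtain N :: nat where N: "R + 1/2 \<le> real N" using real_arch_simple by blast
  obtain M :: nat where M: "R + real N \<le> real M" using real_arch_simple by blast
  \<comment> \<open>To the right of Re z + N for all z in the strip, and a half-integer, so that the
    recurrence leads from it exactly to Re z = 1/2.\<close>
  define X where "X = real M + 1 / 2"
  obtain K where K: "\<And>x. x \<in> {1/2..X} \<Longrightarrow> norm (Gamma x) \<le> (K::real)"
  proof -
    have "compact (Gamma ` {1/2..X})"
      by (intro compact_continuous_image continuous_intros)
        (auto elim!: nonpos_Ints_cases')
    thus ?thesis using that unfolding compact_eq_bounded_closed bounded_iff by blast
  qed
  have half: "exp_type (- (pi / 2)) (\<lambda>z. Gamma (Complex (1/2) (Im z))) UNIV"
    by (rule exp_type_bounded) (use norm_Gamma_half_bounds(2) in auto)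
  have shift: "exp_type (- (pi / 2)) (\<lambda>z. Gamma (Complex X (Im z))) UNIV"
  proof -
    have X: "Complex X y = Complex (1/2) y + of_nat M" for y
      by (simp add: X_def complex_eq_iff)
    have *: "Gamma (Complex X (Im z)) = pochhammer (Complex (1/2) (Im z)) M * Gamma (Complex (1/2) (Im z))" for z
    proof -
      have "Complex (1/2) (Im z) \<notin> \<int>\<^sub>\<le>\<^sub>0" by (auto elim!: nonpos_Ints_cases' simp: complex_eq_iff)
      thus ?thesis unfolding X
        by (subst pochhammer_Gamma) (auto simp: Gamma_eq_zero_iff)
    qed
    have P: "exp_type 0 (\<lambda>z. pochhammer z M) {z. Re z = 1/2}"
      by (rule exp_type_pochhammer[where R = "1/2"]) auto
    have "exp_type 0 (\<lambda>z. pochhammer (Complex (1/2) (Im z)) M) UNIV"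
    proof (rule exp_typeI)
      fix \<epsilon> :: real assume "\<epsilon> > 0"
      then obtain C where C: "\<And>z. z \<in> {z. Re z = 1/2} \<Longrightarrow> norm (pochhammer z M) \<le> C * exp (\<epsilon> * \<bar>Im z\<bar>)"
        using exp_typeE[OF P] by metis
      show "\<exists>C. \<forall>z\<in>UNIV. norm (pochhammer (Complex (1/2) (Im z)) M) \<le> C * exp ((0 + \<epsilon>) * \<bar>Im z\<bar>)"
        using C[of "Complex (1/2) (Im z)" for z] by auto
    qed
    from exp_type_mult[OF this half] show ?thesis by (simp add: *)
  qed
  have right: "exp_type (- (pi / 2)) Gamma {z. Re z \<in> {1/2..X}}"
  proof (rule exp_typeI)
    fix \<epsilon> :: real assume "\<epsilon> > 0"
    then obtain C where C: "C \<ge> 0"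
      "\<And>z. norm (Gamma (Complex X (Im z))) \<le> C * exp ((- (pi/2) + \<epsilon>) * \<bar>Im z\<bar>)"
      using exp_typeE[OF shift, of "- (pi/2) + \<epsilon>"] by auto
    have GX: "Gamma X > 0" by (intro Gamma_real_pos) (auto simp: X_def)
    show "\<exists>C. \<forall>z\<in>{z. Re z \<in> {1/2..X}}. norm (Gamma z) \<le> C * exp ((- (pi/2) + \<epsilon>) * \<bar>Im z\<bar>)"
    proof (intro exI ballI)
      fix z assume "z \<in> {z. Re z \<in> {1/2..X}}"
      hence z: "Re z \<in> {1/2..X}" by simp
      have "norm (Gamma z) * Gamma X \<le> norm (Gamma (Complex X (Im z))) * Gamma (Re z)"
        using norm_Gamma_ratio_mono[of "Re z" X "Im z"] z by simp
      also have "\<dots> \<le> (C * exp ((- (pi/2) + \<epsilon>) * \<bar>Im z\<bar>)) * K"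
        using C K[OF z] z by (intro mult_mono) (auto intro!: less_imp_le Gamma_real_pos)
      finally show "norm (Gamma z) \<le> (C * K / Gamma X) * exp ((- (pi/2) + \<epsilon>) * \<bar>Im z\<bar>)"
        using GX by (simp add: field_simps)
    qed
  qed
  let ?S = "{z. \<bar>Re z\<bar> \<le> R \<and> (1/2 \<le> Re z \<or> 1 \<le> \<bar>Im z\<bar>)}"
  have "exp_type (- (pi / 2) * \<bar>1\<bar>) (\<lambda>z. Gamma (of_nat N + of_real 1 * z)) ?S"
    by (rule exp_type_affine[OF right]) (use N M in \<open>auto simp: X_def abs_le_iff\<close>)
  hence g: "exp_type (- (pi / 2)) (\<lambda>z. Gamma (of_nat N + z)) ?S" by simp
  show ?thesis
  proof (rule exp_typeI)
    fix \<epsilon> :: real assume "\<epsilon> > 0"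
    then obtain C where C: "C \<ge> 0"
      "\<And>z. z \<in> ?S \<Longrightarrow> norm (Gamma (of_nat N + z)) \<le> C * exp ((- (pi/2) + \<epsilon>) * \<bar>Im z\<bar>)"
      using exp_typeE[OF g, of "- (pi/2) + \<epsilon>"] by auto
    show "\<exists>C. \<forall>z\<in>?S. norm (Gamma z) \<le> C * exp ((- (pi/2) + \<epsilon>) * \<bar>Im z\<bar>)"
    proof (intro exI ballI)
      fix z assume z: "z \<in> ?S"
      have nz: "z \<notin> \<int>\<^sub>\<le>\<^sub>0" using z by (auto elim!: nonpos_Ints_cases')
      have "(1/2) ^ N \<le> norm (pochhammer z N)"
      proof -
        have "(\<Prod>k=0..<N. 1/2) \<le> (\<Prod>k=0..<N. norm (z + of_nat k))"
        proof (intro prod_mono conjI)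
          fix k
          show "1/2 \<le> norm (z + of_nat k)"
            using z abs_Re_le_cmod[of "z + of_nat k"] abs_Im_le_cmod[of "z + of_nat k"] by auto
        qed auto
        thus ?thesis by (simp add: pochhammer_prod prod_norm)
      qed
      moreover have "norm (pochhammer z N) * norm (Gamma z) = norm (Gamma (of_nat N + z))"
        using pochhammer_Gamma[OF nz, of N] nz by (simp add: norm_divide add_ac Gamma_eq_zero_iff)
      ultimately have "(1/2) ^ N * norm (Gamma z) \<le> C * exp ((- (pi/2) + \<epsilon>) * \<bar>Im z\<bar>)"
        using C(2)[OF z] by (metis mult_right_mono norm_ge_zero order_trans)
      thus "norm (Gamma z) \<le> (2 ^ N * C) * exp ((- (pi/2) + \<epsilon>) * \<bar>Im z\<bar>)"
        by (simp add: field_simps power_divide)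
    qed
  qed
qed

section \<open>Superpositions of power functions and the complex Beta integral\<close>

lemma of_real_powr_eq_exp: "t > 0 \<Longrightarrow> of_real t powr (s::complex) = exp (s * of_real (ln t))"
  by (simp add: powr_def Ln_of_real)

lemma norm_of_real_powr: "t \<ge> 0 \<Longrightarrow> norm (of_real t powr (s::complex)) = t powr Re s"
  by (simp add: norm_powr_real_powr)

lemma has_vector_derivative_of_real_powr:
  assumes "x > 0"
  shows "((\<lambda>x. of_real x powr (s::complex)) has_vector_derivative s * of_real x powr (s - 1)) (at x within S)"
  by (rule has_vector_derivative_real_field)
     (use assms in \<open>auto intro!: derivative_eq_intros simp: complex_nonpos_Reals_iff\<close>)

text \<open>The form in which dominated convergence can act, along sequences tending to x.\<close>

lemma has_vector_derivative_iff_quotient: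
  fixes f :: "real \<Rightarrow> 'a::real_normed_vector"
  shows "(f has_vector_derivative D) (at x)
    \<longleftrightarrow> ((\<lambda>y. (f y - f x) /\<^sub>R (y - x)) \<longlongrightarrow> D) (at x)"
proof -
  have eq: "norm (f y - f x - (y - x) *\<^sub>R D) / norm (y - x) = norm ((f y - f x) /\<^sub>R (y - x) - D)"
    if "y \<noteq> x" for y
  proof -
    have "(f y - f x) /\<^sub>R (y - x) - D = (f y - f x - (y - x) *\<^sub>R D) /\<^sub>R (y - x)"
      using that by (simp add: scaleR_diff_right)
    thus ?thesis using that by (simp add: divide_inverse)
  qed
  have "(f has_vector_derivative D) (at x)
      \<longleftrightarrow> ((\<lambda>y. norm (f y - f x - (y - x) *\<^sub>R D) / norm (y - x)) \<longlongrightarrow> 0) (at x)"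
    by (simp add: has_vector_derivative_def has_derivative_iff_norm bounded_linear_scaleR_left)
  also have "\<dots> \<longleftrightarrow> ((\<lambda>y. norm ((f y - f x) /\<^sub>R (y - x) - D)) \<longlongrightarrow> 0) (at x)"
    by (intro filterlim_cong refl) (auto simp: eventually_at_filter eq[simplified])
  also have "\<dots> \<longleftrightarrow> ((\<lambda>y. (f y - f x) /\<^sub>R (y - x)) \<longlongrightarrow> D) (at x)"
    by (simp add: tendsto_norm_zero_iff LIM_zero_iff)
  finally show ?thesis .
qed

text \<open>A power is monotone in x, in a direction given by the sign of r. The sum of the end
  values covers both, as is needed when the exponent varies with the integration variable and has no
  fixed sign.\<close>

lemma powr_le_add_powr:
  fixes a b x r :: real
  assumes "0 < a" "a \<le> x" "x \<le> b"
  shows "x powr r \<le> a powr r + b powr r"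
proof (cases "r \<ge> 0")
  case True
  thus ?thesis using assms powr_mono2[of r x b] by (simp add: add_increasing)
next
  case False
  thus ?thesis using assms powr_mono2'[of r a x] by (simp add: add_increasing2)
qed

text \<open>The derived integrand at the two ends of an interval around x0 dominates it on the whole
  interval, and by the mean value inequality also the difference quotients. So integrability at each
  single x supplies the majorant.\<close>

lemma has_vector_derivative_integral_powr:
  fixes g \<rho> :: "'b \<Rightarrow> complex"
  assumes int: "\<And>x. x > 0 \<Longrightarrow> integrable M (\<lambda>y. g y * of_real x powr \<rho> y)"
    and int': "\<And>x. x > 0 \<Longrightarrow> integrable M (\<lambda>y. g y * \<rho> y * of_real x powr (\<rho> y - 1))"
    and x0: "x0 > (0::real)"
  shows "((\<lambda>x. \<integral>y. g y * of_real x powr \<rho> y \<partial>M) has_vector_derivative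
           (\<integral>y. g y * \<rho> y * of_real x0 powr (\<rho> y - 1) \<partial>M)) (at x0)"
proof -
  define a b where "a = x0 / 2" and "b = 2 * x0"
  have ab: "0 < a" "a < x0" "x0 < b" using x0 by (auto simp: a_def b_def)
  define D where "D = (\<lambda>x y. g y * \<rho> y * of_real x powr (\<rho> y - 1))"
  define F where "F = (\<lambda>x y. g y * of_real x powr \<rho> y)"
  define h where "h = (\<lambda>y. norm (D a y) + norm (D b y))"
  have h: "integrable M h"
    unfolding h_def D_def using ab by (intro Bochner_Integration.integrable_add integrable_norm int') auto
  have D_le: "norm (D x y) \<le> h y" if "x \<in> {a..b}" for x y
  proof -
    have "norm (D x y) = norm (g y * \<rho> y) * x powr Re (\<rho> y - 1)"
      using that ab by (simp add: D_def norm_mult norm_of_real_powr)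
    also have "\<dots> \<le> norm (g y * \<rho> y) * (a powr Re (\<rho> y - 1) + b powr Re (\<rho> y - 1))"
      using that ab by (intro mult_left_mono powr_le_add_powr) auto
    also have "\<dots> = h y"
      using ab by (simp add: h_def D_def norm_mult norm_of_real_powr algebra_simps)
    finally show ?thesis .
  qed
  have der: "((\<lambda>x. F x y) has_vector_derivative D x y) (at x within S)" if "x > 0" for x y S
    unfolding F_def D_def
    using has_vector_derivative_mult_right[OF has_vector_derivative_of_real_powr[OF that]]
    by (simp add: mult.assoc)
  have diff_le: "norm (F x y - F x0 y) \<le> h y * norm (x - x0)" if "x \<in> {a..b}" for x y
  proof (rule differentiable_bound)
    show "((\<lambda>x. F x y) has_derivative (\<lambda>t. t *\<^sub>R D x y)) (at x within {a..b})" if "x \<in> {a..b}" for x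
      using der[of x y] that ab by (simp add: has_vector_derivative_def)
    show "onorm (\<lambda>t. t *\<^sub>R D x y) \<le> h y" if "x \<in> {a..b}" for x
      using D_le[OF that, of y] by (simp add: onorm_scaleR_left bounded_linear_ident onorm_id)
  qed (use that ab in auto)
  have "((\<lambda>x. ((\<integral>y. F x y \<partial>M) - (\<integral>y. F x0 y \<partial>M)) /\<^sub>R (x - x0)) \<longlongrightarrow> (\<integral>y. D x0 y \<partial>M)) (at x0 within {a..b})"
    unfolding tendsto_at_iff_sequentially
  proof (intro allI impI)
    fix X :: "nat \<Rightarrow> real"
    assume X: "\<forall>i. X i \<in> {a..b} - {x0}" and lim: "X \<longlonglongrightarrow> x0"
    have Xpos: "X i > 0" "X i \<in> {a..b}" "X i \<noteq> x0" for i using X ab by (auto intro: less_le_trans)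
    have intF: "integrable M (F x)" if "x > 0" for x
      using int[OF that] by (simp add: F_def)
    have "(\<lambda>i. \<integral>y. (F (X i) y - F x0 y) /\<^sub>R (X i - x0) \<partial>M) \<longlonglongrightarrow> (\<integral>y. D x0 y \<partial>M)"
    proof (rule integral_dominated_convergence[where w = h])
      show "D x0 \<in> borel_measurable M"
        using int'[OF x0] by (simp add: D_def)
      show "(\<lambda>y. (F (X i) y - F x0 y) /\<^sub>R (X i - x0)) \<in> borel_measurable M" for i
        using intF[OF Xpos(1)] intF[OF x0] by measurable
      show "AE y in M. (\<lambda>i. (F (X i) y - F x0 y) /\<^sub>R (X i - x0)) \<longlonglongrightarrow> D x0 y"
      proof (rule AE_I2)
        fix y
        have "((\<lambda>x. (F x y - F x0 y) /\<^sub>R (x - x0)) \<longlongrightarrow> D x0 y) (at x0)"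
          using der[OF x0, of y UNIV] by (simp add: has_vector_derivative_iff_quotient)
        thus "(\<lambda>i. (F (X i) y - F x0 y) /\<^sub>R (X i - x0)) \<longlonglongrightarrow> D x0 y"
          using lim Xpos(3) unfolding tendsto_at_iff_sequentially comp_def by auto
      qed
      show "AE y in M. norm ((F (X i) y - F x0 y) /\<^sub>R (X i - x0)) \<le> h y" for i
      proof (rule AE_I2)
        fix y
        show "norm ((F (X i) y - F x0 y) /\<^sub>R (X i - x0)) \<le> h y"
          using diff_le[OF Xpos(2)[of i], of y] Xpos(3)[of i]
          by (simp add: pos_divide_le_eq divide_inverse[symmetric] mult.commute[of "inverse _"])
      qed
    qed (rule h)
    also have "(\<lambda>i. \<integral>y. (F (X i) y - F x0 y) /\<^sub>R (X i - x0) \<partial>M) =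
        (\<lambda>x. ((\<integral>y. F x y \<partial>M) - (\<integral>y. F x0 y \<partial>M)) /\<^sub>R (x - x0)) \<circ> X"
      using intF Xpos x0 by (simp add: fun_eq_iff Bochner_Integration.integral_diff)
    finally show "((\<lambda>x. ((\<integral>y. F x y \<partial>M) - (\<integral>y. F x0 y \<partial>M)) /\<^sub>R (x - x0)) \<circ> X)
        \<longlonglongrightarrow> (\<integral>y. D x0 y \<partial>M)" .
  qed
  moreover have "at x0 within {a..b} = at x0"
    using ab by (intro at_within_interior) auto
  ultimately show ?thesis
    by (simp add: has_vector_derivative_iff_quotient F_def D_def)
qed

text \<open>\<open>nth_vderiv\<close> iterates a total operator, so values and existence are proved
  together. Each equality is known on the open half line, hence near every t, and this lets the next
  derivative be taken.\<close>

lemma nth_vderiv_chain: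
  fixes f :: "real \<Rightarrow> 'a::real_normed_vector"
  assumes f: "\<And>t. t > 0 \<Longrightarrow> f t = F 0 t"
    and F: "\<And>k t. k < n \<Longrightarrow> t > 0 \<Longrightarrow> (F k has_vector_derivative F (Suc k) t) (at t)"
  shows nth_vderiv_chain_eq: "\<And>k t. k \<le> n \<Longrightarrow> t > 0 \<Longrightarrow> nth_vderiv k f t = F k t"
    and times_differentiable_chain: "times_differentiable_on n f {0<..}"
proof -
  have eq: "nth_vderiv k f t = F k t" and der: "k < n \<Longrightarrow> (nth_vderiv k f has_vector_derivative F (Suc k) t) (at t)"
    if "k \<le> n" "t > 0" for k t
  proof -
    have *: "(nth_vderiv k f has_vector_derivative F (Suc k) t) (at t)"
      if "\<forall>t>0. nth_vderiv k f t = F k t" "k < n" "t > 0" for k t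
      by (rule has_vector_derivative_transform_within_open[OF F[OF that(2,3)], of "{0<..}"])
         (use that in auto)
    have "\<forall>t>0. nth_vderiv k f t = F k t" using \<open>k \<le> n\<close>
    proof (induction k)
      case 0
      thus ?case using f by (simp add: nth_vderiv_def)
    next
      case (Suc k)
      hence "\<forall>t>0. (nth_vderiv k f has_vector_derivative F (Suc k) t) (at t)"
        using * by auto
      thus ?case by (auto simp: nth_vderiv_def intro!: vector_derivative_at)
    qed
    thus "nth_vderiv k f t = F k t" "k < n \<Longrightarrow> (nth_vderiv k f has_vector_derivative F (Suc k) t) (at t)"
      using \<open>t > 0\<close> * by auto
  qed
  thus "\<And>k t. k \<le> n \<Longrightarrow> t > 0 \<Longrightarrow> nth_vderiv k f t = F k t" by blast
  show "times_differentiable_on n f {0<..}"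
    unfolding times_differentiable_on_def using der
    by (auto intro!: differentiableI_vector)
qed

section \<open>Gamma integral, Riemann-Liouville kernel and complex Beta integral\<close>

lemma Re_pos_not_nonpos_Ints: "Re z > 0 \<Longrightarrow> z \<notin> \<int>\<^sub>\<le>\<^sub>0"
  by (auto elim!: nonpos_Ints_cases')

text \<open>Carries the Gamma integral from the completed measure to \<open>lborel\<close>, over
  which Fubini is applied below.\<close>

lemma Gamma_integral_lborel:
  assumes "Re z > 0"
  shows "integrable lborel (\<lambda>t. indicator {0<..} t *\<^sub>R (of_real t powr (z - 1) / of_real (exp t)))"
    and "(\<integral>t. indicator {0<..} t *\<^sub>R (of_real t powr (z - 1) / of_real (exp t)) \<partial>lborel) = Gamma z"
proof -
  let ?f = "\<lambda>t. indicator {0<..} t *\<^sub>R (of_real t powr (z - 1) / of_real (exp t))"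
  have "?f = (\<lambda>t. indicator {0<..} t *\<^sub>R (exp ((z - 1) * of_real (ln t)) / of_real (exp t)))"
    by (auto simp: fun_eq_iff indicator_def of_real_powr_eq_exp)
  moreover have "\<dots> \<in> borel_measurable borel"
    by measurable
  ultimately have meas: "?f \<in> borel_measurable borel" by simp
  have int: "integrable lebesgue ?f"
    using absolutely_integrable_Gamma_integral'[OF assms] by (simp add: set_integrable_def)
  thus "integrable lborel ?f"
    using integrable_completion meas by (simp add: integrable_completion)
  have "(\<integral>t. ?f t \<partial>lebesgue) = Gamma z"
    using set_lebesgue_integral_eq_integral(2)[OF absolutely_integrable_Gamma_integral'[OF assms]]
      integral_unique[OF Gamma_integral_complex'[OF assms]]
    by (simp add: set_lebesgue_integral_def)
  thus "(\<integral>t. ?f t \<partial>lborel) = Gamma z"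
    using meas by (simp add: integral_completion)
qed

text \<open>The integrand of the fractional integral of \<tau>^(z - 1) from 0 to u, without the
  factor 1 / Gamma(b), extended by 0 to the whole line. The open interval drops both singular end
  points.\<close>

definition RL_kernel :: "real \<Rightarrow> complex \<Rightarrow> real \<Rightarrow> real \<Rightarrow> complex" where
  "RL_kernel b z u \<tau> = indicator {0<..<u} \<tau> *\<^sub>R ((u - \<tau>) powr (b - 1) *\<^sub>R of_real \<tau> powr (z - 1))"

text \<open>In this form, with \<open>exp\<close> and \<open>ln\<close> in place of a complex power,
  measurability is automatic.\<close>

lemma RL_kernel_exp:
  "RL_kernel b z u \<tau> = indicator {0<..<u} \<tau> *\<^sub>R ((u - \<tau>) powr (b - 1) *\<^sub>R exp ((z - 1) * of_real (ln \<tau>)))"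
  by (auto simp: RL_kernel_def indicator_def of_real_powr_eq_exp)

text \<open>The spelling \<open>0 + u * x\<close> is that of the affine substitution rule. The
  degree is z + b - 2; the factor u from the substitution later raises it to z + b - 1.\<close>

lemma RL_kernel_scale:
  assumes "u > 0"
  shows "RL_kernel b z u (0 + u * x) = of_real u powr (z + of_real b - 2) * RL_kernel b z 1 x"
proof (cases "x \<in> {0<..<1}")
  case True
  have "u - u * x = u * (1 - x)" by (simp add: algebra_simps)
  moreover have "of_real u powr (z + of_real b - 2) = of_real (u powr (b - 1)) * of_real u powr (z - 1)"
    using assms by (simp add: of_real_powr_eq_exp powr_def[of u] exp_add[symmetric] algebra_simps flip: exp_of_real)
  ultimately show ?thesis using True assms
    by (simp add: RL_kernel_def powr_mult scaleR_conv_of_real powr_times_real mult_ac)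
next
  case False
  have "u * x \<in> {0<..<u} \<longleftrightarrow> x \<in> {0<..<1}"
    using assms by (auto simp: zero_less_mult_iff)
  thus ?thesis using False by (simp add: RL_kernel_def)
qed

text \<open>The modulus of a kernel is a kernel with real exponent, so integrals of norms are
  instances of the complex formulas.\<close>

lemma norm_RL_kernel: "of_real (norm (RL_kernel b z u \<tau>)) = RL_kernel b (of_real (Re z)) u \<tau>"
proof (cases "\<tau> \<in> {0<..<u}")
  case True
  hence "of_real \<tau> powr (of_real (Re z) - 1) = complex_of_real (\<tau> powr (Re z - 1))"
    using powr_of_real[of \<tau> "Re z - 1"] by simp
  thus ?thesis using True by (simp add: RL_kernel_def norm_of_real_powr scaleR_conv_of_real norm_mult)
qed (simp add: RL_kernel_def)

lemma integrable_RL_kernel_1: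
  assumes "b > 0" "Re z > 0"
  shows "integrable lborel (RL_kernel b z 1)"
proof -
  have "(\<lambda>t. t powr (Re z - 1) * (1 - t) powr (b - 1)) absolutely_integrable_on {0..1}"
    using integrable_Beta'[of "Re z" b] assms
    by (subst absolutely_integrable_on_iff_nonneg) auto
  hence "integrable lborel (\<lambda>t. indicator {0..1} t *\<^sub>R (t powr (Re z - 1) * (1 - t) powr (b - 1)))"
    unfolding set_integrable_def by (subst (asm) integrable_completion) auto
  thus ?thesis
  proof (rule Bochner_Integration.integrable_bound)
    show "RL_kernel b z 1 \<in> borel_measurable lborel"
      unfolding RL_kernel_exp by measurable
    show "AE t in lborel. norm (RL_kernel b z 1 t) \<le> norm (indicat_real {0..1} t *\<^sub>R (t powr (Re z - 1) * (1 - t) powr (b - 1)))"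
      by (intro AE_I2) (auto simp: RL_kernel_def indicator_def norm_of_real_powr abs_mult)
  qed
qed

lemma integral_RL_kernel_scale:
  assumes "u > 0"
  shows "(\<integral>\<tau>. RL_kernel b z u \<tau> \<partial>lborel) = of_real u powr (z + of_real b - 1) * (\<integral>\<tau>. RL_kernel b z 1 \<tau> \<partial>lborel)"
proof -
  have "(\<integral>\<tau>. RL_kernel b z u \<tau> \<partial>lborel) = u *\<^sub>R (of_real u powr (z + of_real b - 2) * (\<integral>\<tau>. RL_kernel b z 1 \<tau> \<partial>lborel))"
    using assms by (subst lborel_integral_real_affine[where c = u and t = 0]) (simp_all only: RL_kernel_scale, auto)
  also have "u *\<^sub>R (of_real u powr (z + of_real b - 2) * (\<integral>\<tau>. RL_kernel b z 1 \<tau> \<partial>lborel))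
      = (of_real u * of_real u powr (z + of_real b - 2)) * (\<integral>\<tau>. RL_kernel b z 1 \<tau> \<partial>lborel)"
    by (simp add: scaleR_conv_of_real)
  also have "of_real u * of_real u powr (z + of_real b - 2) = of_real u powr (z + of_real b - 1)"
    using assms powr_add[of "of_real u" "z + of_real b - 2" 1] by (simp add: mult.commute algebra_simps)
  finally show ?thesis .
qed

lemma integrable_RL_kernel:
  assumes "b > 0" "Re z > 0" "u > 0"
  shows "integrable lborel (RL_kernel b z u)"
proof -
  have "integrable lborel (\<lambda>x. RL_kernel b z u (0 + u * x))"
    unfolding RL_kernel_scale[OF assms(3)] using integrable_RL_kernel_1[OF assms(1,2)] by simp
  thus ?thesis using assms by (subst (asm) lborel_integrable_real_affine_iff) auto
qed

lemma integral_norm_RL_kernel: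
  assumes "u > 0"
  shows "(\<integral>\<tau>. norm (RL_kernel b z u \<tau>) \<partial>lborel) = u powr (Re z + b - 1) * (\<integral>\<tau>. norm (RL_kernel b z 1 \<tau>) \<partial>lborel)"
proof -
  have "complex_of_real (\<integral>\<tau>. norm (RL_kernel b z u \<tau>) \<partial>lborel) = (\<integral>\<tau>. RL_kernel b (of_real (Re z)) u \<tau> \<partial>lborel)"
    by (simp flip: integral_of_real norm_RL_kernel)
  also have "\<dots> = of_real u powr (of_real (Re z + b - 1)) * (\<integral>\<tau>. RL_kernel b (of_real (Re z)) 1 \<tau> \<partial>lborel)"
    using integral_RL_kernel_scale[OF assms] by simp
  also have "\<dots> = of_real (u powr (Re z + b - 1) * (\<integral>\<tau>. norm (RL_kernel b z 1 \<tau>) \<partial>lborel))"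
    using assms powr_of_real[of u "Re z + b - 1"] by (simp flip: integral_of_real norm_RL_kernel)
  finally show ?thesis by (simp only: of_real_eq_iff)
qed

text \<open>
  Fubini for \<open>exp (- u)\<close> times the kernel: integrating over \<open>\<tau>\<close> first gives \<open>\<Gamma>(z + b)\<close> times the
  integral, integrating over \<open>u\<close> first gives \<open>\<Gamma>(b) \<Gamma>(z)\<close>.
\<close>

lemma integral_RL_kernel_1:
  assumes "b > 0" "Re z > 0"
  shows "(\<integral>\<tau>. RL_kernel b z 1 \<tau> \<partial>lborel) = of_real (Gamma b) * Gamma z * rGamma (z + of_real b)"
proof -
  define I where "I = (\<integral>\<tau>. RL_kernel b z 1 \<tau> \<partial>lborel)"
  define J where "J = (\<integral>\<tau>. norm (RL_kernel b z 1 \<tau>) \<partial>lborel)"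
  define K where "K = (\<lambda>u \<tau>. exp (- u) *\<^sub>R RL_kernel b z u \<tau>)"
  have inner: "integrable lborel (K u)" for u
  proof (cases "u > 0")
    case True
    thus ?thesis unfolding K_def using integrable_RL_kernel[OF assms, of u] by simp
  qed (simp add: K_def RL_kernel_def)
  have "integrable (lborel \<Otimes>\<^sub>M lborel) (case_prod K)"
  proof (rule lborel_pair.Fubini_integrable)
    show "case_prod K \<in> borel_measurable (lborel \<Otimes>\<^sub>M lborel)"
    proof -
      have "case_prod K = (\<lambda>p. if 0 < snd p \<and> snd p < fst p then
          exp (- fst p) *\<^sub>R ((fst p - snd p) powr (b - 1) *\<^sub>R exp ((z - 1) * of_real (ln (snd p)))) else 0)"
        by (auto simp: K_def RL_kernel_exp fun_eq_iff)
      also have "\<dots> \<in> borel_measurable (lborel \<Otimes>\<^sub>M lborel)"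
        by measurable
      finally show ?thesis .
    qed
    show "AE u in lborel. integrable lborel (\<lambda>\<tau>. case_prod K (u, \<tau>))"
      using inner by simp
    \<comment> \<open>Integrated over \<tau>, the norm becomes J times u^(Re z + b - 1) exp(- u),
      the integrand of Gamma at Re z + b.\<close>
    have int: "integrable lborel (\<lambda>u. norm (indicator {0<..} u *\<^sub>R (of_real u powr ((z + of_real b) - 1) / of_real (exp u))) * J)"
    proof -
      have "Re (z + of_real b) > 0" using assms by simp
      from integrable_norm[OF Gamma_integral_lborel(1)[OF this]] show ?thesis
        by simp
    qed
    have "norm (indicator {0<..} u *\<^sub>R (of_real u powr ((z + of_real b) - 1) / of_real (exp u))) * J
        = (\<integral>\<tau>. norm (K u \<tau>) \<partial>lborel)" for u :: real
      proof (cases "u > 0")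
        case True
        hence "(\<integral>\<tau>. norm (K u \<tau>) \<partial>lborel) = exp (- u) * (u powr (Re z + b - 1) * J)"
          by (simp add: K_def integral_norm_RL_kernel[of u] flip: J_def)
        thus ?thesis using True by (simp add: norm_of_real_powr norm_mult norm_inverse norm_divide exp_minus divide_inverse)
      qed (simp add: K_def RL_kernel_def)
    with int show "integrable lborel (\<lambda>u. \<integral>\<tau>. norm (case_prod K (u, \<tau>)) \<partial>lborel)"
      by (simp only: prod.case)
  qed
  hence "(\<integral>\<tau>. (\<integral>u. K u \<tau> \<partial>lborel) \<partial>lborel) = (\<integral>u. (\<integral>\<tau>. K u \<tau> \<partial>lborel) \<partial>lborel)"
    by (rule lborel_pair.Fubini_integral)
  also have "(\<lambda>u. \<integral>\<tau>. K u \<tau> \<partial>lborel) = (\<lambda>u. indicator {0<..} u *\<^sub>R (of_real u powr ((z + of_real b) - 1) / of_real (exp u)) * I)"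
  proof (rule ext)
    fix u :: real
    show "(\<integral>\<tau>. K u \<tau> \<partial>lborel) = indicator {0<..} u *\<^sub>R (of_real u powr ((z + of_real b) - 1) / of_real (exp u)) * I"
    proof (cases "u > 0")
      case True
      hence "(\<integral>\<tau>. K u \<tau> \<partial>lborel) = exp (- u) *\<^sub>R (of_real u powr (z + of_real b - 1) * I)"
        by (simp add: K_def integral_RL_kernel_scale[of u] flip: I_def)
      thus ?thesis using True by (simp add: scaleR_conv_of_real exp_minus divide_inverse)
    qed (simp add: K_def RL_kernel_def)
  qed
  also have "(\<integral>u. indicator {0<..} u *\<^sub>R (of_real u powr ((z + of_real b) - 1) / of_real (exp u)) * I \<partial>lborel)
      = Gamma (z + of_real b) * I"
    using assms by (subst integral_mult_left_zero) (simp add: Gamma_integral_lborel(2))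
  also have "(\<lambda>\<tau>. \<integral>u. K u \<tau> \<partial>lborel) = (\<lambda>\<tau>. indicator {0<..} \<tau> *\<^sub>R (of_real \<tau> powr (z - 1) / of_real (exp \<tau>)) * of_real (Gamma b))"
  proof (rule ext)
    fix \<tau> :: real
    \<comment> \<open>The substitution u = \<tau> + x splits exp(- u) (u - \<tau>)^(b - 1) \<tau>^(z
      - 1) into a function of \<tau> times a function of x.\<close>
    have "K (\<tau> + 1 * x) \<tau> = (indicator {0<..} \<tau> *\<^sub>R (of_real \<tau> powr (z - 1) / of_real (exp \<tau>)))
            * (indicator {0<..} x *\<^sub>R (of_real x powr (of_real b - 1) / of_real (exp x)))" for x
    proof (cases "0 < \<tau> \<and> 0 < x")
      case True
      have "of_real x powr (of_real b - 1) = complex_of_real (x powr (b - 1))"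
        using powr_of_real[of x "b - 1"] True by simp
      thus ?thesis using True
        by (simp add: K_def RL_kernel_def exp_minus exp_add scaleR_conv_of_real divide_inverse)
    qed (auto simp: K_def RL_kernel_def indicator_def)
    hence "(\<integral>u. K u \<tau> \<partial>lborel) = (\<integral>x. (indicator {0<..} \<tau> *\<^sub>R (of_real \<tau> powr (z - 1) / of_real (exp \<tau>)))
            * (indicator {0<..} x *\<^sub>R (of_real x powr (of_real b - 1) / of_real (exp x))) \<partial>lborel)"
      by (subst lborel_integral_real_affine[where c = 1 and t = \<tau>]) (simp_all del: mult_1_left)
    also have "\<dots> = (indicator {0<..} \<tau> *\<^sub>R (of_real \<tau> powr (z - 1) / of_real (exp \<tau>))) * Gamma (of_real b)"
      using assms by (subst integral_mult_right_zero) (simp add: Gamma_integral_lborel(2))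
    finally show "(\<integral>u. K u \<tau> \<partial>lborel) = indicator {0<..} \<tau> *\<^sub>R (of_real \<tau> powr (z - 1) / of_real (exp \<tau>)) * of_real (Gamma b)"
      by (simp add: Gamma_complex_of_real)
  qed
  also have "(\<integral>\<tau>. indicator {0<..} \<tau> *\<^sub>R (of_real \<tau> powr (z - 1) / of_real (exp \<tau>)) * of_real (Gamma b) \<partial>lborel)
      = Gamma z * of_real (Gamma b)"
    using assms by (subst integral_mult_left_zero) (simp add: Gamma_integral_lborel(2))
  finally have "Gamma z * of_real (Gamma b) = Gamma (z + of_real b) * I" .
  moreover have "Gamma (z + of_real b) \<noteq> 0"
    using assms by (simp add: Gamma_eq_zero_iff Re_pos_not_nonpos_Ints)
  ultimately show ?thesis by (simp add: I_def rGamma_inverse_Gamma field_simps)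
qed

lemma integral_RL_kernel:
  assumes "b > 0" "Re z > 0" "u > 0"
  shows "(\<integral>\<tau>. RL_kernel b z u \<tau> \<partial>lborel)
    = of_real (Gamma b) * Gamma z * rGamma (z + of_real b) * of_real u powr (z + of_real b - 1)"
  using integral_RL_kernel_scale[OF assms(3)] integral_RL_kernel_1[OF assms(1,2)] by simp

section \<open>Riemann--Liouville derivatives of superpositions\<close>

text \<open>In the normalisation t^\<sigma> / Gamma(1 + \<sigma>), fractional integration of order
  \<beta> only replaces \<sigma> by \<sigma> + \<beta>; Fubini carries this through the
  superposition. The bound \<sigma>0 > -1 makes the singularity at 0 integrable uniformly in
  y.\<close>

lemma RL_superposition:
  fixes w \<sigma> :: "'b \<Rightarrow> complex"
  assumes M: "sigma_finite_measure M" and \<sigma>[measurable]: "\<sigma> \<in> borel_measurable M"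
    and w: "(\<lambda>y. w y * rGamma (1 + \<sigma> y)) \<in> borel_measurable M"
    and int: "\<And>t. t > 0 \<Longrightarrow> integrable M (\<lambda>y. w y * rGamma (1 + \<sigma> y) * of_real t powr \<sigma> y)"
    and \<sigma>0: "\<And>y. y \<in> space M \<Longrightarrow> Re (\<sigma> y) \<ge> \<sigma>0" "\<sigma>0 > -1"
    and f: "\<And>t. t > 0 \<Longrightarrow> f t = (\<integral>y. w y * rGamma (1 + \<sigma> y) * of_real t powr \<sigma> y \<partial>M)"
    and \<beta>: "\<beta> > 0" and t: "t > 0"
  shows "(\<lambda>\<tau>. (t - \<tau>) powr (\<beta> - 1) *\<^sub>R f \<tau>) absolutely_integrable_on {0..t}"
    and "RL_integral \<beta> f t = (\<integral>y. w y * rGamma (1 + \<sigma> y + of_real \<beta>) * of_real t powr (\<sigma> y + of_real \<beta>) \<partial>M)"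
proof -
  interpret sigma_finite_measure M by (rule M)
  interpret pair_sigma_finite M lborel ..
  define W where "W = (\<lambda>y. w y * rGamma (1 + \<sigma> y))"
  have W[measurable]: "W \<in> borel_measurable M" using w by (simp add: W_def)
  define h where "h = (\<lambda>y \<tau>. W y * RL_kernel \<beta> (1 + \<sigma> y) t \<tau>)"
  have Re_pos: "Re (1 + \<sigma> y) > 0" if "y \<in> space M" for y using \<sigma>0(1)[OF that] \<sigma>0(2) by simp
  have k_int: "integrable lborel (RL_kernel \<beta> (1 + \<sigma> y) t)" if "y \<in> space M" for y
    using that by (intro integrable_RL_kernel \<beta> t Re_pos)
  have h_meas: "case_prod h \<in> borel_measurable (M \<Otimes>\<^sub>M lborel)"
  proof -
    have "case_prod h = (\<lambda>p. if 0 < snd p \<and> snd p < t then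
        W (fst p) * ((t - snd p) powr (\<beta> - 1) *\<^sub>R exp (\<sigma> (fst p) * of_real (ln (snd p)))) else 0)"
      by (auto simp: h_def RL_kernel_exp fun_eq_iff)
    also have "\<dots> \<in> borel_measurable (M \<Otimes>\<^sub>M lborel)" by measurable
    finally show ?thesis .
  qed
  \<comment> \<open>For \<tau> < t, \<tau>^(Re \<sigma>) \<le> t^(Re \<sigma> - \<sigma>0)
    \<tau>^\<sigma>0. So the one kernel with exponent \<sigma>0 controls all y, and what remains is
    the integrand at the single time t, integrable by assumption.\<close>
  define C where "C = (\<integral>\<tau>. norm (RL_kernel \<beta> (1 + of_real \<sigma>0) t \<tau>) \<partial>lborel)"
  have norm_le: "(\<integral>\<tau>. norm (h y \<tau>) \<partial>lborel) \<le> C * t powr (- \<sigma>0) * norm (W y * of_real t powr \<sigma> y)"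
    if y: "y \<in> space M" for y
  proof -
    have "(\<integral>\<tau>. norm (h y \<tau>) \<partial>lborel) = norm (W y) * (\<integral>\<tau>. norm (RL_kernel \<beta> (1 + \<sigma> y) t \<tau>) \<partial>lborel)"
      by (simp add: h_def norm_mult)
    also have "(\<integral>\<tau>. norm (RL_kernel \<beta> (1 + \<sigma> y) t \<tau>) \<partial>lborel)
        \<le> (\<integral>\<tau>. t powr (Re (\<sigma> y) - \<sigma>0) * norm (RL_kernel \<beta> (1 + of_real \<sigma>0) t \<tau>) \<partial>lborel)"
    proof (rule integral_mono)
      show "integrable lborel (\<lambda>\<tau>. norm (RL_kernel \<beta> (1 + \<sigma> y) t \<tau>))"
        using k_int[OF y] by simp
      show "integrable lborel (\<lambda>\<tau>. t powr (Re (\<sigma> y) - \<sigma>0) * norm (RL_kernel \<beta> (1 + of_real \<sigma>0) t \<tau>))"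
        using integrable_RL_kernel[OF \<beta> _ t] \<sigma>0(2) by (intro integrable_mult_right integrable_norm) simp
      fix \<tau> :: real
      have "\<tau> powr Re (\<sigma> y) \<le> t powr (Re (\<sigma> y) - \<sigma>0) * \<tau> powr \<sigma>0" if "0 < \<tau>" "\<tau> < t"
      proof -
        have "\<tau> powr Re (\<sigma> y) = \<tau> powr (Re (\<sigma> y) - \<sigma>0) * \<tau> powr \<sigma>0"
          using that by (simp flip: powr_add)
        also have "\<dots> \<le> t powr (Re (\<sigma> y) - \<sigma>0) * \<tau> powr \<sigma>0"
          using that \<sigma>0(1)[OF y] by (intro mult_right_mono powr_mono2) auto
        finally show ?thesis .
      qed
      thus "norm (RL_kernel \<beta> (1 + \<sigma> y) t \<tau>)
          \<le> t powr (Re (\<sigma> y) - \<sigma>0) * norm (RL_kernel \<beta> (1 + of_real \<sigma>0) t \<tau>)"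
        by (auto simp: RL_kernel_def indicator_def norm_of_real_powr mult_left_mono mult.left_commute)
    qed
    also have "\<dots> = t powr (Re (\<sigma> y) - \<sigma>0) * C"
      by (simp add: C_def)
    also have "norm (W y) * (t powr (Re (\<sigma> y) - \<sigma>0) * C) = C * t powr (- \<sigma>0) * norm (W y * of_real t powr \<sigma> y)"
      using t by (simp add: norm_mult norm_of_real_powr powr_diff powr_minus divide_inverse mult_ac)
    finally show ?thesis by (simp add: mult_left_mono)
  qed
  have pair_int: "integrable (M \<Otimes>\<^sub>M lborel) (case_prod h)"
  proof (rule Fubini_integrable[OF h_meas])
    show "AE y in M. integrable lborel (\<lambda>\<tau>. case_prod h (y, \<tau>))"
      using k_int by (simp add: h_def)
    show "integrable M (\<lambda>y. \<integral>\<tau>. norm (case_prod h (y, \<tau>)) \<partial>lborel)"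
    proof (rule Bochner_Integration.integrable_bound)
      show "integrable M (\<lambda>y. C * t powr (- \<sigma>0) * norm (W y * of_real t powr \<sigma> y))"
        using int[OF t] by (simp add: W_def)
      show "(\<lambda>y. \<integral>\<tau>. norm (case_prod h (y, \<tau>)) \<partial>lborel) \<in> borel_measurable M"
        using h_meas by (intro lborel.borel_measurable_lebesgue_integral) (simp add: case_prod_unfold)
      show "AE y in M. norm (\<integral>\<tau>. norm (case_prod h (y, \<tau>)) \<partial>lborel)
          \<le> norm (C * t powr (- \<sigma>0) * norm (W y * of_real t powr \<sigma> y))"
        using norm_le by (intro AE_I2) (auto intro: order_trans[OF _ abs_ge_self])
    qed
  qed
  have inner: "(\<integral>y. h y \<tau> \<partial>M) = indicator {0<..<t} \<tau> *\<^sub>R ((t - \<tau>) powr (\<beta> - 1) *\<^sub>R f \<tau>)" for \<tau>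
  proof (cases "\<tau> \<in> {0<..<t}")
    case True
    hence "h y \<tau> = of_real ((t - \<tau>) powr (\<beta> - 1)) * (W y * of_real \<tau> powr \<sigma> y)" for y
      by (simp add: h_def RL_kernel_def scaleR_conv_of_real mult_ac)
    thus ?thesis using True f[of \<tau>] by (simp add: scaleR_conv_of_real W_def)
  qed (simp add: h_def RL_kernel_def)
  have ind_int: "integrable lborel (\<lambda>\<tau>. indicator {0<..<t} \<tau> *\<^sub>R ((t - \<tau>) powr (\<beta> - 1) *\<^sub>R f \<tau>))"
    using integrable_snd[OF pair_int] by (simp add: inner)
  hence "set_integrable lborel {0<..<t} (\<lambda>\<tau>. (t - \<tau>) powr (\<beta> - 1) *\<^sub>R f \<tau>)"
    by (simp add: set_integrable_def)
  hence "(\<lambda>\<tau>. (t - \<tau>) powr (\<beta> - 1) *\<^sub>R f \<tau>) absolutely_integrable_on {0<..<t}"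
    by (metis integrable_completion set_integrable_def borel_measurable_integrable)
  thus abs_int: "(\<lambda>\<tau>. (t - \<tau>) powr (\<beta> - 1) *\<^sub>R f \<tau>) absolutely_integrable_on {0..t}"
    by (rule absolutely_integrable_spike_set) (auto intro: negligible_subset[of "{0,t}"])
  have "integral {0..t} (\<lambda>\<tau>. (t - \<tau>) powr (\<beta> - 1) *\<^sub>R f \<tau>) = integral {0<..<t} (\<lambda>\<tau>. (t - \<tau>) powr (\<beta> - 1) *\<^sub>R f \<tau>)"
    by (simp add: integral_open_interval_real)
  also have "\<dots> = (\<integral>\<tau>. indicator {0<..<t} \<tau> *\<^sub>R ((t - \<tau>) powr (\<beta> - 1) *\<^sub>R f \<tau>) \<partial>lborel)"
    using set_borel_integral_eq_integral(2)[of "{0<..<t}" "\<lambda>\<tau>. (t - \<tau>) powr (\<beta> - 1) *\<^sub>R f \<tau>"] ind_int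
    by (simp add: set_integrable_def set_lebesgue_integral_def)
  also have "\<dots> = (\<integral>\<tau>. (\<integral>y. h y \<tau> \<partial>M) \<partial>lborel)"
    by (simp add: inner)
  also have "\<dots> = (\<integral>y. (\<integral>\<tau>. h y \<tau> \<partial>lborel) \<partial>M)"
    by (rule Fubini_integral[OF pair_int])
  also have "\<dots> = (\<integral>y. of_real (Gamma \<beta>) * (w y * rGamma (1 + \<sigma> y + of_real \<beta>) * of_real t powr (\<sigma> y + of_real \<beta>)) \<partial>M)"
  proof (rule Bochner_Integration.integral_cong[OF refl])
    fix y assume y: "y \<in> space M"
    have "1 + \<sigma> y \<notin> \<int>\<^sub>\<le>\<^sub>0" by (rule Re_pos_not_nonpos_Ints[OF Re_pos[OF y]])
    hence "rGamma (1 + \<sigma> y) * Gamma (1 + \<sigma> y) = 1"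
      by (simp add: rGamma_inverse_Gamma Gamma_eq_zero_iff)
    thus "(\<integral>\<tau>. h y \<tau> \<partial>lborel) = of_real (Gamma \<beta>) * (w y * rGamma (1 + \<sigma> y + of_real \<beta>) * of_real t powr (\<sigma> y + of_real \<beta>))"
      using integral_RL_kernel[OF \<beta> Re_pos[OF y] t] by (simp add: h_def W_def)
  qed
  also have "\<dots> = of_real (Gamma \<beta>) * (\<integral>y. w y * rGamma (1 + \<sigma> y + of_real \<beta>) * of_real t powr (\<sigma> y + of_real \<beta>) \<partial>M)"
    by simp
  finally show "RL_integral \<beta> f t = (\<integral>y. w y * rGamma (1 + \<sigma> y + of_real \<beta>) * of_real t powr (\<sigma> y + of_real \<beta>) \<partial>M)"
    using Gamma_real_pos[OF \<beta>] by (simp add: RL_integral_def scaleR_conv_of_real)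
qed

text \<open>\<open>F \<nu>\<close> is a one-parameter family with derivative
  \<open>F (\<nu> - 1)\<close>, because z rGamma(1 + z) = rGamma(z). The chain starts at \<nu> = 0
  for integer \<alpha>, otherwise at \<nu> = N - \<alpha> after one fractional integral. The lower
  bound on Re \<sigma> is tied to the second case: for integer \<alpha> the Wright series may start
  with the exponent -1, at which the power is not integrable at 0.\<close>

lemma RL_deriv_superposition:
  fixes w \<sigma> :: "'b \<Rightarrow> complex"
  assumes M: "sigma_finite_measure M" and \<sigma>: "\<sigma> \<in> borel_measurable M"
    and w: "(\<lambda>y. w y * rGamma (1 + \<sigma> y)) \<in> borel_measurable M"
    and int: "\<And>\<nu> t. t > 0 \<Longrightarrow> integrable M (\<lambda>y. w y * rGamma (1 + \<sigma> y + of_real \<nu>) * of_real t powr (\<sigma> y + of_real \<nu>))"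
    and \<sigma>0: "\<alpha> \<notin> \<int> \<Longrightarrow> \<exists>\<sigma>0>-1. \<forall>y\<in>space M. Re (\<sigma> y) \<ge> \<sigma>0"
    and f: "\<And>t. t > 0 \<Longrightarrow> f t = (\<integral>y. w y * rGamma (1 + \<sigma> y) * of_real t powr \<sigma> y \<partial>M)"
    and \<alpha>: "\<alpha> > 0"
  shows "RL_differentiable \<alpha> f"
    and "t > 0 \<Longrightarrow> RL_deriv \<alpha> f t =
      (\<integral>y. w y * rGamma (1 + \<sigma> y - of_real \<alpha>) * of_real t powr (\<sigma> y - of_real \<alpha>) \<partial>M)"
proof -
  define F where "F = (\<lambda>\<nu> t. \<integral>y. w y * rGamma (1 + \<sigma> y + of_real \<nu>) * of_real t powr (\<sigma> y + of_real \<nu>) \<partial>M)"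
  have F: "(F \<nu> has_vector_derivative F (\<nu> - 1) t) (at t)" if "t > 0" for \<nu> t
  proof -
    have *: "rGamma (1 + \<sigma> y + of_real \<nu>) * (\<sigma> y + of_real \<nu>) = rGamma (1 + \<sigma> y + of_real (\<nu> - 1))" for y
      using rGamma_plus1[of "\<sigma> y + of_real \<nu>"] by (simp add: mult.commute add_ac)
    have e: "\<sigma> y + of_real \<nu> - 1 = \<sigma> y + of_real (\<nu> - 1)" for y by simp
    show ?thesis
      using has_vector_derivative_integral_powr[of M "\<lambda>y. w y * rGamma (1 + \<sigma> y + of_real \<nu>)"
          "\<lambda>y. \<sigma> y + of_real \<nu>" t, unfolded mult.assoc[of "w _"] * e] int[of _ \<nu>] int[of _ "\<nu> - 1"] that
      unfolding F_def by (simp only: mult.assoc)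
  qed
  have chain: "(F (\<nu> - real k) has_vector_derivative F (\<nu> - real (Suc k)) t) (at t)" if "t > 0" for \<nu> k t
    using F[OF that, of "\<nu> - real k"] by (simp add: algebra_simps)
  have f0: "f t = F (0 - real 0) t" if "t > 0" for t using f[OF that] by (simp add: F_def)
  have goal: "F (- \<alpha>) t = (\<integral>y. w y * rGamma (1 + \<sigma> y - of_real \<alpha>) * of_real t powr (\<sigma> y - of_real \<alpha>) \<partial>M)" for t
    by (simp add: F_def)
  have "RL_differentiable \<alpha> f \<and> (t > 0 \<longrightarrow> RL_deriv \<alpha> f t = F (- \<alpha>) t)"
  proof (cases "\<alpha> \<in> \<int>")
    case True
    define n where "n = nat \<lfloor>\<alpha>\<rfloor>"
    have n: "real n = \<alpha>" using True \<alpha> by (auto simp: n_def elim!: Ints_cases)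
    note c = nth_vderiv_chain[of f "\<lambda>k. F (0 - real k)" n, OF f0 chain]
    show ?thesis
      using c(1)[of n t] c(2) True n by (simp add: RL_differentiable_def RL_deriv_def flip: n_def)
  next
    case False
    then obtain \<sigma>0 where s0: "\<And>y. y \<in> space M \<Longrightarrow> Re (\<sigma> y) \<ge> \<sigma>0" "\<sigma>0 > -1" using \<sigma>0 by blast
    define N where "N = nat \<lfloor>\<alpha>\<rfloor> + 1"
    define \<beta> where "\<beta> = real N - \<alpha>"
    have \<beta>: "\<beta> > 0" using \<alpha> unfolding \<beta>_def N_def by linarith
    have int0: "integrable M (\<lambda>y. w y * rGamma (1 + \<sigma> y) * of_real t powr \<sigma> y)" if "t > 0" for t
      using int[OF that, of 0] by simp
    note RL = RL_superposition[OF M \<sigma> w int0 s0 f \<beta>]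
    have "RL_integral \<beta> f t = F (\<beta> - real 0) t" if "t > 0" for t
      using RL(2)[OF _ _ _ that] by (simp add: F_def)
    note c = nth_vderiv_chain[of "RL_integral \<beta> f" "\<lambda>k. F (\<beta> - real k)" N, OF this chain]
    have "\<beta> - real N = - \<alpha>" by (simp add: \<beta>_def)
    thus ?thesis
      using c(1)[of N t] c(2) False RL(1)
      by (simp add: RL_differentiable_def RL_deriv_def Let_def \<beta>_def flip: N_def) (simp add: N_def)
  qed
  thus "RL_differentiable \<alpha> f"
    and "t > 0 \<Longrightarrow> RL_deriv \<alpha> f t =
      (\<integral>y. w y * rGamma (1 + \<sigma> y - of_real \<alpha>) * of_real t powr (\<sigma> y - of_real \<alpha>) \<partial>M)"
    by (auto simp: goal)
qed

lemma nth_vderiv_superposition: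
  fixes g \<rho> :: "'b \<Rightarrow> complex"
  assumes int: "\<And>x. x > 0 \<Longrightarrow> integrable M (\<lambda>y. g y * of_real x powr \<rho> y)"
    and int1: "\<And>x. x > 0 \<Longrightarrow> integrable M (\<lambda>y. g y * \<rho> y * of_real x powr (\<rho> y - 1))"
    and int2: "\<And>x. x > 0 \<Longrightarrow> integrable M (\<lambda>y. g y * \<rho> y * (\<rho> y - 1) * of_real x powr (\<rho> y - 2))"
    and f: "\<And>x. x > 0 \<Longrightarrow> f x = (\<integral>y. g y * of_real x powr \<rho> y \<partial>M)"
  shows "times_differentiable_on 2 f {0<..}"
    and "x > 0 \<Longrightarrow> nth_vderiv 1 f x = (\<integral>y. g y * \<rho> y * of_real x powr (\<rho> y - 1) \<partial>M)"
    and "x > 0 \<Longrightarrow> nth_vderiv 2 f x = (\<integral>y. g y * \<rho> y * (\<rho> y - 1) * of_real x powr (\<rho> y - 2) \<partial>M)"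
proof -
  define F where "F = (\<lambda>k::nat. if k = 0 then (\<lambda>x. \<integral>y. g y * of_real x powr \<rho> y \<partial>M)
    else if k = 1 then (\<lambda>x. \<integral>y. g y * \<rho> y * of_real x powr (\<rho> y - 1) \<partial>M)
    else (\<lambda>x. \<integral>y. g y * \<rho> y * (\<rho> y - 1) * of_real x powr (\<rho> y - 2) \<partial>M))"
  have F: "(F k has_vector_derivative F (Suc k) x) (at x)" if "k < 2" "x > 0" for k x
  proof -
    from that consider "k = 0" | "k = 1" by linarith
    thus ?thesis
    proof cases
      case 1
      thus ?thesis using has_vector_derivative_integral_powr[OF int int1 that(2)] by (simp add: F_def)
    next
      case 2
      have "\<rho> y - 1 - 1 = \<rho> y - 2" for y by simp
      hence "integrable M (\<lambda>y. g y * \<rho> y * (\<rho> y - 1) * of_real x powr (\<rho> y - 1 - 1))" if "x > 0" for x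
        using int2[OF that] by simp
      thus ?thesis using has_vector_derivative_integral_powr[OF int1 _ that(2)] 2 by (simp add: F_def)
    qed
  qed
  have f0: "f x = F 0 x" if "x > 0" for x using f[OF that] by (simp add: F_def)
  note c = nth_vderiv_chain[of f F 2, OF f0 F]
  show "times_differentiable_on 2 f {0<..}" using c(2) by simp
  show "x > 0 \<Longrightarrow> nth_vderiv 1 f x = (\<integral>y. g y * \<rho> y * of_real x powr (\<rho> y - 1) \<partial>M)"
    "x > 0 \<Longrightarrow> nth_vderiv 2 f x = (\<integral>y. g y * \<rho> y * (\<rho> y - 1) * of_real x powr (\<rho> y - 2) \<partial>M)"
    using c(1)[of 1 x] c(1)[of 2 x] by (auto simp: F_def)
qed

text \<open>Each of the three terms changes the power of x by the same amount d - 2, so the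
  coefficients collect to the indicial polynomial. Moments of \<rho> up to order 2 control both
  derivatives.\<close>

lemma euler_operator_superposition:
  fixes g \<rho> :: "'b \<Rightarrow> complex"
  assumes int: "\<And>x j. x > 0 \<Longrightarrow> j \<le> 2 \<Longrightarrow> integrable M (\<lambda>y. g y * of_real x powr \<rho> y * \<rho> y ^ j)"
    and f: "\<And>x. x > 0 \<Longrightarrow> f x = (\<integral>y. g y * of_real x powr \<rho> y \<partial>M)"
  shows "times_differentiable_on 2 f {0<..}"
    and "x > 0 \<Longrightarrow> (A * x powr d) *\<^sub>R nth_vderiv 2 f x + (B * x powr (d - 1)) *\<^sub>R nth_vderiv 1 f x
           + (C * x powr (d - 2)) *\<^sub>R f x
         = (\<integral>y. g y * (of_real A * \<rho> y * (\<rho> y - 1) + of_real B * \<rho> y + of_real C)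
                 * of_real x powr (\<rho> y + of_real (d - 2)) \<partial>M)"
proof -
  have pd: "of_real x powr (s - of_nat k) = of_real x powr s * of_real (1 / x ^ k)" if "x > 0" for x :: real and s :: complex and k
    using that by (simp add: powr_diff)
  have int0: "integrable M (\<lambda>y. g y * of_real x powr \<rho> y)" if "x > 0" for x
    using int[OF that, of 0] by simp
  have int1: "integrable M (\<lambda>y. g y * \<rho> y * of_real x powr (\<rho> y - 1))" if "x > 0" for x
    using integrable_mult_left[OF int[OF that, of 1], of "of_real (1 / x ^ 1)"] pd[OF that, of _ 1]
    by (simp add: mult_ac)
  have int2: "integrable M (\<lambda>y. g y * \<rho> y * (\<rho> y - 1) * of_real x powr (\<rho> y - 2))" if "x > 0" for x
  proof -
    have "integrable M (\<lambda>y. (g y * of_real x powr \<rho> y * \<rho> y ^ 2 - g y * of_real x powr \<rho> y * \<rho> y ^ 1) * of_real (1 / x ^ 2))"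
      using int[OF that, of 2] int[OF that, of 1] by (intro integrable_mult_left Bochner_Integration.integrable_diff) auto
    also have "(\<lambda>y. (g y * of_real x powr \<rho> y * \<rho> y ^ 2 - g y * of_real x powr \<rho> y * \<rho> y ^ 1) * of_real (1 / x ^ 2))
        = (\<lambda>y. g y * \<rho> y * (\<rho> y - 1) * of_real x powr (\<rho> y - 2))"
      using pd[OF that, of _ 2] by (simp add: fun_eq_iff power2_eq_square algebra_simps)
    finally show ?thesis .
  qed
  note d = nth_vderiv_superposition[OF int0 int1 int2 f]
  show "times_differentiable_on 2 f {0<..}" using d(1) by simp
  assume x: "x > 0"
  \<comment> \<open>Used with r = 0, 1, 2: for the second derivative, the first derivative and the
    function itself.\<close>
  have pw: "complex_of_real (x powr (d - r)) * of_real x powr (s - of_real (2 - r)) = of_real x powr (s + of_real (d - 2))" for r s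
    using x by (simp add: powr_of_real[symmetric] powr_add[symmetric] algebra_simps)
  have "(A * x powr d) *\<^sub>R nth_vderiv 2 f x + (B * x powr (d - 1)) *\<^sub>R nth_vderiv 1 f x + (C * x powr (d - 2)) *\<^sub>R f x
      = (\<integral>y. of_real (A * x powr d) * (g y * \<rho> y * (\<rho> y - 1) * of_real x powr (\<rho> y - 2))
           + of_real (B * x powr (d - 1)) * (g y * \<rho> y * of_real x powr (\<rho> y - 1))
           + of_real (C * x powr (d - 2)) * (g y * of_real x powr \<rho> y) \<partial>M)"
    using int0[OF x] int1[OF x] int2[OF x] d(2,3)[OF _ _ _ _ x] f[OF x]
    by (simp add: scaleR_conv_of_real Bochner_Integration.integral_add)
  also have "\<dots> = (\<integral>y. g y * (of_real A * \<rho> y * (\<rho> y - 1) + of_real B * \<rho> y + of_real C)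
                 * of_real x powr (\<rho> y + of_real (d - 2)) \<partial>M)"
  proof (rule Bochner_Integration.integral_cong[OF refl])
    fix y
    show "of_real (A * x powr d) * (g y * \<rho> y * (\<rho> y - 1) * of_real x powr (\<rho> y - 2))
           + of_real (B * x powr (d - 1)) * (g y * \<rho> y * of_real x powr (\<rho> y - 1))
           + of_real (C * x powr (d - 2)) * (g y * of_real x powr \<rho> y)
        = g y * (of_real A * \<rho> y * (\<rho> y - 1) + of_real B * \<rho> y + of_real C) * of_real x powr (\<rho> y + of_real (d - 2))"
      using pw[of 0 "\<rho> y"] pw[of 1 "\<rho> y"] pw[of 2 "\<rho> y"]
      by (simp add: algebra_simps)
  qed
  finally show "(A * x powr d) *\<^sub>R nth_vderiv 2 f x + (B * x powr (d - 1)) *\<^sub>R nth_vderiv 1 f x + (C * x powr (d - 2)) *\<^sub>R f x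
      = (\<integral>y. g y * (of_real A * \<rho> y * (\<rho> y - 1) + of_real B * \<rho> y + of_real C)
                 * of_real x powr (\<rho> y + of_real (d - 2)) \<partial>M)" .
qed

section \<open>Shifting a contour to a vertical line\<close>

lemma tendsto_integral_symmetric:
  fixes f :: "real \<Rightarrow> complex"
  assumes "integrable lborel f"
  shows "(\<lambda>n. integral {- real n..real n} f) \<longlonglongrightarrow> (\<integral>x. f x \<partial>lborel)"
proof -
  have eq: "integral {- real n..real n} f = (\<integral>x. indicator {- real n..real n} x *\<^sub>R f x \<partial>lborel)" for n
    using set_borel_integral_eq_integral(2)[of "{- real n..real n}" f]
      integrable_mult_indicator[OF _ assms, of "{- real n..real n}"]
    by (simp add: set_integrable_def set_lebesgue_integral_def)
  show ?thesis unfolding eq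
  proof (rule integral_dominated_convergence[where w = "\<lambda>x. norm (f x)"])
    show "AE x in lborel. (\<lambda>n. indicator {- real n..real n} x *\<^sub>R f x) \<longlonglongrightarrow> f x"
    proof (rule AE_I2)
      fix x :: real
      have "eventually (\<lambda>n. indicator {- real n..real n} x *\<^sub>R f x = f x) sequentially"
        using eventually_ge_at_top[of "nat \<lceil>\<bar>x\<bar>\<rceil>"]
      proof eventually_elim
        case (elim n)
        hence "\<bar>x\<bar> \<le> real n" by linarith
        thus ?case by (simp add: indicator_def abs_le_iff)
      qed
      thus "(\<lambda>n. indicator {- real n..real n} x *\<^sub>R f x) \<longlonglongrightarrow> f x" by (rule tendsto_eventually)
    qed
    show "AE x in lborel. norm (indicator {- real n..real n} x *\<^sub>R f x) \<le> norm (f x)" for n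
      by (auto simp: indicator_def)
  qed (use assms in auto)
qed

text \<open>A sum of two reflected and scaled Gamma integrands at z = 1. They miss the point t = 0,
  hence equality only almost everywhere.\<close>

lemma integrable_exp_abs:
  assumes "\<delta> > 0"
  shows "integrable lborel (\<lambda>t::real. exp (- \<delta> * \<bar>t\<bar>))"
proof -
  define e where "e = (\<lambda>t::real. indicator {0<..} t * exp (- t))"
  have "integrable lborel (\<lambda>t. norm (indicator {0<..} t *\<^sub>R (of_real t powr (1 - 1) / complex_of_real (exp t))))"
    by (intro integrable_norm Gamma_integral_lborel(1)) simp
  also have "(\<lambda>t. norm (indicator {0<..} t *\<^sub>R (of_real t powr (1 - 1) / complex_of_real (exp t)))) = e"
    by (auto simp: e_def fun_eq_iff indicator_def norm_divide exp_minus inverse_eq_divide)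
  finally have e: "integrable lborel e" .
  have "integrable lborel (\<lambda>t. e (0 + \<delta> * t) + e (0 + (- \<delta>) * t))"
    using assms by (intro Bochner_Integration.integrable_add lborel_integrable_real_affine[OF e]) auto
  moreover have "AE t in lborel. e (0 + \<delta> * t) + e (0 + (- \<delta>) * t) = exp (- \<delta> * \<bar>t\<bar>)"
    using AE_lborel_singleton[of 0]
  proof eventually_elim
    case (elim t)
    thus ?case using assms by (cases "t > 0") (auto simp: e_def indicator_def mult_less_0_iff zero_less_mult_iff)
  qed
  ultimately show ?thesis
    by (subst integrable_cong_AE[where g = "\<lambda>t. e (0 + \<delta> * t) + e (0 + (- \<delta>) * t)"])
       (auto dest: borel_measurable_integrable simp: eq_commute)
qed

section \<open>Closing an arbitrary contour to a loop\<close>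

locale infinite_contour_data =
  fixes L :: "real \<Rightarrow> complex" and T \<gamma> :: real
  assumes T: "T > 0" and C1: "L piecewise_C1_differentiable_on {-T..T}"
    and outside: "\<And>t. \<bar>t\<bar> \<ge> T \<Longrightarrow> L t = Complex \<gamma> t"
begin

definition core :: "real \<Rightarrow> complex" where "core u = L (2 * T * u - T)"

text \<open>For T' \<ge> T and \<gamma>' < \<gamma>: the contour L cut off at parameters of modulus
  T', traversed upwards and closed on the left by three sides of a rectangle, so that the line Re s
  = \<gamma>' is traversed downwards. The loop starts at the lower end of the bent part, which makes
  the lower tail of L the last segment.\<close>

definition boxed :: "real \<Rightarrow> real \<Rightarrow> real \<Rightarrow> complex" where
  "boxed T' \<gamma>' = core +++ (linepath (Complex \<gamma> T) (Complex \<gamma> T') +++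
     (linepath (Complex \<gamma> T') (Complex \<gamma>' T') +++ (linepath (Complex \<gamma>' T') (Complex \<gamma>' (- T')) +++
     (linepath (Complex \<gamma>' (- T')) (Complex \<gamma> (- T')) +++ linepath (Complex \<gamma> (- T')) (Complex \<gamma> (- T))))))"

lemma valid_path_core: "valid_path core"
proof -
  have "(L \<circ> (\<lambda>u. 2 * T * u - T)) piecewise_C1_differentiable_on {0..1}"
  proof (rule piecewise_C1_differentiable_compose)
    show "(\<lambda>u. 2 * T * u - T) piecewise_C1_differentiable_on {0..1}"
      by (intro C1_differentiable_imp_piecewise) (auto simp: C1_differentiable_on_def intro!: exI[of _ "\<lambda>_. 2 * T"] derivative_eq_intros)
    have "(\<lambda>u. 2 * T * u - T) ` {0..1} \<subseteq> {-T..T}"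
      using T by (auto simp: mult_le_one)
    thus "L piecewise_C1_differentiable_on (\<lambda>u. 2 * T * u - T) ` {0..1}"
      by (rule piecewise_C1_differentiable_on_subset[OF C1])
    show "finite ({0..1} \<inter> (\<lambda>u. 2 * T * u - T) -` {x})" for x
    proof (rule finite_subset)
      show "{0..1} \<inter> (\<lambda>u. 2 * T * u - T) -` {x} \<subseteq> {(x + T) / (2 * T)}"
        using T by (auto simp: field_simps)
    qed auto
  qed
  thus ?thesis by (simp add: valid_path_def core_def[abs_def] o_def)
qed

lemma core_ends [simp]: "pathstart core = Complex \<gamma> (- T)" "pathfinish core = Complex \<gamma> T"
  using T by (auto simp: pathstart_def pathfinish_def core_def outside)

lemma core_image: "path_image core \<subseteq> range L"
  by (auto simp: path_image_def core_def)

lemma valid_path_boxed: "valid_path (boxed T' \<gamma>')"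
  by (simp add: boxed_def valid_path_core)

lemma boxed_loop: "pathfinish (boxed T' \<gamma>') = pathstart (boxed T' \<gamma>')"
  by (simp add: boxed_def)

text \<open>A rough localisation is enough: the pieces on Re z = \<gamma> lie on L, which is
  straight there.\<close>

lemma boxed_image:
  assumes "T' \<ge> T" "\<gamma>' \<le> \<gamma>"
  shows "path_image (boxed T' \<gamma>') \<subseteq> range L \<union> {z. \<bar>Im z\<bar> = T' \<and> \<gamma>' \<le> Re z \<and> Re z \<le> \<gamma>} \<union> {z. Re z = \<gamma>'}"
proof -
  have v: "closed_segment (Complex c a) (Complex c b) = {z. Re z = c \<and> Im z \<in> closed_segment a b}" for a b c
    using closed_segment_same_Re[of "Complex c a" "Complex c b"] by simp
  have h: "closed_segment (Complex a c) (Complex b c) = {z. Im z = c \<and> Re z \<in> closed_segment a b}" for a b c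
    using closed_segment_same_Im[of "Complex a c" "Complex b c"] by simp
  have rL: "z \<in> range L" if "Re z = \<gamma>" "\<bar>Im z\<bar> \<ge> T" for z
    using outside[OF that(2)] that(1) by (metis complex.collapse rangeI)
  show ?thesis
  proof
    fix z assume "z \<in> path_image (boxed T' \<gamma>')"
    then consider "z \<in> path_image core" | "Re z = \<gamma>" "Im z \<in> closed_segment T T'"
      | "Im z = T'" "Re z \<in> closed_segment \<gamma> \<gamma>'" | "Re z = \<gamma>'"
      | "Im z = - T'" "Re z \<in> closed_segment \<gamma>' \<gamma>" | "Re z = \<gamma>" "Im z \<in> closed_segment (- T') (- T)"
      unfolding boxed_def by (simp add: path_image_join v h) blast
    thus "z \<in> range L \<union> {z. \<bar>Im z\<bar> = T' \<and> \<gamma>' \<le> Re z \<and> Re z \<le> \<gamma>} \<union> {z. Re z = \<gamma>'}"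
    proof cases
      case 1
      thus ?thesis using core_image by blast
    next
      case 2
      thus ?thesis using rL[of z] assms T by (simp add: closed_segment_eq_real_ivl)
    next
      case 6
      thus ?thesis using rL[of z] assms T by (simp add: closed_segment_eq_real_ivl)
    qed (use assms T in \<open>auto simp: closed_segment_eq_real_ivl split: if_splits\<close>)
  qed
qed

text \<open>Makes the complement of L open, so that its connected components are path
  components.\<close>

lemma closed_range: "closed (range L)"
proof -
  have "range L = L ` {-T..T} \<union> {z. Re z = \<gamma> \<and> \<bar>Im z\<bar> \<ge> T}"
  proof (intro equalityI subsetI)
    fix z assume "z \<in> range L"
    then obtain t where "z = L t" by auto
    thus "z \<in> L ` {-T..T} \<union> {z. Re z = \<gamma> \<and> \<bar>Im z\<bar> \<ge> T}"
      using T by (cases "t \<in> {-T..T}") (auto simp: outside)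
  next
    fix z assume "z \<in> L ` {-T..T} \<union> {z. Re z = \<gamma> \<and> \<bar>Im z\<bar> \<ge> T}"
    thus "z \<in> range L" using outside[of "Im z"] by (auto simp: complex_eq_iff intro: range_eqI[of _ _ "Im z"])
  qed
  moreover have "compact (L ` {-T..T})"
    using C1 by (intro compact_continuous_image) (auto simp: piecewise_C1_differentiable_on_def)
  moreover have "closed {z. Re z = \<gamma> \<and> \<bar>Im z\<bar> \<ge> T}"
    by (intro closed_Collect_conj closed_Collect_eq closed_Collect_le continuous_intros)
  ultimately show ?thesis by (auto intro: compact_imp_closed)
qed

lemma Re_bounded: obtains R where "\<And>t. Re (L t) \<le> R" "\<gamma> \<le> R"
proof -
  have "compact (L ` {-T..T})"
    using C1 by (intro compact_continuous_image) (auto simp: piecewise_C1_differentiable_on_def)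
  then obtain B where "\<forall>z\<in>L ` {-T..T}. norm z \<le> B"
    by (meson bounded_iff compact_imp_bounded)
  hence B: "norm (L t) \<le> B" if "t \<in> {-T..T}" for t
    using that by blast
  show ?thesis
  proof (rule that[of "max B \<gamma>"])
    show "Re (L t) \<le> max B \<gamma>" for t
    proof (cases "\<bar>t\<bar> \<ge> T")
      case False
      hence "t \<in> {-T..T}" by auto
      from order_trans[OF complex_Re_le_cmod B[OF this]] have "Re (L t) \<le> B" .
      thus ?thesis by simp
    qed (simp add: outside)
  qed auto
qed

text \<open>
  A point right of \<open>L\<close> is joined to a far point of the real axis by a path missing \<open>L\<close>; once the box
  encloses that path too, it misses the whole boxed contour, which cannot wind around the far end.
\<close>

lemma winding_number_boxed:
  assumes P: "P \<subseteq> right_side L" and fin: "\<And>R. finite {p \<in> P. Re p \<le> R}"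
  obtains G where "G \<ge> T" "- G \<le> \<gamma>"
    "\<And>T' \<gamma>' p. T' \<ge> G \<Longrightarrow> \<gamma>' \<le> - G \<Longrightarrow> p \<in> P \<Longrightarrow> winding_number (boxed T' \<gamma>') p = 0"
proof -
  obtain R where R: "\<And>t. Re (L t) \<le> R" "\<gamma> \<le> R" using Re_bounded by blast
  \<comment> \<open>The loop lies in a half plane, a convex set, and p is outside it.\<close>
  have far: "winding_number (boxed T' \<gamma>') p = 0" if "T' \<ge> T" "\<gamma>' \<le> \<gamma>" "Re p > R" for T' \<gamma>' p
  proof (rule winding_number_zero_outside[where s = "{z. Re z \<le> R}"])
    show "path_image (boxed T' \<gamma>') \<subseteq> {z. Re z \<le> R}"
      using boxed_image[OF that(1,2)] R that by auto
  qed (use that boxed_loop in \<open>auto intro: valid_path_imp_path valid_path_boxed convex_halfspace_Re_le\<close>)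
  have near: "eventually (\<lambda>G. \<forall>T'\<ge>G. \<forall>\<gamma>'\<le>-G. winding_number (boxed T' \<gamma>') p = 0) at_top" if "p \<in> P" for p
  proof -
    have "eventually (\<lambda>r. connected_component (- range L) p (of_real r)) at_top"
      using P that by (auto simp: right_side_def)
    moreover have "eventually (\<lambda>r. r > R) at_top" by (rule eventually_gt_at_top)
    ultimately have "eventually (\<lambda>r. connected_component (- range L) p (of_real r) \<and> r > R) at_top"
      by (rule eventually_conj)
    then obtain r where r: "connected_component (- range L) p (of_real r)" "r > R"
      using eventually_happens'[OF trivial_limit_at_top_linorder] by blast
    \<comment> \<open>The sides of L are defined by connected components; a path is wanted because
      its compact image tells how large the box must be.\<close>
    have "path_component (- range L) p (of_real r)"
      using r(1) closed_range by (subst path_component_eq_connected_component) (auto intro: open_imp_locally_path_connected)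
    then obtain h where h: "path h" "path_image h \<subseteq> - range L" "pathstart h = p" "pathfinish h = of_real r"
      by (auto simp: path_component_def)
    obtain B where B: "\<And>z. z \<in> path_image h \<Longrightarrow> norm z \<le> B"
      using bounded_path_image[OF h(1)] by (auto simp: bounded_iff)
    show ?thesis
    proof (rule eventually_mono[OF eventually_gt_at_top[of "max B (max T \<bar>\<gamma>\<bar>)"]], intro allI impI)
      fix G T' \<gamma>' assume G: "max B (max T \<bar>\<gamma>\<bar>) < G" and T': "G \<le> T'" and \<gamma>': "\<gamma>' \<le> - G"
      have T'T: "T' \<ge> T" "\<gamma>' \<le> \<gamma>" using G T' \<gamma>' by auto
      have disj: "path_image h \<inter> path_image (boxed T' \<gamma>') = {}"
      proof -
        have "\<bar>Im z\<bar> < T' \<and> \<gamma>' < Re z" if "z \<in> path_image h" for z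
          using B[OF that] abs_Im_le_cmod[of z] abs_Re_le_cmod[of z] G T' \<gamma>' by auto
        moreover have "z \<notin> range L" if "z \<in> path_image h" for z
          using h(2) that by auto
        moreover have "z \<in> range L \<or> \<bar>Im z\<bar> = T' \<or> Re z = \<gamma>'" if "z \<in> path_image (boxed T' \<gamma>')" for z
          using boxed_image[OF T'T] that by auto
        ultimately show ?thesis by (metis disjoint_iff order_less_irrefl)
      qed
      have "winding_number (boxed T' \<gamma>') p = winding_number (boxed T' \<gamma>') (of_real r)"
      proof (rule winding_number_eq[where S = "path_image h"])
        show "p \<in> path_image h" using pathstart_in_path_image[of h] by (simp add: h(3))
        show "of_real r \<in> path_image h" using pathfinish_in_path_image[of h] by (simp add: h(4))
        show "connected (path_image h)" by (rule connected_path_image[OF h(1)])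
      qed (simp_all add: valid_path_imp_path valid_path_boxed boxed_loop disj)
      also have "\<dots> = 0" using far[OF T'T] r(2) by simp
      finally show "winding_number (boxed T' \<gamma>') p = 0" .
    qed
  qed
  \<comment> \<open>The size of the box depends on p. Only finitely many p have Re p \<le> R, and
    all others are covered by \<open>far\<close>, so one G serves for all of P.\<close>
  have "eventually (\<lambda>G. \<forall>p\<in>{p \<in> P. Re p \<le> R}. \<forall>T'\<ge>G. \<forall>\<gamma>'\<le>-G. winding_number (boxed T' \<gamma>') p = 0) at_top"
    using near by (intro eventually_ball_finite fin) auto
  moreover have "eventually (\<lambda>G. G \<ge> max T (- \<gamma>)) at_top" by (rule eventually_ge_at_top)
  ultimately have "eventually (\<lambda>G. (\<forall>p\<in>{p \<in> P. Re p \<le> R}. \<forall>T'\<ge>G. \<forall>\<gamma>'\<le>-G.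
      winding_number (boxed T' \<gamma>') p = 0) \<and> G \<ge> max T (- \<gamma>)) at_top"
    by (rule eventually_conj)
  then obtain G where G: "\<forall>p\<in>{p \<in> P. Re p \<le> R}. \<forall>T'\<ge>G. \<forall>\<gamma>'\<le>-G. winding_number (boxed T' \<gamma>') p = 0"
      "G \<ge> max T (- \<gamma>)"
    using eventually_happens'[OF trivial_limit_at_top_linorder] by blast
  show ?thesis
  proof (rule that[of G])
    fix T' \<gamma>' p assume "G \<le> T'" "\<gamma>' \<le> - G" "p \<in> P"
    thus "winding_number (boxed T' \<gamma>') p = 0"
      using G far[of T' \<gamma>' p] by (cases "Re p \<le> R") auto
  qed (use G in auto)
qed

text \<open>\<open>fox_H\<close> integrates over the parameter of L, a contour integral over [0, 1];
  an affine change of parameter links them. Finitely many parameters are left out: the two ends,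
  where the derivative is one-sided, and the images of the exceptional points of L.\<close>

lemma has_integral_core:
  assumes "f contour_integrable_on core"
  shows "((\<lambda>t. f (L t) * vector_derivative L (at t)) has_integral contour_integral core f) {-T..T}"
proof -
  let ?h = "\<lambda>t. f (L t) * vector_derivative L (at t)"
  let ?\<phi> = "\<lambda>u. 2 * T * u - T"
  obtain S where S: "finite S" "L C1_differentiable_on ({-T..T} - S)"
    using C1 by (auto simp: piecewise_C1_differentiable_on_def)
  have "((\<lambda>u. f (core u) * vector_derivative core (at u within {0..1})) has_integral contour_integral core f) {0..1}"
    using has_contour_integral_integral[OF assms] by (simp add: has_contour_integral_def)
  moreover have "2 * T * ?h (?\<phi> u) = f (core u) * vector_derivative core (at u within {0..1})"
    if "u \<in> {0..1} - (insert 0 (insert 1 ((\<lambda>x. (x + T) / (2 * T)) ` S)))" for u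
  proof -
    have u: "0 < u" "u < 1" using that by (auto simp: less_le)
    have "?\<phi> u \<notin> S"
    proof
      assume "?\<phi> u \<in> S"
      hence "(?\<phi> u + T) / (2 * T) \<in> (\<lambda>x. (x + T) / (2 * T)) ` S" by blast
      moreover have "(?\<phi> u + T) / (2 * T) = u" using T by simp
      ultimately show False using that by auto
    qed
    moreover have "?\<phi> u \<in> {-T..T}" using u T by (auto simp: mult_le_one)
    ultimately have "L differentiable at (?\<phi> u)"
      using S(2) by (auto simp: C1_differentiable_on_eq)
    hence "(L has_vector_derivative vector_derivative L (at (?\<phi> u))) (at (?\<phi> u))"
      by (simp add: vector_derivative_works)
    hence "((L \<circ> ?\<phi>) has_vector_derivative (2 * T) *\<^sub>R vector_derivative L (at (?\<phi> u))) (at u)"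
      by (intro vector_diff_chain_at) (auto intro!: derivative_eq_intros)
    hence "(core has_vector_derivative (2 * T) *\<^sub>R vector_derivative L (at (?\<phi> u))) (at u within {0..1})"
      by (simp add: core_def[abs_def] o_def has_vector_derivative_at_within)
    hence "vector_derivative core (at u within {0..1}) = (2 * T) *\<^sub>R vector_derivative L (at (?\<phi> u))"
      using u by (intro vector_derivative_within_cbox[of 0 1, simplified]) auto
    thus ?thesis by (simp add: core_def scaleR_conv_of_real)
  qed
  ultimately have "((\<lambda>u. 2 * T * ?h (?\<phi> u)) has_integral contour_integral core f) {0..1}"
    by (rule_tac has_integral_spike_finite[of "insert 0 (insert 1 ((\<lambda>x. (x + T) / (2 * T)) ` S))", rotated 2])
       (use S in auto)
  hence "((\<lambda>u. (1 / (2 * T)) *\<^sub>R (2 * T * ?h (?\<phi> u))) has_integral (1 / (2 * T)) *\<^sub>R contour_integral core f) {0..1}"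
    by (rule has_integral_cmul)
  moreover have "(1 / (2 * T)) *\<^sub>R (2 * T * ?h (?\<phi> u)) = ?h ((2 * T) *\<^sub>R u + (- T))" for u
    using T by (simp add: scaleR_conv_of_real)
  ultimately have "((\<lambda>u. ?h ((2 * T) *\<^sub>R u + (- T))) has_integral (1 / (2 * T)) *\<^sub>R contour_integral core f) {0..1}"
    by (simp only:)
  moreover have "(- T - (- T)) /\<^sub>R (2 * T) = 0" "(T - (- T)) /\<^sub>R (2 * T) = 1" using T by auto
  ultimately show ?thesis
    using has_integral_affinity_iff[of "2 * T" ?h "- T" "contour_integral core f" "- T" T] T
    by (simp add: inverse_eq_divide)
qed

text \<open>Cauchy's theorem on the boxed loops, whose horizontal sides vanish as T' grows. Decay is
  asked for only at heights from G on, since below G the strip between \<gamma>' and \<gamma> may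
  contain poles.\<close>

lemma integral_contour_shift:
  assumes P: "P \<subseteq> right_side L" "closed P" and f: "f holomorphic_on - P"
    and zero: "\<And>T' p. T' \<ge> G \<Longrightarrow> p \<in> P \<Longrightarrow> winding_number (boxed T' \<gamma>') p = 0"
    and off: "\<And>p. p \<in> P \<Longrightarrow> \<gamma>' < Re p \<and> \<bar>Im p\<bar> < G"
    and G: "G \<ge> T" "\<gamma>' < \<gamma>"
    and decay: "\<delta> > 0" "\<And>s. \<gamma>' \<le> Re s \<Longrightarrow> Re s \<le> \<gamma> \<Longrightarrow> \<bar>Im s\<bar> \<ge> G \<Longrightarrow> norm (f s) \<le> C * exp (- \<delta> * \<bar>Im s\<bar>)"
    and int: "integrable lborel (\<lambda>y. f (Complex \<gamma>' y))"
  shows "integral UNIV (\<lambda>t. f (L t) * vector_derivative L (at t)) = \<i> * (\<integral>y. f (Complex \<gamma>' y) \<partial>lborel)"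
proof -
  let ?h = "\<lambda>t. f (L t) * vector_derivative L (at t)"
  let ?v = "\<lambda>c y. f (Complex c y)"
  have PL: "P \<inter> range L = {}"
  proof -
    have "p \<notin> range L" if "p \<in> P" for p
    proof -
      have "eventually (\<lambda>r. connected_component (- range L) p (of_real r)) at_top"
        using P that by (auto simp: right_side_def)
      then obtain r where "connected_component (- range L) p (of_real r)"
        by (meson eventually_happens trivial_limit_at_top_linorder)
      thus ?thesis using connected_component_in by blast
    qed
    thus ?thesis by blast
  qed
  have in_U: "path_image (boxed T' \<gamma>') \<subseteq> - P" if "T' \<ge> G" for T'
  proof
    fix z assume "z \<in> path_image (boxed T' \<gamma>')"
    hence "z \<in> range L \<or> \<bar>Im z\<bar> = T' \<or> Re z = \<gamma>'"
      using boxed_image[of T' \<gamma>'] that G by auto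
    moreover have "z \<notin> range L" "\<bar>Im z\<bar> < T'" "\<gamma>' < Re z" if "z \<in> P"
      using off[OF that] PL that \<open>T' \<ge> G\<close> by auto
    ultimately show "z \<in> - P" by auto
  qed
  have vcont: "continuous_on {y. \<bar>y\<bar> \<ge> T} (?v \<gamma>)"
  proof (intro continuous_on_compose2[OF holomorphic_on_imp_continuous_on[OF f]] continuous_intros)
    show "(\<lambda>y. Complex \<gamma> y) ` {y. T \<le> \<bar>y\<bar>} \<subseteq> - P"
    proof safe
      fix y assume "T \<le> \<bar>y\<bar>" "Complex \<gamma> y \<in> P"
      thus False using PL outside[of y] rangeI[of L y] by auto
    qed
  qed
  have core_int: "f contour_integrable_on core"
    by (rule contour_integrable_holomorphic_simple[OF f]) (use P PL core_image in \<open>auto intro: valid_path_core\<close>)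
  define R where "R = (\<lambda>T'. contour_integral (linepath (Complex \<gamma> T') (Complex \<gamma>' T')) f
      + contour_integral (linepath (Complex \<gamma>' (- T')) (Complex \<gamma> (- T'))) f)"
  have box: "contour_integral core f + \<i> * integral {T..T'} (?v \<gamma>) + \<i> * integral {- T'..- T} (?v \<gamma>) + R T'
      = \<i> * integral {- T'..T'} (?v \<gamma>')" if T': "T' > G" for T'
  proof -
    have U: "open (- P)" using P by auto
    have path: "path_image (boxed T' \<gamma>') \<subseteq> - P" using in_U T' by simp
    have "(f has_contour_integral 0) (boxed T' \<gamma>')"
      by (rule Cauchy_theorem_global[OF U f valid_path_boxed boxed_loop path]) (use zero T' in auto)
    hence 0: "contour_integral (boxed T' \<gamma>') f = 0" by (rule contour_integral_unique)
    have cint: "f contour_integrable_on linepath a b" if "closed_segment a b \<subseteq> path_image (boxed T' \<gamma>')" for a b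
      by (rule contour_integrable_holomorphic_simple[OF f U]) (use that path in auto)
    have 1: "contour_integral (linepath (Complex \<gamma> T) (Complex \<gamma> T')) f = \<i> * integral {T..T'} (?v \<gamma>)"
      by (rule contour_integral_linepath_same_Re) (use T' G in auto)
    have 2: "contour_integral (linepath (Complex \<gamma> (- T')) (Complex \<gamma> (- T))) f = \<i> * integral {- T'..- T} (?v \<gamma>)"
      by (rule contour_integral_linepath_same_Re) (use T' G in auto)
    have "contour_integral (linepath (Complex \<gamma>' (- T')) (Complex \<gamma>' T')) f = \<i> * integral {- T'..T'} (?v \<gamma>')"
      by (rule contour_integral_linepath_same_Re) (use T' G T in auto)
    moreover have "contour_integral (linepath (Complex \<gamma>' T') (Complex \<gamma>' (- T'))) f
        = - contour_integral (linepath (Complex \<gamma>' (- T')) (Complex \<gamma>' T')) f"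
      by (metis contour_integral_reversepath reversepath_linepath valid_path_linepath)
    ultimately have 3: "contour_integral (linepath (Complex \<gamma>' T') (Complex \<gamma>' (- T'))) f = - \<i> * integral {- T'..T'} (?v \<gamma>')"
      by simp
    have "contour_integral (boxed T' \<gamma>') f = contour_integral core f + (\<i> * integral {T..T'} (?v \<gamma>) +
        (contour_integral (linepath (Complex \<gamma> T') (Complex \<gamma>' T')) f + (- \<i> * integral {- T'..T'} (?v \<gamma>') +
        (contour_integral (linepath (Complex \<gamma>' (- T')) (Complex \<gamma> (- T'))) f + \<i> * integral {- T'..- T} (?v \<gamma>)))))"
    proof -
      have "f contour_integrable_on linepath (Complex \<gamma> T) (Complex \<gamma> T')"
        "f contour_integrable_on linepath (Complex \<gamma> T') (Complex \<gamma>' T')"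
        "f contour_integrable_on linepath (Complex \<gamma>' T') (Complex \<gamma>' (- T'))"
        "f contour_integrable_on linepath (Complex \<gamma>' (- T')) (Complex \<gamma> (- T'))"
        "f contour_integrable_on linepath (Complex \<gamma> (- T')) (Complex \<gamma> (- T))"
        by (rule cint, simp add: boxed_def path_image_join le_supI1 le_supI2)+
      thus ?thesis unfolding boxed_def
        by (simp add: core_int valid_path_core 1 2 3)
    qed
    thus ?thesis using 0 by (simp add: R_def algebra_simps)
  qed
  \<comment> \<open>The integrand on the two straight tails of L. The tails are absolutely
    integrable, while the bent part is kept as a gauge integral.\<close>
  define g where "g = (\<lambda>t. if T \<le> \<bar>t\<bar> then ?v \<gamma> t else 0)"
  have "compact {y. T \<le> \<bar>y\<bar> \<and> \<bar>y\<bar> \<le> G}"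
  proof -
    have "{y. T \<le> \<bar>y\<bar> \<and> \<bar>y\<bar> \<le> G} = {T..G} \<union> {-G..-T}" using T by auto
    thus ?thesis by (simp add: compact_Un)
  qed
  hence "compact (?v \<gamma> ` {y. T \<le> \<bar>y\<bar> \<and> \<bar>y\<bar> \<le> G})"
    by (intro compact_continuous_image continuous_on_subset[OF vcont]) auto
  then obtain K where "\<forall>z\<in>?v \<gamma> ` {y. T \<le> \<bar>y\<bar> \<and> \<bar>y\<bar> \<le> G}. norm z \<le> K"
    by (meson bounded_iff compact_imp_bounded)
  hence K: "norm (?v \<gamma> y) \<le> K" if "T \<le> \<bar>y\<bar>" "\<bar>y\<bar> \<le> G" for y
    using that by blast
  have g_int: "integrable lborel g"
  proof (rule Bochner_Integration.integrable_bound)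
    \<comment> \<open>Decay covers |t| \<ge> G. On T \<le> |t| \<le> G compactness gives the bound
      K, and exp(\<delta> G) offsets the factor exp(- \<delta> |t|).\<close>
    show "integrable lborel (\<lambda>t. (\<bar>C\<bar> + \<bar>K\<bar> * exp (\<delta> * G)) * exp (- \<delta> * \<bar>t\<bar>))"
      using integrable_exp_abs[OF decay(1)] by simp
    have "g = (\<lambda>t. indicator {t. T \<le> \<bar>t\<bar>} t *\<^sub>R ?v \<gamma> t)"
      by (auto simp: g_def fun_eq_iff)
    also have "\<dots> \<in> borel_measurable borel"
      by (intro borel_measurable_continuous_on_indicator vcont) measurable
    finally show "g \<in> borel_measurable lborel" by simp
    show "AE t in lborel. norm (g t) \<le> norm ((\<bar>C\<bar> + \<bar>K\<bar> * exp (\<delta> * G)) * exp (- \<delta> * \<bar>t\<bar>))"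
    proof (rule AE_I2)
      fix t :: real
      have "norm (?v \<gamma> t) \<le> \<bar>C\<bar> * exp (- \<delta> * \<bar>t\<bar>)" if "\<bar>t\<bar> \<ge> G"
      proof -
        have "norm (?v \<gamma> t) \<le> C * exp (- \<delta> * \<bar>t\<bar>)" using decay(2)[of "Complex \<gamma> t"] that G by simp
        also have "\<dots> \<le> \<bar>C\<bar> * exp (- \<delta> * \<bar>t\<bar>)" by (intro mult_right_mono) auto
        finally show ?thesis .
      qed
      moreover have "norm (?v \<gamma> t) \<le> \<bar>K\<bar> * exp (\<delta> * G) * exp (- \<delta> * \<bar>t\<bar>)" if "T \<le> \<bar>t\<bar>" "\<bar>t\<bar> \<le> G"
      proof -
        have "norm (?v \<gamma> t) \<le> \<bar>K\<bar> * 1" using K[OF that] by simp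
        also have "1 \<le> exp (\<delta> * G + - \<delta> * \<bar>t\<bar>)"
          using decay(1) that by (simp add: mult_left_mono)
        hence "\<bar>K\<bar> * 1 \<le> \<bar>K\<bar> * exp (\<delta> * G + - \<delta> * \<bar>t\<bar>)" by (intro mult_left_mono) auto
        finally show ?thesis by (simp add: exp_diff exp_minus divide_inverse mult.assoc)
      qed
      ultimately have "norm (g t) \<le> \<bar>C\<bar> * exp (- \<delta> * \<bar>t\<bar>) + \<bar>K\<bar> * exp (\<delta> * G) * exp (- \<delta> * \<bar>t\<bar>)"
        unfolding g_def by (cases "\<bar>t\<bar> \<ge> G") (auto simp: add_increasing add_increasing2)
      thus "norm (g t) \<le> norm ((\<bar>C\<bar> + \<bar>K\<bar> * exp (\<delta> * G)) * exp (- \<delta> * \<bar>t\<bar>))"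
        by (simp add: algebra_simps)
    qed
  qed
  have g_ab: "g integrable_on {a..b}" for a b
  proof -
    have "set_integrable lborel {a..b} g"
      using integrable_mult_indicator[OF _ g_int, of "{a..b}"] by (simp add: set_integrable_def)
    thus ?thesis by (rule set_borel_integral_eq_integral(1))
  qed
  have g_parts: "integral {- T'..T'} g = integral {T..T'} (?v \<gamma>) + integral {- T'..- T} (?v \<gamma>)" if "T' \<ge> T" for T'
  proof -
    have "integral {- T'..T'} g = integral {- T'..- T} g + integral {- T..T'} g"
      by (rule Henstock_Kurzweil_Integration.integral_combine[symmetric]) (use that T g_ab in auto)
    also have "integral {- T..T'} g = integral {- T..T} g + integral {T..T'} g"
      by (rule Henstock_Kurzweil_Integration.integral_combine[symmetric]) (use that T g_ab in auto)
    also have "integral {- T..T} g = integral {- T..T} (\<lambda>_. 0)"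
      by (rule integral_spike[of "{- T, T}"]) (auto simp: g_def)
    also have "integral {T..T'} g = integral {T..T'} (?v \<gamma>)"
      by (intro integral_cong) (use T in \<open>auto simp: g_def\<close>)
    also have "integral {- T'..- T} g = integral {- T'..- T} (?v \<gamma>)"
      by (intro integral_cong) (use T in \<open>auto simp: g_def\<close>)
    finally show ?thesis by simp
  qed
  have R0: "(\<lambda>n. R (real n)) \<longlonglongrightarrow> 0"
  proof (rule Lim_null_comparison)
    show "eventually (\<lambda>n. norm (R (real n)) \<le> 2 * (\<bar>C\<bar> * (\<gamma> - \<gamma>')) * exp (- \<delta> * real n)) sequentially"
    proof (rule eventually_mono[OF eventually_gt_at_top[of "nat \<lceil>G\<rceil>"]])
      fix n assume "n > nat \<lceil>G\<rceil>"
      hence n: "real n > G" by linarith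
      have "open (- P)" using P by auto
      have seg: "norm (contour_integral (linepath (Complex a c) (Complex b c)) f) \<le> \<bar>C\<bar> * exp (- \<delta> * real n) * \<bar>b - a\<bar>"
        if ab: "{a, b} = {\<gamma>', \<gamma>}" "\<bar>c\<bar> = real n" for a b c
      proof -
        have im: "Im z = c \<and> Re z \<in> {\<gamma>'..\<gamma>}" if "z \<in> closed_segment (Complex a c) (Complex b c)" for z
        proof -
          have "Im z = c" "Re z \<in> closed_segment a b"
            using that closed_segment_same_Im[of "Complex a c" "Complex b c"] by auto
          moreover have "closed_segment a b = {\<gamma>'..\<gamma>}"
            using ab(1) G(2) by (auto simp: doubleton_eq_iff closed_segment_eq_real_ivl)
          ultimately show ?thesis by simp
        qed
        have "norm (contour_integral (linepath (Complex a c) (Complex b c)) f)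
            \<le> \<bar>C\<bar> * exp (- \<delta> * real n) * norm (Complex b c - Complex a c)"
        proof (rule contour_integral_bound_linepath)
          have "closed_segment (Complex a c) (Complex b c) \<subseteq> - P"
          proof
            fix z assume "z \<in> closed_segment (Complex a c) (Complex b c)"
            thus "z \<in> - P" using im[of z] off[of z] n ab(2) by auto
          qed
          thus "f contour_integrable_on linepath (Complex a c) (Complex b c)"
            by (intro contour_integrable_holomorphic_simple[OF f \<open>open (- P)\<close>]) auto
          fix z assume "z \<in> closed_segment (Complex a c) (Complex b c)"
          with im have z: "Im z = c" "\<gamma>' \<le> Re z" "Re z \<le> \<gamma>" by auto
          have "norm (f z) \<le> C * exp (- \<delta> * \<bar>Im z\<bar>)"
            using z n ab(2) by (intro decay(2)) auto
          also have "\<dots> \<le> \<bar>C\<bar> * exp (- \<delta> * \<bar>Im z\<bar>)" by (intro mult_right_mono) auto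
          finally show "norm (f z) \<le> \<bar>C\<bar> * exp (- \<delta> * real n)" using z ab(2) by simp
        qed simp
        also have "Complex b c - Complex a c = of_real (b - a)" by (simp add: complex_eq_iff)
        finally show ?thesis by (simp only: norm_of_real)
      qed
      have "norm (R (real n)) \<le> norm (contour_integral (linepath (Complex \<gamma> (real n)) (Complex \<gamma>' (real n))) f)
          + norm (contour_integral (linepath (Complex \<gamma>' (- real n)) (Complex \<gamma> (- real n))) f)"
        unfolding R_def by (rule norm_triangle_ineq)
      also have "\<dots> \<le> \<bar>C\<bar> * exp (- \<delta> * real n) * \<bar>\<gamma>' - \<gamma>\<bar> + \<bar>C\<bar> * exp (- \<delta> * real n) * \<bar>\<gamma> - \<gamma>'\<bar>"
        by (intro add_mono seg) auto
      also have "\<dots> = 2 * (\<bar>C\<bar> * (\<gamma> - \<gamma>')) * exp (- \<delta> * real n)"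
        using G(2) by (simp add: algebra_simps)
      finally show "norm (R (real n)) \<le> 2 * (\<bar>C\<bar> * (\<gamma> - \<gamma>')) * exp (- \<delta> * real n)" .
    qed
    have "(\<lambda>n. exp (- \<delta> * real n)) \<longlonglongrightarrow> 0"
      using decay(1) by real_asymp
    thus "(\<lambda>n. 2 * (\<bar>C\<bar> * (\<gamma> - \<gamma>')) * exp (- \<delta> * real n)) \<longlonglongrightarrow> 0"
      by (rule tendsto_mult_right_zero)
  qed
  have lim': "(\<lambda>n. \<i> * integral {- real n..real n} (?v \<gamma>')) \<longlonglongrightarrow> \<i> * (\<integral>y. ?v \<gamma>' y \<partial>lborel)"
    by (intro tendsto_intros tendsto_integral_symmetric int)
  have "(\<lambda>n. contour_integral core f + \<i> * integral {- real n..real n} g + R (real n))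
      \<longlonglongrightarrow> contour_integral core f + \<i> * (\<integral>t. g t \<partial>lborel) + 0"
    by (intro tendsto_intros R0 tendsto_integral_symmetric g_int)
  moreover have "eventually (\<lambda>n. contour_integral core f + \<i> * integral {- real n..real n} g + R (real n)
      = \<i> * integral {- real n..real n} (?v \<gamma>')) sequentially"
  proof (rule eventually_mono[OF eventually_gt_at_top[of "nat \<lceil>G\<rceil>"]])
    fix n assume "n > nat \<lceil>G\<rceil>"
    hence n: "real n > G" by linarith
    show "contour_integral core f + \<i> * integral {- real n..real n} g + R (real n)
      = \<i> * integral {- real n..real n} (?v \<gamma>')"
      using box[OF n] g_parts[of "real n"] n G by (simp add: algebra_simps)
  qed
  ultimately have "(\<lambda>n. \<i> * integral {- real n..real n} (?v \<gamma>'))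
      \<longlonglongrightarrow> contour_integral core f + \<i> * (\<integral>t. g t \<partial>lborel) + 0"
    by (rule Lim_transform_eventually)
  from LIMSEQ_unique[OF this lim'] have lim: "contour_integral core f + \<i> * (\<integral>t. g t \<partial>lborel) = \<i> * (\<integral>y. ?v \<gamma>' y \<partial>lborel)"
    by simp
  have "((\<lambda>t. (if t \<in> {-T..T} then ?h t else 0) + \<i> * g t) has_integral
      contour_integral core f + \<i> * (\<integral>t. g t \<partial>lborel)) UNIV"
    using has_integral_core[OF core_int] has_integral_integral_lborel[OF g_int]
    by (intro has_integral_add has_integral_mult_right) (simp_all only: has_integral_restrict_UNIV)
  \<comment> \<open>At t = T and t = - T both pieces contribute, so these two parameters are left
    out.\<close>
  hence "(?h has_integral contour_integral core f + \<i> * (\<integral>t. g t \<partial>lborel)) UNIV"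
  proof (rule has_integral_spike_finite[of "{-T, T}", rotated 2])
    fix t assume "t \<in> UNIV - {-T, T}"
    hence t: "t \<noteq> T" "t \<noteq> - T" by auto
    show "?h t = (if t \<in> {-T..T} then ?h t else 0) + \<i> * g t"
    proof (cases "t \<in> {-T..T}")
      case True
      thus ?thesis using t by (auto simp: g_def abs_le_iff)
    next
      case False
      hence tT: "\<bar>t\<bar> > T" by auto
      have "((\<lambda>t. Complex \<gamma> t) has_vector_derivative \<i>) (at t)"
      proof -
        have "(\<lambda>t. Complex \<gamma> t) = (\<lambda>t. of_real \<gamma> + \<i> * of_real t)" by (auto simp: complex_eq_iff)
        thus ?thesis by (auto intro!: derivative_eq_intros)
      qed
      hence "(L has_vector_derivative \<i>) (at t)"
      proof (rule has_vector_derivative_transform_within_open[where S = "{t. \<bar>t\<bar> > T}"])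
        show "open {t::real. \<bar>t\<bar> > T}" by (intro open_Collect_less continuous_intros)
      qed (use tT outside in auto)
      thus ?thesis using False tT by (auto simp: g_def vector_derivative_at outside)
    qed
  qed auto
  thus ?thesis using lim by (simp add: integral_unique)
qed

end

section \<open>Wright series\<close>

text \<open>Log-convexity: the slope of ln Gamma over [x, x + \<mu>] is at least that over
  [x - 1, x], which is ln (x - 1) by the recurrence. The weight t makes x a convex combination of x
  - 1 and x + \<mu>.\<close>

lemma Gamma_add_ge:
  assumes "x > 1" "\<mu> > (0::real)"
  shows "Gamma x * (x - 1) powr \<mu> \<le> Gamma (x + \<mu>)"
proof -
  define h where "h = (ln \<circ> Gamma :: real \<Rightarrow> real)"
  have conv: "convex_on {0<..} h" unfolding h_def by (rule log_convex_Gamma_real)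
  define t where "t = 1 / (1 + \<mu>)"
  have t: "0 \<le> t" "t \<le> 1" "t * (1 + \<mu>) = 1" using assms by (auto simp: t_def)
  have "h ((1 - t) *\<^sub>R (x - 1) + t *\<^sub>R (x + \<mu>)) \<le> (1 - t) * h (x - 1) + t * h (x + \<mu>)"
    using conv t assms by (intro convex_onD) auto
  also have "(1 - t) *\<^sub>R (x - 1) + t *\<^sub>R (x + \<mu>) = (x - 1) + t * (1 + \<mu>)"
    by (simp add: algebra_simps)
  finally have "h x \<le> (1 - t) * h (x - 1) + t * h (x + \<mu>)" by (simp add: t(3))
  hence "(1 + \<mu>) * h x \<le> (1 + \<mu>) * ((1 - t) * h (x - 1) + t * h (x + \<mu>))"
    using assms by (intro mult_left_mono) auto
  also have "\<dots> = (1 + \<mu>) * h (x - 1) + (t * (1 + \<mu>)) * (h (x + \<mu>) - h (x - 1))"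
    by (simp add: algebra_simps)
  also have "\<dots> = \<mu> * h (x - 1) + h (x + \<mu>)" unfolding t(3) by (simp add: algebra_simps)
  finally have "(1 + \<mu>) * h x \<le> \<mu> * h (x - 1) + h (x + \<mu>)" .
  moreover have "h x = ln (x - 1) + h (x - 1)"
  proof -
    have "x - 1 \<notin> \<int>\<^sub>\<le>\<^sub>0" using assms by (auto elim!: nonpos_Ints_cases')
    hence "Gamma x = (x - 1) * Gamma (x - 1)" using Gamma_plus1[of "x - 1"] by simp
    moreover have "Gamma (x - 1) > 0" using assms by (intro Gamma_real_pos) auto
    ultimately show ?thesis using assms ln_mult_pos[of "x - 1" "Gamma (x - 1)"] by (simp add: h_def)
  qed
  ultimately have "h x + \<mu> * ln (x - 1) \<le> h (x + \<mu>)" by (simp add: algebra_simps)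
  hence "exp (h x) * exp (\<mu> * ln (x - 1)) \<le> exp (h (x + \<mu>))" by (simp flip: exp_add)
  moreover have "exp (h x) = Gamma x" "exp (h (x + \<mu>)) = Gamma (x + \<mu>)"
    using assms by (auto simp: h_def)
  ultimately show ?thesis using assms by (simp add: powr_def)
qed

lemma prod_list_le_power:
  fixes f :: "'a \<Rightarrow> real"
  assumes "\<And>a. a \<in> set xs \<Longrightarrow> 0 \<le> f a \<and> f a \<le> b"
  shows "(\<Prod>a\<leftarrow>xs. f a) \<le> b ^ length xs" "0 \<le> (\<Prod>a\<leftarrow>xs. f a)"
proof -
  have "0 \<le> (\<Prod>a\<leftarrow>xs. f a) \<and> (\<Prod>a\<leftarrow>xs. f a) \<le> b ^ length xs" using assms
  proof (induction xs)
    case (Cons y ys)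
    hence "0 \<le> f y" "f y \<le> b" "0 \<le> (\<Prod>a\<leftarrow>ys. f a)" "(\<Prod>a\<leftarrow>ys. f a) \<le> b ^ length ys" by auto
    moreover from this have "0 \<le> b" by linarith
    ultimately show ?case by (auto intro!: mult_mono)
  qed auto
  thus "(\<Prod>a\<leftarrow>xs. f a) \<le> b ^ length xs" "0 \<le> (\<Prod>a\<leftarrow>xs. f a)" by auto
qed

lemma norm_prod_list: "norm (\<Prod>a\<leftarrow>xs. f a) = (\<Prod>a\<leftarrow>xs. norm (f a :: complex))"
  by (induction xs) (auto simp: norm_mult)

lemma prod_list_Gamma_Suc:
  assumes "\<And>a. a \<in> set as \<Longrightarrow> a + of_nat n \<notin> \<int>\<^sub>\<le>\<^sub>0"
  shows "(\<Prod>a\<leftarrow>as. Gamma (a + of_nat (Suc n))) = (\<Prod>a\<leftarrow>as. a + of_nat n) * (\<Prod>a\<leftarrow>as. Gamma (a + of_nat n) :: complex)"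
  using assms
proof (induction as)
  case (Cons a as)
  have "Gamma (a + of_nat (Suc n)) = (a + of_nat n) * Gamma (a + of_nat n)"
    using Cons.prems[of a] Gamma_plus1[of "a + of_nat n"] by (simp add: add_ac)
  thus ?case using Cons by (simp add: mult_ac)
qed auto

text \<open>Ratio test: from n to n + 1 the product of Gamma values gains at most (2 n)^q and the
  reciprocal Gamma factor at most (\<mu> n / 2)^(- \<mu>). As \<mu> > q, the ratio tends to 0
  whatever R is.\<close>

lemma summable_Gamma_quotients:
  fixes as :: "complex list" and b \<mu> R :: real
  assumes "\<mu> > real (length as)" "R \<ge> 0"
  shows "summable (\<lambda>n. norm (\<Prod>a\<leftarrow>as. Gamma (a + of_nat n)) * \<bar>rGamma (b + \<mu> * real n)\<bar> * R ^ n)"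
proof -
  define q where "q = length as"
  define f where "f = (\<lambda>n. norm (\<Prod>a\<leftarrow>as. Gamma (a + of_nat n)) * \<bar>rGamma (b + \<mu> * real n)\<bar> * R ^ n)"
  have \<mu>: "\<mu> > 0" "\<mu> > real q" using assms by (auto simp: q_def)
  \<comment> \<open>From such n on, a + n is not a pole and |a + n| \<le> 2 n.\<close>
  have as: "eventually (\<lambda>n. \<forall>a\<in>set as. norm a < real n) sequentially"
    using filterlim_real_sequentially by (intro eventually_ball_finite ballI) (auto simp: filterlim_at_top_dense)
  have "(\<lambda>n. (2 ^ q * R * (\<mu> / 2) powr (- \<mu>)) * real n powr (real q - \<mu>)) \<longlonglongrightarrow> (2 ^ q * R * (\<mu> / 2) powr (- \<mu>)) * 0"
    using \<mu> by (intro tendsto_mult tendsto_const tendsto_neg_powr filterlim_real_sequentially) auto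
  hence small: "eventually (\<lambda>n. (2 ^ q * R * (\<mu> / 2) powr (- \<mu>)) * real n powr (real q - \<mu>) < 1/2) sequentially"
    by (intro order_tendstoD(2)) auto
  \<comment> \<open>Ensures b + \<mu> n - 1 \<ge> \<mu> n / 2, so that the lower bound for Gamma
    quotients applies.\<close>
  have big: "eventually (\<lambda>n. \<mu> * real n / 2 > 1 + \<bar>b\<bar>) sequentially"
    using \<mu>(1) by real_asymp
  have "eventually (\<lambda>n. norm (f (Suc n)) \<le> 1/2 * norm (f n)) sequentially"
    using as small big eventually_gt_at_top[of 0]
  proof eventually_elim
    case (elim n)
    let ?x = "b + \<mu> * real n"
    have x: "?x - 1 \<ge> \<mu> * real n / 2" "?x > 1" using elim(3) by linarith+
    have npos: "a + of_nat n \<notin> \<int>\<^sub>\<le>\<^sub>0" if "a \<in> set as" for a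
    proof
      assume "a + of_nat n \<in> \<int>\<^sub>\<le>\<^sub>0"
      then obtain k where "a + of_nat n = - of_nat k" by (auto elim!: nonpos_Ints_cases')
      from arg_cong[OF this, of Re] have "Re (a + of_nat n) \<le> 0" by simp
      moreover have "- Re a \<le> norm a" using abs_Re_le_cmod[of a] by linarith
      ultimately show False using elim(1) that by fastforce
    qed
    have P: "norm (\<Prod>a\<leftarrow>as. Gamma (a + of_nat (Suc n))) \<le> (2 * real n) ^ q * norm (\<Prod>a\<leftarrow>as. Gamma (a + of_nat n))"
    proof -
      have "norm (\<Prod>a\<leftarrow>as. a + of_nat n) \<le> (2 * real n) ^ q"
        unfolding norm_prod_list q_def
      proof (rule prod_list_le_power(1))
        fix a assume "a \<in> set as"
        hence "norm a < real n" using elim(1) by blast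
        thus "0 \<le> norm (a + of_nat n) \<and> norm (a + of_nat n) \<le> 2 * real n"
          using norm_triangle_ineq[of a "of_nat n"] by simp
      qed
      thus ?thesis by (subst prod_list_Gamma_Suc[OF npos]) (auto simp: norm_mult intro!: mult_right_mono)
    qed
    have G: "\<bar>rGamma (?x + \<mu>)\<bar> \<le> (\<mu> * real n / 2) powr (- \<mu>) * \<bar>rGamma ?x\<bar>"
    proof -
      have Gx: "Gamma ?x > 0" "Gamma (?x + \<mu>) > 0" using x \<mu> by (auto intro!: Gamma_real_pos)
      have "Gamma ?x * (\<mu> * real n / 2) powr \<mu> \<le> Gamma ?x * (?x - 1) powr \<mu>"
        using Gx x \<mu> by (intro mult_left_mono powr_mono2) auto
      also have "\<dots> \<le> Gamma (?x + \<mu>)" by (rule Gamma_add_ge[OF x(2) \<mu>(1)])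
      finally have le: "Gamma ?x * (\<mu> * real n / 2) powr \<mu> \<le> Gamma (?x + \<mu>)" .
      have "0 < Gamma ?x * (\<mu> * real n / 2) powr \<mu>" using Gx \<mu> elim(4) by simp
      from le_imp_inverse_le[OF le this] show ?thesis
        using Gx by (simp add: rGamma_inverse_Gamma powr_minus mult.commute)
    qed
    have "norm (f (Suc n)) = norm (\<Prod>a\<leftarrow>as. Gamma (a + of_nat (Suc n))) * \<bar>rGamma (?x + \<mu>)\<bar> * (R * R ^ n)"
      using assms(2) by (simp add: f_def algebra_simps abs_mult)
    also have "\<dots> \<le> ((2 * real n) ^ q * norm (\<Prod>a\<leftarrow>as. Gamma (a + of_nat n))) * ((\<mu> * real n / 2) powr (- \<mu>) * \<bar>rGamma ?x\<bar>) * (R * R ^ n)"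
      using P G assms(2) by (intro mult_mono) auto
    also have "\<dots> = ((2 * real n) ^ q * (\<mu> * real n / 2) powr (- \<mu>) * R) * norm (f n)"
      using assms(2) by (simp add: f_def abs_mult)
    also have "(2 * real n) ^ q * (\<mu> * real n / 2) powr (- \<mu>) * R = (2 ^ q * R * (\<mu> / 2) powr (- \<mu>)) * real n powr (real q - \<mu>)"
    proof -
      have "(\<mu> * real n / 2) powr (- \<mu>) = (\<mu> / 2) powr (- \<mu>) * real n powr (- \<mu>)"
        using powr_mult[of "\<mu> / 2" "real n" "- \<mu>"] \<mu> by simp
      moreover have "(2 * real n) ^ q = 2 ^ q * real n powr real q"
        using elim(4) by (simp add: power_mult_distrib powr_realpow)
      moreover have "real n powr (real q - \<mu>) = real n powr real q * real n powr (- \<mu>)"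
        by (simp flip: powr_add)
      ultimately show ?thesis by (simp only: mult_ac)
    qed
    also have "\<dots> * norm (f n) \<le> 1/2 * norm (f n)"
      using elim(2) by (intro mult_right_mono) auto
    finally show "norm (f (Suc n)) \<le> 1/2 * norm (f n)" .
  qed
  then obtain N where "\<And>n. n \<ge> N \<Longrightarrow> norm (f (Suc n)) \<le> 1/2 * norm (f n)"
    by (auto simp: eventually_sequentially)
  thus ?thesis using summable_ratio_test[of "1/2" N f] by (simp add: f_def)
qed

section \<open>Wright series as superpositions over a counting measure\<close>

lemma integrable_count_space_times_nat:
  fixes f :: "'a \<times> nat \<Rightarrow> complex"
  assumes "finite K" "\<And>k. k \<in> K \<Longrightarrow> summable (\<lambda>n. norm (f (k, n)))"
  shows "integrable (count_space (K \<times> UNIV)) f"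
    and "(\<integral>p. f p \<partial>count_space (K \<times> UNIV)) = (\<Sum>k\<in>K. \<Sum>n. f (k, n))"
proof -
  have s: "Infinite_Set_Sum.abs_summable_on (\<lambda>n. f (k, n)) UNIV" if "k \<in> K" for k
    using assms(2)[OF that] by (simp add: Infinite_Set_Sum.abs_summable_on_nat_iff')
  have *: "Infinite_Set_Sum.abs_summable_on f (K \<times> UNIV)"
    using assms s by (subst abs_summable_on_Sigma_iff) (auto intro: countable_finite)
  thus "integrable (count_space (K \<times> UNIV)) f" by (simp add: Infinite_Set_Sum.abs_summable_on_def)
  have "infsetsum f (K \<times> UNIV) = infsetsum (\<lambda>k. infsetsum (\<lambda>n. f (k, n)) UNIV) K"
    using assms(1) * by (intro infsetsum_Sigma) (auto intro: countable_finite)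
  also have "\<dots> = (\<Sum>k\<in>K. \<Sum>n. f (k, n))"
    using assms(1) s by (simp add: infsetsum_nat')
  finally show "(\<integral>p. f p \<partial>count_space (K \<times> UNIV)) = (\<Sum>k\<in>K. \<Sum>n. f (k, n))"
    by (simp add: infsetsum_def)
qed

lemma powr_mult_of_nat: "x > 0 \<Longrightarrow> x powr (e * real n) = (x powr e) ^ n" for x e :: real
  by (simp add: powr_powr[symmetric] powr_realpow)

text \<open>A factor linear in n is absorbed into the radius of the series, which is harmless
  because convergence holds for every radius.\<close>

lemma affine_le_power_two: "\<bar>a + b * real n\<bar> \<le> (\<bar>a\<bar> + \<bar>b\<bar>) * 2 ^ n"
proof -
  have "\<bar>a + b * real n\<bar> \<le> \<bar>a\<bar> * 1 + \<bar>b\<bar> * real n"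
    using abs_triangle_ineq[of a "b * real n"] by (simp add: abs_mult)
  also have "\<dots> \<le> \<bar>a\<bar> * 2 ^ n + \<bar>b\<bar> * 2 ^ n"
    using of_nat_less_two_power[of n, where 'a = real] by (intro add_mono mult_left_mono) auto
  finally show ?thesis by (simp add: algebra_simps)
qed

text \<open>The numerator pair (1, 1) contributes n!, which cancels the factorial built into
  \<open>wright\<close>.\<close>

lemma wright_snoc_one:
  "wright (map (\<lambda>a. (a, 1)) as @ [(1, 1)]) [(b, \<beta>)] z
    = (\<Sum>n. (\<Prod>a\<leftarrow>as. Gamma (a + of_nat n)) * rGamma (b + of_real (\<beta> * real n)) * z ^ n)"
proof -
  have "Gamma (1 + complex_of_nat n) = fact n" for n by (rule Gamma_fact)
  thus ?thesis by (simp add: wright_def o_def mult_ac)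
qed

text \<open>Common core of parts 2 and 3. The coefficients of the equation enter only through
  \<open>ind\<close>, which matches term n + 1 of the time derivative with term n of the right-hand
  side. \<open>len\<close> gives convergence, and \<open>poles\<close> permits the recurrence in the
  Gamma factors.\<close>

lemma wright_series_solution:
  fixes as :: "nat \<Rightarrow> complex list" and \<alpha> d A B C a Z :: real and c :: "nat \<Rightarrow> complex" and m :: nat
  defines "\<mu> \<equiv> \<alpha> + real m"
  defines "\<sigma> \<equiv> (\<lambda>k n. \<alpha> - real k + \<mu> * real n)"
  defines "\<rho> \<equiv> (\<lambda>k n. a + (d - 2) * \<sigma> k n / \<mu>)"
  assumes \<alpha>: "\<alpha> > 0" and K: "K \<subseteq> {1..nat \<lfloor>\<alpha>\<rfloor> + 1}"
    and len: "\<And>k. k \<in> K \<Longrightarrow> real (length (as k)) < \<mu>"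
    and poles: "\<And>k a n. k \<in> K \<Longrightarrow> a \<in> set (as k) \<Longrightarrow> a + of_nat n \<notin> \<int>\<^sub>\<le>\<^sub>0"
    and ind: "\<And>k n. k \<in> K \<Longrightarrow> of_real Z * (\<Prod>a\<leftarrow>as k. a + of_nat n)
      = of_real (pochhammer (1 + \<sigma> k n) m * (A * \<rho> k n * (\<rho> k n - 1) + B * \<rho> k n + C))"
    and u: "\<And>x t. x > 0 \<Longrightarrow> t > 0 \<Longrightarrow> u x t = of_real (x powr a) *
      (\<Sum>k\<in>K. c k * of_real (x powr ((d - 2) * (\<alpha> - real k) / \<mu>) * t powr (\<alpha> - real k)) *
        wright (map (\<lambda>a. (a, 1)) (as k) @ [(1, 1)]) [(of_real (1 + \<alpha> - real k), \<mu>)]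
          (of_real (Z * x powr (d - 2) * t powr \<mu>)))"
  shows "fractional_eq_solution \<alpha> m d A B C u"
proof -
  have \<mu>: "\<mu> > 0" using \<alpha> by (simp add: \<mu>_def)
  have finK: "finite K" using K finite_subset by blast
  define Q where "Q = (\<lambda>k n. \<Prod>a\<leftarrow>as k. Gamma (a + of_nat n))"
  define w where "w = (\<lambda>(k, n). c k * Q k n * of_real Z ^ n)"
  define s where "s = (\<lambda>(k, n). complex_of_real (\<sigma> k n))"
  define r where "r = (\<lambda>(k, n). complex_of_real (\<rho> k n))"
  define M where "M = count_space (K \<times> (UNIV :: nat set))"
  define E where "E = (\<lambda>x t k n. of_real (x powr \<rho> k n * t powr \<sigma> k n) :: complex)"
  have powers: "x powr \<rho> k n = x powr (a + (d - 2) * (\<alpha> - real k) / \<mu>) * (x powr (d - 2)) ^ n"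
      "t powr (\<sigma> k n + \<nu>) = t powr (\<alpha> - real k + \<nu>) * (t powr \<mu>) ^ n" if "x > 0" "t > 0" for x t k n \<nu>
  proof -
    have "\<rho> k n = (a + (d - 2) * (\<alpha> - real k) / \<mu>) + (d - 2) * real n"
      using \<mu> by (simp add: \<rho>_def \<sigma>_def field_simps)
    thus "x powr \<rho> k n = x powr (a + (d - 2) * (\<alpha> - real k) / \<mu>) * (x powr (d - 2)) ^ n"
      using that by (simp only: powr_add powr_mult_of_nat)
    have "\<sigma> k n + \<nu> = (\<alpha> - real k + \<nu>) + \<mu> * real n" by (simp add: \<sigma>_def)
    thus "t powr (\<sigma> k n + \<nu>) = t powr (\<alpha> - real k + \<nu>) * (t powr \<mu>) ^ n"
      using that by (simp only: powr_add powr_mult_of_nat)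
  qed
  have summ: "summable (\<lambda>n. norm (w (k, n) * rGamma (1 + s (k, n) + of_real \<nu>) * of_real t powr (s (k, n) + of_real \<nu>)
        * of_real x powr r (k, n) * r (k, n) ^ j))" if k: "k \<in> K" and xt: "x > 0" "t > 0" for x t \<nu> k j
  proof -
    \<comment> \<open>The factor 2^j comes from the bound D^j (2^j)^n for |\<rho>|^j.\<close>
    define R where "R = \<bar>Z\<bar> * x powr (d - 2) * t powr \<mu> * 2 ^ j"
    define b where "b = 1 + \<alpha> - real k + \<nu>"
    define D where "D = \<bar>a + (d - 2) * (\<alpha> - real k) / \<mu>\<bar> + \<bar>d - 2\<bar>"
    define D' where "D' = norm (c k) * x powr (a + (d - 2) * (\<alpha> - real k) / \<mu>) * t powr (\<alpha> - real k + \<nu>) * D ^ j"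
    have "summable (\<lambda>n. norm (Q k n) * \<bar>rGamma (b + \<mu> * real n)\<bar> * R ^ n)"
      unfolding Q_def by (rule summable_Gamma_quotients[OF len[OF k]]) (simp add: R_def)
    hence "summable (\<lambda>n. D' * (norm (Q k n) * \<bar>rGamma (b + \<mu> * real n)\<bar> * R ^ n))"
      by (rule summable_mult)
    thus ?thesis
    proof (rule summable_comparison_test'[where N = 0])
      fix n
      have rho: "\<bar>\<rho> k n\<bar> ^ j \<le> (D * 2 ^ n) ^ j"
      proof (rule power_mono)
        have "\<rho> k n = (a + (d - 2) * (\<alpha> - real k) / \<mu>) + (d - 2) * real n"
          using \<mu> by (simp add: \<rho>_def \<sigma>_def field_simps)
        thus "\<bar>\<rho> k n\<bar> \<le> D * 2 ^ n" using affine_le_power_two by (simp add: D_def)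
      qed simp
      have rG: "norm (rGamma (1 + s (k, n) + of_real \<nu>)) = \<bar>rGamma (b + \<mu> * real n)\<bar>"
      proof -
        have "1 + s (k, n) + of_real \<nu> = of_real (b + \<mu> * real n)" by (simp add: s_def \<sigma>_def b_def)
        thus ?thesis by (simp only: rGamma_complex_of_real norm_of_real)
      qed
      have tp: "norm (of_real t powr (s (k, n) + of_real \<nu>)) = t powr (\<alpha> - real k + \<nu>) * (t powr \<mu>) ^ n"
        using powers(2)[OF xt] xt by (simp add: s_def norm_of_real_powr)
      have xp: "norm (of_real x powr r (k, n)) = x powr (a + (d - 2) * (\<alpha> - real k) / \<mu>) * (x powr (d - 2)) ^ n"
        using powers(1)[OF xt] xt by (simp add: r_def norm_of_real_powr)
      have "norm (w (k, n) * rGamma (1 + s (k, n) + of_real \<nu>) * of_real t powr (s (k, n) + of_real \<nu>)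
          * of_real x powr r (k, n) * r (k, n) ^ j)
        = norm (c k) * norm (Q k n) * \<bar>Z\<bar> ^ n * \<bar>rGamma (b + \<mu> * real n)\<bar>
          * (t powr (\<alpha> - real k + \<nu>) * (t powr \<mu>) ^ n)
          * (x powr (a + (d - 2) * (\<alpha> - real k) / \<mu>) * (x powr (d - 2)) ^ n) * \<bar>\<rho> k n\<bar> ^ j"
        by (simp add: norm_mult norm_power rG tp xp) (simp add: w_def r_def norm_mult norm_power)
      also have "\<dots> \<le> norm (c k) * norm (Q k n) * \<bar>Z\<bar> ^ n * \<bar>rGamma (b + \<mu> * real n)\<bar>
          * (t powr (\<alpha> - real k + \<nu>) * (t powr \<mu>) ^ n)
          * (x powr (a + (d - 2) * (\<alpha> - real k) / \<mu>) * (x powr (d - 2)) ^ n) * (D * 2 ^ n) ^ j"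
        by (intro mult_left_mono rho) auto
      also have "\<dots> = D' * (norm (Q k n) * \<bar>rGamma (b + \<mu> * real n)\<bar> * R ^ n)"
      proof -
        have "(D * 2 ^ n) ^ j = D ^ j * (2 ^ j) ^ n"
          unfolding power_mult_distrib power_mult[symmetric] by (simp only: mult.commute)
        moreover have "R ^ n = \<bar>Z\<bar> ^ n * (x powr (d - 2)) ^ n * (t powr \<mu>) ^ n * (2 ^ j) ^ n"
          by (simp only: R_def power_mult_distrib)
        ultimately show ?thesis unfolding D'_def by (simp only: mult_ac)
      qed
      finally show "norm (norm (w (k, n) * rGamma (1 + s (k, n) + of_real \<nu>) * of_real t powr (s (k, n) + of_real \<nu>)
          * of_real x powr r (k, n) * r (k, n) ^ j)) \<le> D' * (norm (Q k n) * \<bar>rGamma (b + \<mu> * real n)\<bar> * R ^ n)"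
        by simp
    qed
  qed
  have int: "integrable M (\<lambda>p. w p * rGamma (1 + s p + of_real \<nu>) * of_real t powr (s p + of_real \<nu>)
        * of_real x powr r p * r p ^ j)" if "x > 0" "t > 0" for x t \<nu> j
    unfolding M_def by (rule integrable_count_space_times_nat(1)[OF finK]) (rule summ[OF _ that])
  have u_int: "u x t = (\<integral>p. w p * rGamma (1 + s p) * of_real t powr s p * of_real x powr r p \<partial>M)"
    if xt: "x > 0" "t > 0" for x t
  proof -
    have S: "summable (\<lambda>n. norm (w (k, n) * rGamma (1 + s (k, n)) * of_real t powr s (k, n) * of_real x powr r (k, n)))"
      if "k \<in> K" for k using summ[OF that xt, of 0 0] by simp
    have "(\<integral>p. w p * rGamma (1 + s p) * of_real t powr s p * of_real x powr r p \<partial>M)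
      = (\<Sum>k\<in>K. \<Sum>n. w (k, n) * rGamma (1 + s (k, n)) * of_real t powr s (k, n) * of_real x powr r (k, n))"
      unfolding M_def by (rule integrable_count_space_times_nat(2)[OF finK S])
    also have "\<dots> = u x t"
      unfolding u[OF xt] sum_distrib_left
    proof (rule sum.cong[OF refl])
      fix k assume k: "k \<in> K"
      let ?F = "of_real (x powr a) * (c k * of_real (x powr ((d - 2) * (\<alpha> - real k) / \<mu>) * t powr (\<alpha> - real k)))"
      let ?W = "\<lambda>n. Q k n * rGamma (of_real (1 + \<alpha> - real k) + of_real (\<mu> * real n)) * of_real (Z * x powr (d - 2) * t powr \<mu>) ^ n"
      have F0: "w (k, n) * rGamma (1 + s (k, n)) * of_real t powr s (k, n) * of_real x powr r (k, n) = ?F * ?W n" for n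
      proof -
        have "of_real t powr s (k, n) = of_real (t powr (\<alpha> - real k) * (t powr \<mu>) ^ n)"
          using powers(2)[OF xt, of k n 0] xt by (simp add: s_def powr_of_real)
        moreover have "of_real x powr r (k, n) = of_real (x powr a * x powr ((d - 2) * (\<alpha> - real k) / \<mu>) * (x powr (d - 2)) ^ n)"
          using powers(1)[OF xt, of k n] xt by (simp add: r_def powr_of_real powr_add)
        moreover have "1 + s (k, n) = of_real (1 + \<alpha> - real k) + of_real (\<mu> * real n)"
          by (simp add: s_def \<sigma>_def)
        ultimately show ?thesis
          by (simp only: w_def prod.case of_real_mult of_real_power power_mult_distrib mult_ac)
      qed
      show "(\<Sum>n. w (k, n) * rGamma (1 + s (k, n)) * of_real t powr s (k, n) * of_real x powr r (k, n))
          = of_real (x powr a) * (c k * of_real (x powr ((d - 2) * (\<alpha> - real k) / \<mu>) * t powr (\<alpha> - real k)) *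
        wright (map (\<lambda>a. (a, 1)) (as k) @ [(1, 1)]) [(of_real (1 + \<alpha> - real k), \<mu>)]
          (of_real (Z * x powr (d - 2) * t powr \<mu>)))"
      \<comment> \<open>When c k = 0, summability of the products says nothing about the Wright
        series itself.\<close>
      proof (cases "?F = 0")
        case True
        thus ?thesis by (simp only: F0 mult_zero_left suminf_zero mult.assoc[symmetric])
      next
        case False
        have "summable (\<lambda>n. ?F * ?W n)" using summable_norm_cancel[OF S[OF k]] by (simp only: F0)
        hence "summable ?W" using False by (rule summable_mult_D)
        hence "(\<Sum>n. ?F * ?W n) = ?F * (\<Sum>n. ?W n)" by (rule suminf_mult)
        also have "(\<Sum>n. ?W n) = wright (map (\<lambda>a. (a, 1)) (as k) @ [(1, 1)]) [(of_real (1 + \<alpha> - real k), \<mu>)]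
          (of_real (Z * x powr (d - 2) * t powr \<mu>))"
          unfolding wright_snoc_one Q_def ..
        finally show ?thesis unfolding F0 by (simp only: mult.assoc)
      qed
    qed
    finally show ?thesis ..
  qed
  have M_sf: "sigma_finite_measure M"
    unfolding M_def using finK by (intro sigma_finite_measure_count_space_countable) (auto intro: countable_finite)
  have meas: "f \<in> borel_measurable M" for f :: "nat \<times> nat \<Rightarrow> complex"
    by (simp add: M_def)
  \<comment> \<open>The smallest exponent occurs for k = \<lfloor>\<alpha>\<rfloor> + 1 and n = 0;
    it exceeds -1 because \<alpha> is not an integer.\<close>
  have s_lower: "\<exists>\<sigma>0>-1. \<forall>p\<in>space M. Re (s p) \<ge> \<sigma>0" if "\<alpha> \<notin> \<int>"
  proof (intro exI[of _ "\<alpha> - real (nat \<lfloor>\<alpha>\<rfloor> + 1)"] conjI ballI)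
    have "of_int \<lfloor>\<alpha>\<rfloor> \<noteq> \<alpha>" using that Ints_of_int by metis
    thus "- 1 < \<alpha> - real (nat \<lfloor>\<alpha>\<rfloor> + 1)" using \<alpha> by linarith
    fix p assume "p \<in> space M"
    then obtain k n where "p = (k, n)" "k \<in> K" by (auto simp: M_def)
    moreover from this have "real k \<le> real (nat \<lfloor>\<alpha>\<rfloor> + 1)" using K by auto
    moreover have "\<mu> * real n \<ge> 0" using \<mu> by simp
    ultimately show "\<alpha> - real (nat \<lfloor>\<alpha>\<rfloor> + 1) \<le> Re (s p)"
      by (simp add: s_def \<sigma>_def)
  qed
  have RL: "RL_differentiable \<alpha> (\<lambda>t. u x t)"
    "t > 0 \<Longrightarrow> RL_deriv \<alpha> (\<lambda>t. u x t) t
      = (\<integral>p. (w p * of_real x powr r p) * rGamma (1 + s p - of_real \<alpha>) * of_real t powr (s p - of_real \<alpha>) \<partial>M)"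
    if x: "x > 0" for x t
  proof -
    have i: "integrable M (\<lambda>p. (w p * of_real x powr r p) * rGamma (1 + s p + of_real \<nu>) * of_real t powr (s p + of_real \<nu>))"
      if "t > 0" for \<nu> t using int[OF x that, of \<nu> 0] by (simp add: mult_ac)
    have e: "u x t = (\<integral>p. (w p * of_real x powr r p) * rGamma (1 + s p) * of_real t powr s p \<partial>M)" if "t > 0" for t
      using u_int[OF x that] by (simp add: mult_ac)
    note * = RL_deriv_superposition[OF M_sf meas meas i s_lower e \<alpha>]
    show "RL_differentiable \<alpha> (\<lambda>t. u x t)" by (rule *(1))
    show "t > 0 \<Longrightarrow> RL_deriv \<alpha> (\<lambda>t. u x t) t
      = (\<integral>p. (w p * of_real x powr r p) * rGamma (1 + s p - of_real \<alpha>) * of_real t powr (s p - of_real \<alpha>) \<partial>M)"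
      by (rule *(2))
  qed
  have X: "times_differentiable_on 2 (\<lambda>x. u x t) {0<..}"
    "x > 0 \<Longrightarrow> (A * x powr d) *\<^sub>R nth_vderiv 2 (\<lambda>x. u x t) x + (B * x powr (d - 1)) *\<^sub>R nth_vderiv 1 (\<lambda>x. u x t) x
           + (C * x powr (d - 2)) *\<^sub>R u x t
         = (\<integral>p. w p * rGamma (1 + s p) * of_real t powr s p * (of_real A * r p * (r p - 1) + of_real B * r p + of_real C)
                 * of_real x powr (r p + of_real (d - 2)) \<partial>M)"
    if t: "t > 0" for x t
  proof -
    have i: "integrable M (\<lambda>p. w p * rGamma (1 + s p) * of_real t powr s p * of_real x powr r p * r p ^ j)"
      if "x > 0" "j \<le> 2" for x j using int[OF that(1) t, of 0 j] by simp
    have e: "u x t = (\<integral>p. w p * rGamma (1 + s p) * of_real t powr s p * of_real x powr r p \<partial>M)" if "x > 0" for x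
      by (rule u_int[OF that t])
    note * = euler_operator_superposition[OF i e]
    show "times_differentiable_on 2 (\<lambda>x. u x t) {0<..}" by (rule *(1))
    show "x > 0 \<Longrightarrow> (A * x powr d) *\<^sub>R nth_vderiv 2 (\<lambda>x. u x t) x + (B * x powr (d - 1)) *\<^sub>R nth_vderiv 1 (\<lambda>x. u x t) x
           + (C * x powr (d - 2)) *\<^sub>R u x t
         = (\<integral>p. w p * rGamma (1 + s p) * of_real t powr s p * (of_real A * r p * (r p - 1) + of_real B * r p + of_real C)
                 * of_real x powr (r p + of_real (d - 2)) \<partial>M)"
      by (rule *(2))
  qed
  have eq: "RL_deriv \<alpha> (\<lambda>t. u x t) t = t ^ m *\<^sub>R ((A * x powr d) *\<^sub>R nth_vderiv 2 (\<lambda>x. u x t) x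
      + (B * x powr (d - 1)) *\<^sub>R nth_vderiv 1 (\<lambda>x. u x t) x + (C * x powr (d - 2)) *\<^sub>R u x t)"
    if xt: "x > 0" "t > 0" for x t
  proof -
    define l where "l = (\<lambda>p. (w p * of_real x powr r p) * rGamma (1 + s p - of_real \<alpha>) * of_real t powr (s p - of_real \<alpha>))"
    define g where "g = (\<lambda>p. w p * rGamma (1 + s p) * of_real t powr s p * (of_real A * r p * (r p - 1) + of_real B * r p + of_real C)
                 * of_real x powr (r p + of_real (d - 2)))"
    \<comment> \<open>One step in n raises \<sigma> by \<mu> = \<alpha> + m, of which the derivative
      consumes \<alpha> and m is left as t^m; it raises \<rho> by d - 2.\<close>
    have step: "l (k, Suc n) = of_real (t ^ m) * g (k, n)" if k: "k \<in> K" for k n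
    proof -
      have s: "s (k, Suc n) = s (k, n) + of_real \<mu>" by (simp add: s_def \<sigma>_def algebra_simps)
      have r: "r (k, Suc n) = r (k, n) + of_real (d - 2)"
        using \<mu> by (simp add: r_def \<rho>_def \<sigma>_def field_simps)
      have w: "w (k, Suc n) = (of_real Z * (\<Prod>a\<leftarrow>as k. a + of_nat n)) * w (k, n)"
      proof -
        have PG: "(\<Prod>a\<leftarrow>as k. Gamma (a + of_nat (Suc n))) = (\<Prod>a\<leftarrow>as k. a + of_nat n) * (\<Prod>a\<leftarrow>as k. Gamma (a + of_nat n))"
          by (rule prod_list_Gamma_Suc) (rule poles[OF k])
        show ?thesis unfolding w_def Q_def prod.case power_Suc PG by (simp only: mult_ac)
      qed
      have poch: "of_real (pochhammer (1 + \<sigma> k n) m) * rGamma (1 + s (k, n) + of_nat m) = rGamma (1 + s (k, n))"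
      proof -
        have "1 + s (k, n) = of_real (1 + \<sigma> k n)" by (simp add: s_def)
        thus ?thesis using pochhammer_rGamma[of "1 + s (k, n)" m] by (simp only: pochhammer_of_real)
      qed
      have t: "of_real t powr (s (k, Suc n) - of_real \<alpha>) = of_real (t ^ m) * of_real t powr s (k, n)"
      proof -
        have "s (k, Suc n) - of_real \<alpha> = of_nat m + s (k, n)" by (simp add: s \<mu>_def)
        thus ?thesis using xt by (simp add: powr_add)
      qed
      have sG: "1 + s (k, Suc n) - of_real \<alpha> = 1 + s (k, n) + of_nat m" by (simp add: s \<mu>_def)
      define Pq where "Pq = complex_of_real (A * \<rho> k n * (\<rho> k n - 1) + B * \<rho> k n + C)"
      have Pq: "of_real A * r (k, n) * (r (k, n) - 1) + of_real B * r (k, n) + of_real C = Pq"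
        by (simp add: r_def Pq_def)
      have w': "w (k, Suc n) = of_real (pochhammer (1 + \<sigma> k n) m) * Pq * w (k, n)"
        unfolding w ind[OF k] Pq_def of_real_mult by (rule refl)
      have "l (k, Suc n) = of_real (pochhammer (1 + \<sigma> k n) m) * Pq * w (k, n) * of_real x powr (r (k, n) + of_real (d - 2))
          * rGamma (1 + s (k, n) + of_nat m) * (of_real (t ^ m) * of_real t powr s (k, n))"
        by (simp only: l_def sG t w' r)
      also have "\<dots> = (of_real (pochhammer (1 + \<sigma> k n) m) * rGamma (1 + s (k, n) + of_nat m)) * Pq * w (k, n)
          * of_real x powr (r (k, n) + of_real (d - 2)) * (of_real (t ^ m) * of_real t powr s (k, n))"
        by (simp only: mult_ac)
      also have "\<dots> = of_real (t ^ m) * g (k, n)"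
        unfolding poch g_def Pq by (simp only: mult_ac)
      finally show ?thesis .
    qed
    \<comment> \<open>1 + \<sigma> - \<alpha> equals 1 - k, a pole of Gamma since k \<ge> 1: the
      derivative annihilates the first term, and this makes the index shift lossless.\<close>
    have zero: "l (k, 0) = 0" if k: "k \<in> K" for k
    proof -
      have "1 + s (k, 0) - of_real \<alpha> = - of_nat (k - 1)"
        using k K by (auto simp: s_def \<sigma>_def of_nat_diff)
      hence "rGamma (1 + s (k, 0) - of_real \<alpha>) = 0" by (simp only: rGamma_eq_zero_iff) simp
      thus ?thesis by (simp add: l_def)
    qed
    have l_sum: "summable (\<lambda>n. norm (l (k, n)))" if "k \<in> K" for k
      using summ[OF that xt, of "- \<alpha>" 0] by (simp add: l_def mult_ac)
    \<comment> \<open>By \<open>step\<close> these terms are, up to the factor t^m, a tail of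
      \<open>l\<close>.\<close>
    have g_sum: "summable (\<lambda>n. norm (g (k, n)))" if k: "k \<in> K" for k
    proof -
      have "summable (\<lambda>n. norm (l (k, Suc n)))" using l_sum[OF k] by (subst summable_Suc_iff)
      hence "summable (\<lambda>n. (1 / t ^ m) * norm (l (k, Suc n)))" by (rule summable_mult)
      thus ?thesis using xt by (simp add: step[OF k] norm_mult norm_power)
    qed
    have "RL_deriv \<alpha> (\<lambda>t. u x t) t = (\<integral>p. l p \<partial>M)"
      using RL(2)[OF xt] by (simp add: l_def)
    also have "\<dots> = (\<Sum>k\<in>K. \<Sum>n. l (k, n))"
      unfolding M_def by (rule integrable_count_space_times_nat(2)[OF finK l_sum])
    also have "\<dots> = (\<Sum>k\<in>K. \<Sum>n. of_real (t ^ m) * g (k, n))"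
    proof (rule sum.cong[OF refl])
      fix k assume k: "k \<in> K"
      show "(\<Sum>n. l (k, n)) = (\<Sum>n. of_real (t ^ m) * g (k, n))"
        using suminf_split_head[OF summable_norm_cancel[OF l_sum[OF k]]] by (simp add: zero[OF k] step[OF k])
    qed
    also have "\<dots> = of_real (t ^ m) * (\<Sum>k\<in>K. \<Sum>n. g (k, n))"
      unfolding sum_distrib_left by (intro sum.cong refl suminf_mult summable_norm_cancel[OF g_sum])
    also have "(\<Sum>k\<in>K. \<Sum>n. g (k, n)) = (\<integral>p. g p \<partial>M)"
      unfolding M_def by (rule integrable_count_space_times_nat(2)[OF finK g_sum, symmetric])
    also have "\<dots> = (A * x powr d) *\<^sub>R nth_vderiv 2 (\<lambda>x. u x t) x
      + (B * x powr (d - 1)) *\<^sub>R nth_vderiv 1 (\<lambda>x. u x t) x + (C * x powr (d - 2)) *\<^sub>R u x t"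
      using X(2)[OF xt(2,1)] by (simp add: g_def)
    finally show ?thesis by (simp only: scaleR_conv_of_real)
  qed
  show ?thesis
    unfolding fractional_eq_solution_def using RL(1) X(1) eq by blast
qed

section \<open>The H-function on a vertical line\<close>

text \<open>The modulus of a complex power of a positive base depends on the real part of the
  exponent alone, which is bounded in a strip.\<close>

lemma exp_type_of_real_powr:
  assumes "x > 0" "\<And>z. z \<in> S \<Longrightarrow> \<bar>Re z\<bar> \<le> R"
  shows "exp_type 0 (\<lambda>z. of_real x powr (b + of_real r * z)) S"
proof (rule exp_type_bounded)
  fix z assume z: "z \<in> S"
  define N where "N = \<bar>Re b\<bar> + \<bar>r\<bar> * R"
  have "\<bar>Re b + r * Re z\<bar> \<le> N"
    using assms(2)[OF z] mult_left_mono[of "\<bar>Re z\<bar>" R "\<bar>r\<bar>"] abs_triangle_ineq[of "Re b" "r * Re z"]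
    by (simp add: N_def abs_mult)
  hence "(Re b + r * Re z) * ln x \<le> N * \<bar>ln x\<bar>"
    by (metis abs_ge_self abs_ge_zero abs_mult mult_right_mono order_trans)
  hence "x powr (Re b + r * Re z) \<le> exp (N * \<bar>ln x\<bar>)"
    using assms(1) by (simp add: powr_def)
  thus "norm (of_real x powr (b + of_real r * z)) \<le> exp (N * \<bar>ln x\<bar>) * exp (0 * \<bar>Im z\<bar>)"
    using assms(1) by (simp add: norm_of_real_powr)
qed

text \<open>The part of a strip where the decay of every Gamma(b - s) is available. Two kinds of
  sets in it are used later: whole vertical lines far to the left, and all points of great
  height.\<close>

definition gamma_strip :: "complex list \<Rightarrow> real \<Rightarrow> complex set" where
  "gamma_strip bl R = {s. \<bar>Re s\<bar> \<le> R \<and> (\<forall>b\<in>set bl. 1/2 \<le> Re (b - s) \<or> 1 \<le> \<bar>Im (b - s)\<bar>)}"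

text \<open>The induction shrinks \<open>cs\<close> only; the domain stays that of the full list
  \<open>bl\<close>.\<close>

lemma exp_type_prod_Gamma:
  assumes "set cs \<subseteq> set bl"
  shows "exp_type (- (pi / 2) * real (length cs)) (\<lambda>s. \<Prod>b\<leftarrow>cs. Gamma (b - s)) (gamma_strip bl R)"
  using assms
proof (induction cs)
  case Nil
  show ?case using exp_type_const by simp
next
  case (Cons b cs)
  have "exp_type (- (pi / 2) * \<bar>- 1\<bar>) (\<lambda>s. Gamma (b + of_real (- 1) * s)) (gamma_strip bl R)"
  proof (rule exp_type_affine[OF exp_type_Gamma[of "\<bar>Re b\<bar> + R"]])
    fix s assume "s \<in> gamma_strip bl R"
    moreover have "b \<in> set bl" using Cons.prems by simp
    ultimately show "b + of_real (- 1) * s \<in> {z. \<bar>Re z\<bar> \<le> \<bar>Re b\<bar> + R \<and> (1/2 \<le> Re z \<or> 1 \<le> \<bar>Im z\<bar>)}"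
      by (auto simp: gamma_strip_def)
  qed
  hence "exp_type (- (pi / 2)) (\<lambda>s. Gamma (b - s)) (gamma_strip bl R)" by simp
  from exp_type_mult[OF this Cons.IH] Cons.prems show ?case by (simp add: algebra_simps add_divide_distrib)
qed

lemma exp_type_rGamma_affine:
  assumes "\<And>s. s \<in> S \<Longrightarrow> \<bar>Re s\<bar> \<le> R"
  shows "exp_type (pi / 2 * \<bar>r\<bar>) (\<lambda>s. rGamma (b + of_real r * s)) S"
proof (rule exp_type_affine[OF exp_type_rGamma[of "\<bar>Re b\<bar> + \<bar>r\<bar> * R"]])
  fix s assume "s \<in> S"
  thus "b + of_real r * s \<in> {z. \<bar>Re z\<bar> \<le> \<bar>Re b\<bar> + \<bar>r\<bar> * R}"
    using assms[of s] mult_left_mono[of "\<bar>Re s\<bar>" R "\<bar>r\<bar>"] abs_triangle_ineq[of "Re b" "r * Re s"]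
    by (simp add: abs_mult)
qed

lemma gamma_strip_bounded: "s \<in> gamma_strip bl R \<Longrightarrow> \<bar>Re s\<bar> \<le> R"
  by (simp add: gamma_strip_def)

text \<open>At \<nu> = 0 the Mellin-Barnes kernel of the H-function with upper pair (1, \<mu>),
  without the power of z. A real shift \<nu> appears after fractional integration, or for negative
  \<nu> differentiation, in t.\<close>

definition mellin_factor :: "complex list \<Rightarrow> real \<Rightarrow> complex \<Rightarrow> complex \<Rightarrow> complex" where
  "mellin_factor bl \<mu> \<nu> s = (\<Prod>b\<leftarrow>bl. Gamma (b - s)) * rGamma (1 + \<nu> - of_real \<mu> * s)"

text \<open>Every Gamma factor gains pi / 2 and the reciprocal one loses \<mu> pi / 2; for m + 2
  factors and \<mu> = \<alpha> + m the rate is - (pi / 2) (2 - \<alpha>).\<close>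

lemma exp_type_mellin_factor:
  assumes "\<mu> > 0"
  shows "exp_type (- (pi / 2) * (real (length bl) - \<mu>)) (mellin_factor bl \<mu> \<nu>) (gamma_strip bl R)"
proof -
  have "exp_type (- (pi / 2) * real (length bl) + pi / 2 * \<bar>- \<mu>\<bar>)
      (\<lambda>s. (\<Prod>b\<leftarrow>bl. Gamma (b - s)) * rGamma ((1 + \<nu>) + of_real (- \<mu>) * s)) (gamma_strip bl R)"
    by (intro exp_type_mult exp_type_prod_Gamma exp_type_rGamma_affine[where R = R] gamma_strip_bounded) auto
  thus ?thesis using assms by (simp add: mellin_factor_def[abs_def] algebra_simps diff_divide_distrib)
qed

section \<open>Poles, holomorphy and integrability along vertical lines\<close>

definition gamma_poles :: "complex list \<Rightarrow> complex set" where
  "gamma_poles bl = {s. \<exists>b\<in>set bl. b - s \<in> \<int>\<^sub>\<le>\<^sub>0}"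

lemma closed_gamma_poles: "closed (gamma_poles bl)"
proof -
  have "gamma_poles bl = (\<Union>b\<in>set bl. (\<lambda>s. b - s) -` \<int>\<^sub>\<le>\<^sub>0)"
    by (auto simp: gamma_poles_def)
  thus ?thesis
    by (simp only:) (intro closed_UN finite_set ballI closed_vimage closed_nonpos_Ints continuous_intros)
qed

lemma gamma_polesE:
  assumes "s \<in> gamma_poles bl"
  obtains b n where "b \<in> set bl" "s = b + of_nat n"
proof -
  obtain b where b: "b \<in> set bl" "b - s \<in> \<int>\<^sub>\<le>\<^sub>0" using assms by (auto simp: gamma_poles_def)
  then obtain n where "b - s = - of_nat n" by (auto elim: nonpos_Ints_cases')
  hence "s = b + of_nat n" by (simp add: algebra_simps)
  thus ?thesis using that b by blast
qed

lemma finite_gamma_poles: "finite {s \<in> gamma_poles bl. Re s \<le> R}"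
proof -
  \<comment> \<open>A pole b + n with real part at most R has n \<le> R - Re b; the sum bounds every
    - Re b at once.\<close>
  obtain N :: nat where N: "R + (\<Sum>b\<leftarrow>bl. \<bar>Re b\<bar>) \<le> real N" using real_arch_simple by blast
  have "{s \<in> gamma_poles bl. Re s \<le> R} \<subseteq> (\<lambda>(b, n). b + of_nat n) ` (set bl \<times> {..N})"
  proof safe
    fix s assume s: "s \<in> gamma_poles bl" "Re s \<le> R"
    then obtain b n where bn: "b \<in> set bl" "s = b + of_nat n" by (elim gamma_polesE)
    have "\<bar>Re b\<bar> \<le> (\<Sum>b\<leftarrow>bl. \<bar>Re b\<bar>)"
      using bn(1) by (intro member_le_sum_list) auto
    hence "real n \<le> real N" using s(2) bn(2) N by simp
    thus "s \<in> (\<lambda>(b, n). b + of_nat n) ` (set bl \<times> {..N})" using bn by force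
  qed
  thus ?thesis by (rule finite_subset) auto
qed

lemma holomorphic_prod_Gamma:
  assumes "set cs \<subseteq> set bl"
  shows "(\<lambda>s. \<Prod>b\<leftarrow>cs. Gamma (b - s)) holomorphic_on - gamma_poles bl"
  using assms
proof (induction cs)
  case (Cons b cs)
  have "(\<lambda>s. Gamma (b - s)) holomorphic_on - gamma_poles bl"
    using Cons.prems by (intro holomorphic_intros) (auto simp: gamma_poles_def)
  thus ?case using Cons by (auto intro!: holomorphic_intros)
qed auto

lemma holomorphic_mellin_factor: "mellin_factor bl \<mu> \<nu> holomorphic_on - gamma_poles bl"
  unfolding mellin_factor_def[abs_def]
  by (intro holomorphic_intros holomorphic_prod_Gamma) auto

lemma fox_integrand_eq:
  "fox_integrand (length bl) 0 [(1, \<mu>)] (map (\<lambda>b. (b, 1)) bl) z s = mellin_factor bl \<mu> 0 s * z powr s"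
  by (simp add: fox_integrand_def mellin_factor_def o_def case_prod_beta)

text \<open>A line at distance at least 1/2 to the left of all parameters stays inside
  \<open>gamma_strip\<close> and meets no pole.\<close>

lemma integrable_vertical_line:
  assumes f: "exp_type \<kappa> f (gamma_strip bl R)" "\<kappa> < 0" and hol: "f holomorphic_on - gamma_poles bl"
    and line: "\<bar>\<gamma>\<bar> \<le> R" "\<And>b. b \<in> set bl \<Longrightarrow> \<gamma> \<le> Re b - 1/2"
  shows "integrable lborel (\<lambda>y. f (Complex \<gamma> y))"
proof -
  obtain C where C: "C \<ge> 0" "\<And>z. z \<in> gamma_strip bl R \<Longrightarrow> norm (f z) \<le> C * exp (\<kappa> / 2 * \<bar>Im z\<bar>)"
    using exp_typeE[OF f(1), of "\<kappa> / 2"] f(2) by auto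
  have in_S: "Complex \<gamma> y \<in> gamma_strip bl R" for y
    using line by (force simp: gamma_strip_def)
  show ?thesis
  proof (rule Bochner_Integration.integrable_bound)
    show "integrable lborel (\<lambda>y. C * exp (- (- \<kappa> / 2) * \<bar>y\<bar>))"
      using integrable_exp_abs[of "- \<kappa> / 2"] f(2) by simp
    have "continuous_on UNIV (\<lambda>y. f (Complex \<gamma> y))"
    proof (intro continuous_on_compose2[OF holomorphic_on_imp_continuous_on[OF hol]] continuous_intros subsetI)
      fix s assume "s \<in> range (Complex \<gamma>)"
      hence "Re s = \<gamma>" by auto
      thus "s \<in> - gamma_poles bl" using line(2) by (force elim!: gamma_polesE)
    qed
    thus "(\<lambda>y. f (Complex \<gamma> y)) \<in> borel_measurable lborel"
      by (simp add: borel_measurable_continuous_onI)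
    show "AE y in lborel. norm (f (Complex \<gamma> y)) \<le> norm (C * exp (- (- \<kappa> / 2) * \<bar>y\<bar>))"
      using C(1) C(2)[OF in_S] by (intro AE_I2) simp
  qed
qed

text \<open>A vertical line to the left of all parameters shows that contours exist; then whichever
  contour the choice operator returns is moved to Re s = \<gamma>. That contour does not depend on
  the argument of \<open>fox_H\<close>, so one G serves all \<gamma> and x.\<close>

lemma fox_H_vertical_line:
  fixes bl :: "complex list" and \<mu> :: real
  assumes \<mu>: "\<mu> > 0" "\<mu> < real (length bl)"
  obtains G where "\<And>\<gamma> x. \<gamma> \<le> G \<Longrightarrow> x > 0 \<Longrightarrow>
    fox_H (length bl) 0 [(1, \<mu>)] (map (\<lambda>b. (b, 1)) bl) (of_real x)
      = 1 / (2 * of_real pi) * (\<integral>y. mellin_factor bl \<mu> 0 (Complex \<gamma> y) * of_real x powr Complex \<gamma> y \<partial>lborel)"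
proof -
  let ?bs = "map (\<lambda>b. (b, 1)) bl :: (complex \<times> real) list"
  let ?M = "length bl"
  define L where "L = (SOME L. fox_contour ?M 0 [(1, \<mu>)] ?bs L)"
  define B where "B = (\<Sum>b\<leftarrow>bl. norm b)"
  have B: "norm b \<le> B" if "b \<in> set bl" for b
    unfolding B_def using that by (intro member_le_sum_list) auto
  have "fox_contour ?M 0 [(1, \<mu>)] ?bs (\<lambda>t. Complex (- B - 1) t)"
  proof (rule fox_contour_vertical_line)
    fix b \<beta> assume "(b, \<beta>) \<in> set (take ?M ?bs)"
    hence b: "b \<in> set bl" "\<beta> = 1" by auto
    thus "\<beta> > 0 \<and> - B - 1 < Re b / \<beta>" using B[OF b(1)] abs_Re_le_cmod[of b] by auto
  qed
  hence L: "fox_contour ?M 0 [(1, \<mu>)] ?bs L" unfolding L_def by (rule someI[where P = "fox_contour ?M 0 [(1, \<mu>)] ?bs"])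
  then obtain \<gamma>0 T where T: "T > 0" "L piecewise_C1_differentiable_on {-T..T}"
      "\<And>t. \<bar>t\<bar> \<ge> T \<Longrightarrow> L t = Complex \<gamma>0 t"
    by (auto simp: fox_contour_def infinite_contour_def)
  interpret infinite_contour_data L T \<gamma>0 using T by unfold_locales auto
  have right: "gamma_poles bl \<subseteq> right_side L"
  proof
    fix s assume "s \<in> gamma_poles bl"
    then obtain b where b: "b \<in> set bl" "b - s \<in> \<int>\<^sub>\<le>\<^sub>0" by (auto simp: gamma_poles_def)
    hence "(b, 1) \<in> set (take ?M ?bs)" by auto
    with L have "\<forall>s. b - of_real 1 * s \<in> \<int>\<^sub>\<le>\<^sub>0 \<longrightarrow> s \<in> right_side L"
      unfolding fox_contour_def by blast
    thus "s \<in> right_side L" using b(2) by simp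
  qed
  obtain G where G: "G \<ge> T" "- G \<le> \<gamma>0"
    "\<And>T' \<gamma>' p. T' \<ge> G \<Longrightarrow> \<gamma>' \<le> - G \<Longrightarrow> p \<in> gamma_poles bl \<Longrightarrow> winding_number (boxed T' \<gamma>') p = 0"
    by (rule winding_number_boxed[OF right finite_gamma_poles]) (rule that)
  \<comment> \<open>All poles have Re p \<ge> - B and |Im p| \<le> B. From height G' on, every b - s
    has imaginary part of modulus at least 1.\<close>
  define G' where "G' = \<bar>G\<bar> + B + 1"
  have B0: "B \<ge> 0" unfolding B_def by (intro sum_list_nonneg) auto
  show ?thesis
  proof (rule that[of "- G' - 1"])
    fix \<gamma> x :: real assume \<gamma>: "\<gamma> \<le> - G' - 1" and x: "x > 0"
    define f where "f = (\<lambda>s. mellin_factor bl \<mu> 0 s * of_real x powr s)"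
    define R where "R = \<bar>\<gamma>\<bar> + \<bar>\<gamma>0\<bar>"
    define \<kappa> where "\<kappa> = - (pi / 2) * (real ?M - \<mu>)"
    have \<kappa>: "\<kappa> < 0" using \<mu> by (simp add: \<kappa>_def mult_pos_pos)
    have hol: "f holomorphic_on - gamma_poles bl"
      unfolding f_def using x by (intro holomorphic_intros holomorphic_mellin_factor) auto
    have ft: "exp_type \<kappa> f (gamma_strip bl R)"
    proof -
      have "exp_type (\<kappa> + 0) (\<lambda>s. mellin_factor bl \<mu> 0 s * of_real x powr (0 + of_real 1 * s)) (gamma_strip bl R)"
        unfolding \<kappa>_def by (intro exp_type_mult exp_type_mellin_factor exp_type_of_real_powr[where R = R] \<mu> x gamma_strip_bounded)
      thus ?thesis by (simp add: f_def)
    qed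
    obtain C where C: "\<And>z. z \<in> gamma_strip bl R \<Longrightarrow> norm (f z) \<le> C * exp (\<kappa> / 2 * \<bar>Im z\<bar>)"
      using exp_typeE[OF ft, of "\<kappa> / 2"] \<kappa> by auto
    have "integral UNIV (\<lambda>t. f (L t) * vector_derivative L (at t)) = \<i> * (\<integral>y. f (Complex \<gamma> y) \<partial>lborel)"
    proof (rule integral_contour_shift[OF right closed_gamma_poles hol, where G = G' and C = C and \<delta> = "- \<kappa> / 2"])
      show "winding_number (boxed T' \<gamma>) p = 0" if "T' \<ge> G'" "p \<in> gamma_poles bl" for T' p
        using G(3)[of T' \<gamma> p] that \<gamma> B0 by (simp add: G'_def)
      show "\<gamma> < Re p \<and> \<bar>Im p\<bar> < G'" if p: "p \<in> gamma_poles bl" for p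
      proof -
        obtain b n where "b \<in> set bl" "p = b + of_nat n" by (rule gamma_polesE[OF p])
        thus ?thesis using B[of b] abs_Re_le_cmod[of b] abs_Im_le_cmod[of b] \<gamma> B0 by (auto simp: G'_def)
      qed
      show "G' \<ge> T" "\<gamma> < \<gamma>0" using G(1,2) \<gamma> B0 by (auto simp: G'_def)
      show "- \<kappa> / 2 > 0" using \<kappa> by simp
      show "norm (f s) \<le> C * exp (- (- \<kappa> / 2) * \<bar>Im s\<bar>)" if "\<gamma> \<le> Re s" "Re s \<le> \<gamma>0" "\<bar>Im s\<bar> \<ge> G'" for s
      proof -
        have "1 \<le> \<bar>Im (b - s)\<bar>" if "b \<in> set bl" for b
          using B[OF that] abs_Im_le_cmod[of b] \<open>\<bar>Im s\<bar> \<ge> G'\<close> by (auto simp: G'_def)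
        hence "s \<in> gamma_strip bl R" using that by (auto simp: gamma_strip_def R_def)
        thus ?thesis using C by simp
      qed
      show "integrable lborel (\<lambda>y. f (Complex \<gamma> y))"
      proof (rule integrable_vertical_line[OF ft \<kappa> hol])
        show "\<gamma> \<le> Re b - 1/2" if "b \<in> set bl" for b
          using B[OF that] abs_Re_le_cmod[of b] \<gamma> B0 by (auto simp: G'_def)
      qed (simp add: R_def)
    qed
    thus "fox_H ?M 0 [(1, \<mu>)] ?bs (of_real x)
      = 1 / (2 * of_real pi) * (\<integral>y. mellin_factor bl \<mu> 0 (Complex \<gamma> y) * of_real x powr Complex \<gamma> y \<partial>lborel)"
      unfolding fox_H_def Let_def L_def[symmetric] fox_integrand_eq f_def by (simp add: field_simps)
  qed
qed

section \<open>The Mellin--Barnes solution\<close>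

lemma exp_type_power:
  assumes "exp_type 0 f S"
  shows "exp_type 0 (\<lambda>s. f s ^ j) S"
proof (induction j)
  case 0
  show ?case using exp_type_const by simp
next
  case (Suc j)
  show ?case using exp_type_mult[OF assms Suc] by simp
qed

text \<open>u has the same integral representation on every line \<gamma> \<le> g. So the time
  derivative is computed on the line g - 1 and the space operator on the line g, and the two
  integrands agree pointwise in y.\<close>

lemma fox_H_solution:
  fixes \<alpha> d A B C a :: real and m :: nat and b1 b2 c :: complex
  defines "\<mu> \<equiv> \<alpha> + real m"
  defines "\<Lambda> \<equiv> A * (d - 2)\<^sup>2 * \<mu> ^ m"
  defines "bl \<equiv> [b1, b2] @ map (\<lambda>j. of_real (real j / \<mu>)) [1..<m+1]"
  assumes \<alpha>: "0 < \<alpha>" "\<alpha> < 2" and A: "A > 0" and d: "d \<noteq> 2"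
    and ind: "\<And>s. of_real A * (of_real a + of_real (2 - d) * s) * (of_real a + of_real (2 - d) * s - 1)
        + of_real B * (of_real a + of_real (2 - d) * s) + of_real C
      = of_real (A * (d - 2)\<^sup>2) * ((b1 - s) * (b2 - s))"
    and u: "\<And>x t. x > 0 \<Longrightarrow> t > 0 \<Longrightarrow> u x t = c * of_real (x powr a) *
      fox_H (length bl) 0 [(1, \<mu>)] (map (\<lambda>b. (b, 1)) bl) (of_real (x powr (2 - d) / (\<Lambda> * t powr \<mu>)))"
  shows "fractional_eq_solution \<alpha> m d A B C u"
proof -
  have \<mu>: "\<mu> > 0" using \<alpha> by (simp add: \<mu>_def)
  have len: "length bl = m + 2" by (simp add: bl_def)
  have \<mu>_len: "\<mu> < real (length bl)" using \<alpha> by (simp add: len \<mu>_def)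
  have \<Lambda>: "\<Lambda> > 0" using A d \<mu> by (simp add: \<Lambda>_def)
  obtain G where G: "\<And>\<gamma> x. \<gamma> \<le> G \<Longrightarrow> x > 0 \<Longrightarrow>
    fox_H (length bl) 0 [(1, \<mu>)] (map (\<lambda>b. (b, 1)) bl) (of_real x)
      = 1 / (2 * of_real pi) * (\<integral>y. mellin_factor bl \<mu> 0 (Complex \<gamma> y) * of_real x powr Complex \<gamma> y \<partial>lborel)"
    using fox_H_vertical_line[OF \<mu> \<mu>_len] by blast
  define N where "N = (\<Sum>b\<leftarrow>bl. norm b)"
  have N: "norm b \<le> N" if "b \<in> set bl" for b
    unfolding N_def using that by (intro member_le_sum_list) auto
  have N0: "N \<ge> 0" unfolding N_def by (intro sum_list_nonneg) auto
  \<comment> \<open>Within the range of the vertical-line formula, to the left of all poles, and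
    negative, so that Re \<sigma> = - \<mu> \<gamma> is positive for every \<gamma> \<le> g.\<close>
  define g where "g = min G (- N - 1)"
  define K where "K = c / (2 * of_real pi)"
  define S where "S = (\<lambda>\<gamma> y. Complex \<gamma> y)"
  define w where "w = (\<lambda>s. K * (\<Prod>b\<leftarrow>bl. Gamma (b - s)) * of_real \<Lambda> powr (- s))"
  define \<sigma> where "\<sigma> = (\<lambda>s. - of_real \<mu> * s :: complex)"
  define \<rho> where "\<rho> = (\<lambda>s. of_real a + of_real (2 - d) * s :: complex)"
  have b_far: "\<gamma> \<le> Re b - 1/2" if "\<gamma> \<le> g" "b \<in> set bl" for \<gamma> b
    using that N[of b] abs_Re_le_cmod[of b] by (auto simp: g_def)
  have int: "integrable lborel (\<lambda>y. w (S \<gamma> y) * rGamma (1 + \<sigma> (S \<gamma> y) + of_real \<nu>)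
      * of_real t powr (\<sigma> (S \<gamma> y) + of_real \<nu>) * of_real x powr \<rho> (S \<gamma> y) * \<rho> (S \<gamma> y) ^ j)"
    if \<gamma>: "\<gamma> \<le> g" and xt: "x > 0" "t > 0" for \<gamma> x t \<nu> j
  proof -
    define f where "f = (\<lambda>s. mellin_factor bl \<mu> (of_real \<nu>) s * (K * (of_real \<Lambda> powr (0 + of_real (- 1) * s) *
      (of_real t powr (of_real \<nu> + of_real (- \<mu>) * s) *
       (of_real x powr (of_real a + of_real (2 - d) * s) * (of_real a + of_real (2 - d) * s) ^ j)))))"
    have "exp_type (- (pi / 2) * (real (length bl) - \<mu>) + (0 + (0 + (0 + (0 + 0))))) f (gamma_strip bl \<bar>\<gamma>\<bar>)"
      unfolding f_def
      by (intro exp_type_mult exp_type_mellin_factor exp_type_of_real_powr[where R = "\<bar>\<gamma>\<bar>"] exp_type_const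
            exp_type_power exp_type_linear[where R = "\<bar>\<gamma>\<bar>"] gamma_strip_bounded \<mu> \<Lambda> xt)
    moreover have "f holomorphic_on - gamma_poles bl"
      unfolding f_def using \<Lambda> xt by (intro holomorphic_intros holomorphic_mellin_factor) auto
    moreover have "- (pi / 2) * (real (length bl) - \<mu>) + (0 + (0 + (0 + (0 + 0)))) < 0"
      using \<mu>_len by (simp add: mult_pos_pos)
    ultimately have "integrable lborel (\<lambda>y. f (S \<gamma> y))"
      unfolding S_def using b_far[OF \<gamma>] by (intro integrable_vertical_line) auto
    moreover have "f s = w s * rGamma (1 + \<sigma> s + of_real \<nu>) * of_real t powr (\<sigma> s + of_real \<nu>) * of_real x powr \<rho> s * \<rho> s ^ j" for s
    proof -
      have "1 + of_real \<nu> - of_real \<mu> * s = 1 + \<sigma> s + of_real \<nu>" "of_real \<nu> + of_real (- \<mu>) * s = \<sigma> s + of_real \<nu>"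
        "0 + of_real (- 1) * s = - s" by (simp_all add: \<sigma>_def)
      thus ?thesis unfolding f_def mellin_factor_def w_def \<rho>_def by (simp only: mult_ac)
    qed
    ultimately show ?thesis by simp
  qed
  have u_int: "u x t = (\<integral>y. w (S \<gamma> y) * rGamma (1 + \<sigma> (S \<gamma> y)) * of_real t powr \<sigma> (S \<gamma> y) * of_real x powr \<rho> (S \<gamma> y) \<partial>lborel)"
    if \<gamma>: "\<gamma> \<le> g" and xt: "x > 0" "t > 0" for \<gamma> x t
  proof -
    define z where "z = x powr (2 - d) / (\<Lambda> * t powr \<mu>)"
    have z: "z > 0" using xt \<Lambda> by (simp add: z_def)
    have ln_z: "ln z = (2 - d) * ln x - ln \<Lambda> - \<mu> * ln t"
      using xt \<Lambda> by (simp add: z_def ln_div ln_mult ln_powr)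
    \<comment> \<open>Unpacks the argument z into powers: t gets the exponent \<sigma> = - \<mu> s
      and x the exponent \<rho> = a + (2 - d) s.\<close>
    have zs: "of_real (x powr a) * of_real z powr s = of_real \<Lambda> powr (- s) * of_real t powr \<sigma> s * of_real x powr \<rho> s" for s
    proof -
      have "of_real (x powr a) = exp (of_real a * of_real (ln x) :: complex)"
        using xt by (simp add: powr_def flip: exp_of_real)
      thus ?thesis using xt \<Lambda> z
        by (simp add: of_real_powr_eq_exp ln_z \<sigma>_def \<rho>_def exp_add[symmetric] algebra_simps)
    qed
    have "u x t = c * of_real (x powr a) * (1 / (2 * of_real pi) * (\<integral>y. mellin_factor bl \<mu> 0 (S \<gamma> y) * of_real z powr S \<gamma> y \<partial>lborel))"
      using G[OF _ z, of \<gamma>] \<gamma> by (simp add: u[OF xt] g_def S_def flip: z_def)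
    also have "\<dots> = (K * of_real (x powr a)) * (\<integral>y. mellin_factor bl \<mu> 0 (S \<gamma> y) * of_real z powr S \<gamma> y \<partial>lborel)"
      by (simp add: K_def)
    also have "\<dots> = (\<integral>y. (K * of_real (x powr a)) * (mellin_factor bl \<mu> 0 (S \<gamma> y) * of_real z powr S \<gamma> y) \<partial>lborel)"
      by (rule integral_mult_right_zero[symmetric])
    also have "\<dots> = (\<integral>y. w (S \<gamma> y) * rGamma (1 + \<sigma> (S \<gamma> y)) * of_real t powr \<sigma> (S \<gamma> y) * of_real x powr \<rho> (S \<gamma> y) \<partial>lborel)"
    proof (rule Bochner_Integration.integral_cong[OF refl])
      fix y
      let ?s = "S \<gamma> y"
      have "1 + 0 - of_real \<mu> * ?s = 1 + \<sigma> ?s" by (simp add: \<sigma>_def)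
      hence "(K * of_real (x powr a)) * (mellin_factor bl \<mu> 0 ?s * of_real z powr ?s)
          = K * ((\<Prod>b\<leftarrow>bl. Gamma (b - ?s)) * rGamma (1 + \<sigma> ?s)) * (of_real (x powr a) * of_real z powr ?s)"
        unfolding mellin_factor_def by (simp only: mult_ac)
      thus "(K * of_real (x powr a)) * (mellin_factor bl \<mu> 0 ?s * of_real z powr ?s)
          = w ?s * rGamma (1 + \<sigma> ?s) * of_real t powr \<sigma> ?s * of_real x powr \<rho> ?s"
        unfolding zs w_def by (simp only: mult_ac)
    qed
    finally show ?thesis .
  qed
  have S_meas: "(\<lambda>y. \<sigma> (S \<gamma> y)) \<in> borel_measurable lborel" for \<gamma>
  proof -
    have "continuous_on UNIV (\<lambda>y. \<sigma> (S \<gamma> y))"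
      unfolding \<sigma>_def S_def by (intro continuous_intros)
    thus ?thesis by (simp add: borel_measurable_continuous_onI)
  qed
  have RL: "RL_differentiable \<alpha> (\<lambda>t. u x t)"
    "t > 0 \<Longrightarrow> RL_deriv \<alpha> (\<lambda>t. u x t) t
      = (\<integral>y. (w (S \<gamma> y) * of_real x powr \<rho> (S \<gamma> y)) * rGamma (1 + \<sigma> (S \<gamma> y) - of_real \<alpha>)
          * of_real t powr (\<sigma> (S \<gamma> y) - of_real \<alpha>) \<partial>lborel)"
    if \<gamma>: "\<gamma> \<le> g" and x: "x > 0" for x t \<gamma>
  proof -
    have i: "integrable lborel (\<lambda>y. (w (S \<gamma> y) * of_real x powr \<rho> (S \<gamma> y)) * rGamma (1 + \<sigma> (S \<gamma> y) + of_real \<nu>)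
        * of_real t powr (\<sigma> (S \<gamma> y) + of_real \<nu>))"
      if "t > 0" for \<nu> t using int[OF \<gamma> x that, of \<nu> 0] by (simp add: mult_ac)
    have e: "u x t = (\<integral>y. (w (S \<gamma> y) * of_real x powr \<rho> (S \<gamma> y)) * rGamma (1 + \<sigma> (S \<gamma> y)) * of_real t powr \<sigma> (S \<gamma> y) \<partial>lborel)"
      if "t > 0" for t using u_int[OF \<gamma> x that] by (simp add: mult_ac)
    have meas: "(\<lambda>y. (w (S \<gamma> y) * of_real x powr \<rho> (S \<gamma> y)) * rGamma (1 + \<sigma> (S \<gamma> y))) \<in> borel_measurable lborel"
      using borel_measurable_integrable[OF i[of 1 0]] by simp
    have lower: "\<exists>\<sigma>0>-1. \<forall>y\<in>space lborel. Re (\<sigma> (S \<gamma> y)) \<ge> \<sigma>0"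
      using \<gamma> N0 \<mu> by (intro exI[of _ 0]) (auto simp: \<sigma>_def S_def g_def mult_nonneg_nonpos)
    note * = RL_deriv_superposition[OF sigma_finite_lborel S_meas meas i lower e \<alpha>(1)]
    show "RL_differentiable \<alpha> (\<lambda>t. u x t)" by (rule *(1))
    show "t > 0 \<Longrightarrow> RL_deriv \<alpha> (\<lambda>t. u x t) t
      = (\<integral>y. (w (S \<gamma> y) * of_real x powr \<rho> (S \<gamma> y)) * rGamma (1 + \<sigma> (S \<gamma> y) - of_real \<alpha>)
          * of_real t powr (\<sigma> (S \<gamma> y) - of_real \<alpha>) \<partial>lborel)"
      by (rule *(2))
  qed
  have X: "times_differentiable_on 2 (\<lambda>x. u x t) {0<..}"
    "x > 0 \<Longrightarrow> (A * x powr d) *\<^sub>R nth_vderiv 2 (\<lambda>x. u x t) x + (B * x powr (d - 1)) *\<^sub>R nth_vderiv 1 (\<lambda>x. u x t) x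
           + (C * x powr (d - 2)) *\<^sub>R u x t
         = (\<integral>y. w (S g y) * rGamma (1 + \<sigma> (S g y)) * of_real t powr \<sigma> (S g y)
              * (of_real A * \<rho> (S g y) * (\<rho> (S g y) - 1) + of_real B * \<rho> (S g y) + of_real C)
              * of_real x powr (\<rho> (S g y) + of_real (d - 2)) \<partial>lborel)"
    if t: "t > 0" for x t
  proof -
    have i: "integrable lborel (\<lambda>y. w (S g y) * rGamma (1 + \<sigma> (S g y)) * of_real t powr \<sigma> (S g y) * of_real x powr \<rho> (S g y) * \<rho> (S g y) ^ j)"
      if "x > 0" "j \<le> 2" for x j using int[OF order_refl that(1) t, of 0 j] by simp
    have e: "u x t = (\<integral>y. w (S g y) * rGamma (1 + \<sigma> (S g y)) * of_real t powr \<sigma> (S g y) * of_real x powr \<rho> (S g y) \<partial>lborel)" if "x > 0" for x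
      by (rule u_int[OF order_refl that t])
    note * = euler_operator_superposition[OF i e]
    show "times_differentiable_on 2 (\<lambda>x. u x t) {0<..}" by (rule *(1))
    show "x > 0 \<Longrightarrow> (A * x powr d) *\<^sub>R nth_vderiv 2 (\<lambda>x. u x t) x + (B * x powr (d - 1)) *\<^sub>R nth_vderiv 1 (\<lambda>x. u x t) x
           + (C * x powr (d - 2)) *\<^sub>R u x t
         = (\<integral>y. w (S g y) * rGamma (1 + \<sigma> (S g y)) * of_real t powr \<sigma> (S g y)
              * (of_real A * \<rho> (S g y) * (\<rho> (S g y) - 1) + of_real B * \<rho> (S g y) + of_real C)
              * of_real x powr (\<rho> (S g y) + of_real (d - 2)) \<partial>lborel)"
      by (rule *(2))
  qed
  have eq: "RL_deriv \<alpha> (\<lambda>t. u x t) t = t ^ m *\<^sub>R ((A * x powr d) *\<^sub>R nth_vderiv 2 (\<lambda>x. u x t) x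
      + (B * x powr (d - 1)) *\<^sub>R nth_vderiv 1 (\<lambda>x. u x t) x + (C * x powr (d - 2)) *\<^sub>R u x t)"
    if xt: "x > 0" "t > 0" for x t
  proof -
    have shift: "S (g - 1) y = S g y - 1" for y by (simp add: S_def complex_eq_iff)
    have "(w (s - 1) * of_real x powr \<rho> (s - 1)) * rGamma (1 + \<sigma> (s - 1) - of_real \<alpha>) * of_real t powr (\<sigma> (s - 1) - of_real \<alpha>)
        = of_real (t ^ m) * (w s * rGamma (1 + \<sigma> s) * of_real t powr \<sigma> s
              * (of_real A * \<rho> s * (\<rho> s - 1) + of_real B * \<rho> s + of_real C) * of_real x powr (\<rho> s + of_real (d - 2)))"
      if s: "s \<notin> gamma_poles bl" for s
    proof -
      have rho: "\<rho> (s - 1) = \<rho> s + of_real (d - 2)" by (simp add: \<rho>_def algebra_simps)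
      have sig: "\<sigma> (s - 1) - of_real \<alpha> = of_nat m + \<sigma> s" by (simp add: \<sigma>_def \<mu>_def algebra_simps)
      have sig': "1 + \<sigma> (s - 1) - of_real \<alpha> = 1 + \<sigma> s + of_nat m" by (simp add: \<sigma>_def \<mu>_def algebra_simps)
      have t: "of_real t powr (of_nat m + \<sigma> s) = of_real (t ^ m) * of_real t powr \<sigma> s"
        using xt by (simp add: powr_add)
      have \<Lambda>s: "of_real \<Lambda> powr (- (s - 1)) = of_real \<Lambda> * of_real \<Lambda> powr (- s)"
        using \<Lambda> powr_add[of "of_real \<Lambda> :: complex" 1 "- s"] by simp
      have Gam: "(\<Prod>b\<leftarrow>bl. Gamma (b - (s - 1))) = (\<Prod>b\<leftarrow>bl. b - s) * (\<Prod>b\<leftarrow>bl. Gamma (b - s))"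
      proof -
        have "(\<Prod>a\<leftarrow>map (\<lambda>b. b - s) bl. Gamma (a + of_nat (Suc 0)))
          = (\<Prod>a\<leftarrow>map (\<lambda>b. b - s) bl. a + of_nat 0) * (\<Prod>a\<leftarrow>map (\<lambda>b. b - s) bl. Gamma (a + of_nat 0))"
          by (rule prod_list_Gamma_Suc) (use s in \<open>auto simp: gamma_poles_def\<close>)
        moreover have "b - (s - 1) = (b - s) + of_nat (Suc 0)" for b by simp
        ultimately show ?thesis by (simp only: map_map o_def of_nat_0 add_0_right)
      qed
      \<comment> \<open>Multiplied by \<mu>, the factor j / \<mu> - s becomes j + \<sigma>. The
        power \<mu>^m in \<Lambda> thus yields a Pochhammer symbol, which lowers the argument of
        \<open>rGamma\<close> from 1 + \<sigma> + m to 1 + \<sigma>.\<close>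
      have prod: "of_real \<Lambda> * (\<Prod>b\<leftarrow>bl. b - s) = pochhammer (1 + \<sigma> s) m * (of_real (A * (d - 2)\<^sup>2) * ((b1 - s) * (b2 - s)))"
      proof -
        have "(\<Prod>j\<leftarrow>[1..<k+1]. of_real (real j / \<mu>) - s) * of_real (\<mu> ^ k) = pochhammer (1 + \<sigma> s) k" for k
        proof (induction k)
          case (Suc k)
          have "(of_real (real (Suc k) / \<mu>) - s) * of_real \<mu> = 1 + \<sigma> s + of_nat k"
            using \<mu> by (simp add: \<sigma>_def field_simps)
          moreover have "(\<Prod>j\<leftarrow>[1..<Suc k + 1]. of_real (real j / \<mu>) - s) * of_real (\<mu> ^ Suc k)
             = ((\<Prod>j\<leftarrow>[1..<k+1]. of_real (real j / \<mu>) - s) * of_real (\<mu> ^ k)) * ((of_real (real (Suc k) / \<mu>) - s) * of_real \<mu>)"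
            by simp
          ultimately show ?case unfolding Suc.IH pochhammer_Suc by (simp only:)
        qed simp
        from this[of m] show ?thesis
          by (simp add: bl_def \<Lambda>_def o_def mult_ac)
      qed
      have poch: "pochhammer (1 + \<sigma> s) m * rGamma (1 + \<sigma> s + of_nat m) = rGamma (1 + \<sigma> s)"
        by (rule pochhammer_rGamma[symmetric])
      have "(w (s - 1) * of_real x powr \<rho> (s - 1)) * rGamma (1 + \<sigma> (s - 1) - of_real \<alpha>) * of_real t powr (\<sigma> (s - 1) - of_real \<alpha>)
        = (of_real \<Lambda> * (\<Prod>b\<leftarrow>bl. b - s)) * (K * (\<Prod>b\<leftarrow>bl. Gamma (b - s)) * of_real \<Lambda> powr (- s))
            * of_real x powr (\<rho> s + of_real (d - 2)) * rGamma (1 + \<sigma> s + of_nat m) * (of_real (t ^ m) * of_real t powr \<sigma> s)"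
        unfolding w_def sig' unfolding sig t rho \<Lambda>s Gam by (simp only: mult_ac)
      also have "\<dots> = (pochhammer (1 + \<sigma> s) m * rGamma (1 + \<sigma> s + of_nat m)) * (of_real (A * (d - 2)\<^sup>2) * ((b1 - s) * (b2 - s)))
            * w s * of_real x powr (\<rho> s + of_real (d - 2)) * (of_real (t ^ m) * of_real t powr \<sigma> s)"
        unfolding prod w_def by (simp only: mult_ac)
      also have "\<dots> = of_real (t ^ m) * (w s * rGamma (1 + \<sigma> s) * of_real t powr \<sigma> s
              * (of_real A * \<rho> s * (\<rho> s - 1) + of_real B * \<rho> s + of_real C) * of_real x powr (\<rho> s + of_real (d - 2)))"
        unfolding poch ind[of s, folded \<rho>_def, symmetric] unfolding \<rho>_def ind by (simp only: mult_ac)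
      finally show ?thesis .
    qed
    moreover have "S g y \<notin> gamma_poles bl" for y
    proof
      assume "S g y \<in> gamma_poles bl"
      then obtain b n where b: "b \<in> set bl" "S g y = b + of_nat n" by (rule gamma_polesE)
      from arg_cong[OF b(2), of Re] have "g = Re b + real n" by (simp add: S_def)
      thus False using b_far[OF order_refl b(1)] by simp
    qed
    ultimately have termwise: "(w (S (g - 1) y) * of_real x powr \<rho> (S (g - 1) y)) * rGamma (1 + \<sigma> (S (g - 1) y) - of_real \<alpha>)
          * of_real t powr (\<sigma> (S (g - 1) y) - of_real \<alpha>)
        = of_real (t ^ m) * (w (S g y) * rGamma (1 + \<sigma> (S g y)) * of_real t powr \<sigma> (S g y)
              * (of_real A * \<rho> (S g y) * (\<rho> (S g y) - 1) + of_real B * \<rho> (S g y) + of_real C)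
              * of_real x powr (\<rho> (S g y) + of_real (d - 2)))" for y
      unfolding shift by blast
    have "RL_deriv \<alpha> (\<lambda>t. u x t) t
      = of_real (t ^ m) * (\<integral>y. w (S g y) * rGamma (1 + \<sigma> (S g y)) * of_real t powr \<sigma> (S g y)
              * (of_real A * \<rho> (S g y) * (\<rho> (S g y) - 1) + of_real B * \<rho> (S g y) + of_real C)
              * of_real x powr (\<rho> (S g y) + of_real (d - 2)) \<partial>lborel)"
      using RL(2)[of "g - 1" x t] xt unfolding termwise by simp
    thus ?thesis unfolding X(2)[OF xt(2,1), symmetric] by (simp only: scaleR_conv_of_real)
  qed
  show ?thesis
    unfolding fractional_eq_solution_def using RL(1)[OF order_refl] X(1) eq by blast
qed

section \<open>Indicial polynomial and the three parts of the theorem\<close>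

text \<open>Completing the square: the polynomial is A ((\<rho> + (B/A - 1)/2)^2 - q^2/4) with q the
  square root. Only q^2 enters, so a negative discriminant is served by the complex root. The
  variable \<tau> is \<sigma> / \<mu> for the series and - s for the integral.\<close>

lemma indicial_factorization:
  fixes s1 s2 \<tau> :: complex and A B C a d \<mu> :: real
  assumes "A \<noteq> 0" "d \<noteq> 2" "\<mu> \<noteq> 0"
    and s1: "s1 = of_real (\<mu> / (2 * (2 - d))) *
      (of_real (B / A + 2 * a - 1) + csqrt (of_real ((1 - B / A)\<^sup>2 - 4 * C / A)))"
    and s2: "s2 = of_real (\<mu> / (2 * (2 - d))) *
      (of_real (B / A + 2 * a - 1) - csqrt (of_real ((1 - B / A)\<^sup>2 - 4 * C / A)))"
  defines "\<rho> \<equiv> of_real a + of_real (d - 2) * \<tau>"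
  shows "of_real A * \<rho> * (\<rho> - 1) + of_real B * \<rho> + of_real C
    = of_real (A * (d - 2)\<^sup>2) * ((\<tau> - s1 / of_real \<mu>) * (\<tau> - s2 / of_real \<mu>))"
proof -
  define q where "q = csqrt (of_real ((1 - B / A)\<^sup>2 - 4 * C / A))"
  define p where "p = complex_of_real (B / A + 2 * a - 1)"
  have q2: "q\<^sup>2 = of_real ((1 - B / A)\<^sup>2 - 4 * C / A)" by (simp add: q_def)
  define \<kappa> where "\<kappa> = \<mu> / (2 * (2 - d))"
  \<comment> \<open>s1 and s2 are built with 2 - d, the exponent \<rho> with d - 2; hence the
    sign.\<close>
  have half: "of_real (d - 2) * of_real \<kappa> = (of_real (- \<mu> / 2) :: complex)"
  proof -
    have "(d - 2) * \<kappa> = - \<mu> / 2" using assms(2,3) by (simp add: \<kappa>_def field_simps)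
    thus ?thesis by (simp only: of_real_mult[symmetric])
  qed
  have e1: "of_real (d - 2) * (\<tau> - s1 / of_real \<mu>) = of_real (d - 2) * \<tau> + (p + q) / 2"
  proof -
    have "of_real (d - 2) * (s1 / of_real \<mu>) = (of_real (d - 2) * of_real \<kappa>) * (p + q) / of_real \<mu>"
      unfolding s1 p_def q_def \<kappa>_def by (simp only: times_divide_eq_right mult.assoc)
    also have "\<dots> = - (p + q) / 2"
      unfolding half using assms(3) by (simp add: field_simps)
    finally show ?thesis by (simp only: right_diff_distrib) (simp add: field_simps)
  qed
  have e2: "of_real (d - 2) * (\<tau> - s2 / of_real \<mu>) = of_real (d - 2) * \<tau> + (p - q) / 2"
  proof -
    have "of_real (d - 2) * (s2 / of_real \<mu>) = (of_real (d - 2) * of_real \<kappa>) * (p - q) / of_real \<mu>"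
      unfolding s2 p_def q_def \<kappa>_def by (simp only: times_divide_eq_right mult.assoc)
    also have "\<dots> = - (p - q) / 2"
      unfolding half using assms(3) by (simp add: field_simps)
    finally show ?thesis by (simp only: right_diff_distrib) (simp add: field_simps)
  qed
  have "of_real (A * (d - 2)\<^sup>2) * ((\<tau> - s1 / of_real \<mu>) * (\<tau> - s2 / of_real \<mu>))
    = of_real A * ((of_real (d - 2) * (\<tau> - s1 / of_real \<mu>)) * (of_real (d - 2) * (\<tau> - s2 / of_real \<mu>)))"
    by (simp add: power2_eq_square mult_ac)
  also have "\<dots> = of_real A * ((of_real (d - 2) * \<tau> + p / 2)\<^sup>2 - q\<^sup>2 / 4)"
    unfolding e1 e2 by (simp add: power2_eq_square field_simps)
  also have "of_real (d - 2) * \<tau> + p / 2 = \<rho> + (of_real (B / A) - 1) / 2"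
    by (simp add: \<rho>_def p_def field_simps)
  also have "of_real A * ((\<rho> + (of_real (B / A) - 1) / 2)\<^sup>2 - q\<^sup>2 / 4)
      = of_real A * \<rho> * (\<rho> - 1) + of_real B * \<rho> + of_real C"
    unfolding q2 using assms(1) by (simp add: field_simps power2_eq_square)
  finally show ?thesis ..
qed

text \<open>Multiplied by \<mu>, the factor (p + i) / \<mu> + n becomes i + p + \<mu> n, and for i =
  1, ..., k these form a rising factorial. This is the origin of the power (\<alpha> + m)^m in the
  arguments of the Wright functions.\<close>

lemma prod_list_arith_pochhammer:
  fixes p \<mu> :: real
  assumes "\<mu> \<noteq> 0"
  shows "(\<Prod>i\<leftarrow>[1..<k+1]. of_real ((p + real i) / \<mu>) + of_nat n) * of_real (\<mu> ^ k)
    = (of_real (pochhammer (1 + (p + \<mu> * real n)) k) :: complex)"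
proof (induction k)
  case (Suc k)
  have "((p + real (Suc k)) / \<mu> + real n) * \<mu> = 1 + (p + \<mu> * real n) + real k"
    using assms by (simp add: field_simps)
  from arg_cong[OF this, of complex_of_real]
  have "(of_real ((p + real (Suc k)) / \<mu>) + of_nat n) * of_real \<mu> = complex_of_real (1 + (p + \<mu> * real n) + real k)"
    by (simp only: of_real_mult of_real_add of_real_of_nat_eq)
  moreover have "(\<Prod>i\<leftarrow>[1..<Suc k + 1]. of_real ((p + real i) / \<mu>) + of_nat n) * of_real (\<mu> ^ Suc k)
     = ((\<Prod>i\<leftarrow>[1..<k+1]. of_real ((p + real i) / \<mu>) + of_nat n) * of_real (\<mu> ^ k))
       * ((of_real ((p + real (Suc k)) / \<mu>) + of_nat n) * complex_of_real \<mu>)"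
    by simp
  ultimately show ?case unfolding Suc.IH pochhammer_Suc of_real_mult by (simp only:)
qed simp

theorem theorem1:
  fixes \<alpha> d A B C a K :: real and m :: nat and s1 s2 :: complex and c :: "nat \<Rightarrow> complex"
  assumes "\<alpha> > 0" and "A > 0"
    and K: "K = A * a\<^sup>2 - A * a + B * a + C"
    and s1: "d \<noteq> 2 \<Longrightarrow> s1 = of_real ((\<alpha> + real m) / (2 * (2 - d))) *
      (of_real (B / A + 2 * a - 1) + csqrt (of_real ((1 - B / A)\<^sup>2 - 4 * C / A)))"
    and s2: "d \<noteq> 2 \<Longrightarrow> s2 = of_real ((\<alpha> + real m) / (2 * (2 - d))) *
      (of_real (B / A + 2 * a - 1) - csqrt (of_real ((1 - B / A)\<^sup>2 - 4 * C / A)))"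
  shows
    "(\<alpha> < 2 \<and> d \<noteq> 2 \<longrightarrow>
        fractional_eq_solution \<alpha> m d A B C
          (\<lambda>x t. c 1 * of_real (x powr a) *
             fox_H (m + 2) 0
               [(1, \<alpha> + real m)]
               ([(- s1 / of_real (\<alpha> + real m), 1), (- s2 / of_real (\<alpha> + real m), 1)] @
                map (\<lambda>j. (of_real (real j / (\<alpha> + real m)), 1)) [1..<m+1])
               (of_real (x powr (2 - d) /
                 (A * (d - 2)\<^sup>2 * (\<alpha> + real m) ^ m * t powr (\<alpha> + real m)))))) \<and>
     (\<alpha> > 2 \<and> d \<noteq> 2 \<longrightarrow>
        (let as = (\<lambda>k::nat.
               [((of_real (\<alpha> - real k) - s1) / of_real (\<alpha> + real m), 1),
                ((of_real (\<alpha> - real k) - s2) / of_real (\<alpha> + real m), 1)] @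
               map (\<lambda>i. (of_real ((\<alpha> - real k + real i) / (\<alpha> + real m)), 1)) [1..<m+1] @
               [(1, 1)])
         in fractional_eq_solution \<alpha> m d A B C
          (\<lambda>x t. of_real (x powr a) *
             (\<Sum>k \<in> {k \<in> {1..nat \<lfloor>\<alpha>\<rfloor> + 1}. wright_defined (as k)}.
                c k * of_real (x powr ((d - 2) * (\<alpha> - real k) / (\<alpha> + real m)) *
                               t powr (\<alpha> - real k)) *
                wright (as k) [(of_real (1 + \<alpha> - real k), \<alpha> + real m)]
                  (of_real (A * (d - 2)\<^sup>2 * (\<alpha> + real m) ^ m *
                            x powr (d - 2) * t powr (\<alpha> + real m))))))) \<and>
     (d = 2 \<longrightarrow>
        (let as = (\<lambda>k::nat.
               map (\<lambda>i. (of_real ((\<alpha> - real k + real i) / (\<alpha> + real m)), 1)) [1..<m+1] @ [(1, 1)])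
         in fractional_eq_solution \<alpha> m d A B C
          (\<lambda>x t. of_real (x powr a) *
             (\<Sum>k \<in> {k \<in> {1..nat \<lfloor>\<alpha>\<rfloor> + 1}. wright_defined (as k)}.
                c k * of_real (t powr (\<alpha> - real k)) *
                wright (as k) [(of_real (1 + \<alpha> - real k), \<alpha> + real m)]
                  (of_real (K * (\<alpha> + real m) ^ m * t powr (\<alpha> + real m)))))))"
proof (intro conjI impI)
  define \<mu> where "\<mu> = \<alpha> + real m"
  have \<mu>: "\<mu> > 0" using \<open>\<alpha> > 0\<close> by (simp add: \<mu>_def)
  have A0: "A \<noteq> 0" using \<open>A > 0\<close> by simp
  have map_one: "map (\<lambda>j. (f j, 1)) xs = map (\<lambda>b. (b, 1)) (map f xs)" for f :: "nat \<Rightarrow> complex" and xs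
    by simp
  {
    assume "\<alpha> < 2 \<and> d \<noteq> 2"
    hence \<alpha>: "\<alpha> < 2" and d: "d \<noteq> 2" by auto
    note ind = indicial_factorization[OF A0 d _ s1[OF d, folded \<mu>_def] s2[OF d, folded \<mu>_def]]
    show "fractional_eq_solution \<alpha> m d A B C
          (\<lambda>x t. c 1 * of_real (x powr a) *
             fox_H (m + 2) 0
               [(1, \<alpha> + real m)]
               ([(- s1 / of_real (\<alpha> + real m), 1), (- s2 / of_real (\<alpha> + real m), 1)] @
                map (\<lambda>j. (of_real (real j / (\<alpha> + real m)), 1)) [1..<m+1])
               (of_real (x powr (2 - d) /
                 (A * (d - 2)\<^sup>2 * (\<alpha> + real m) ^ m * t powr (\<alpha> + real m)))))"
      unfolding \<mu>_def[symmetric]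
    proof (rule fox_H_solution[where a = a and ?b1.0 = "- s1 / of_real \<mu>" and ?b2.0 = "- s2 / of_real \<mu>" and c = "c 1"])
      fix s :: complex
      \<comment> \<open>The indicial factorization is used at \<tau> = - s, whence the parameters -
        s1 / \<mu> and - s2 / \<mu> of the H-function.\<close>
      have "(- s - s1 / of_real \<mu>) * (- s - s2 / of_real \<mu>) = (- s1 / of_real \<mu> - s) * (- s2 / of_real \<mu> - s)"
        by (simp add: algebra_simps)
      moreover have "of_real a + of_real (d - 2) * (- s) = of_real a + of_real (2 - d) * s"
        by (simp add: algebra_simps)
      ultimately show "of_real A * (of_real a + of_real (2 - d) * s) * (of_real a + of_real (2 - d) * s - 1)
          + of_real B * (of_real a + of_real (2 - d) * s) + of_real C
        = of_real (A * (d - 2)\<^sup>2) * ((- s1 / of_real \<mu> - s) * (- s2 / of_real \<mu> - s))"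
        using ind[of "- s"] \<mu> by simp
    qed (use \<alpha> d \<open>\<alpha> > 0\<close> \<open>A > 0\<close> in \<open>simp_all add: o_def \<mu>_def del: upt_Suc\<close>)
  }
  {
    assume "\<alpha> > 2 \<and> d \<noteq> 2"
    hence \<alpha>: "\<alpha> > 2" and d: "d \<noteq> 2" by auto
    note ind = indicial_factorization[OF A0 d _ s1[OF d, folded \<mu>_def] s2[OF d, folded \<mu>_def]]
    define as where "as = (\<lambda>k::nat. [(of_real (\<alpha> - real k) - s1) / of_real \<mu>, (of_real (\<alpha> - real k) - s2) / of_real \<mu>]
       @ map (\<lambda>i. of_real ((\<alpha> - real k + real i) / \<mu>)) [1..<m+1])"
    have full: "[((of_real (\<alpha> - real k) - s1) / of_real \<mu>, 1), ((of_real (\<alpha> - real k) - s2) / of_real \<mu>, 1)] @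
               map (\<lambda>i. (of_real ((\<alpha> - real k + real i) / \<mu>), 1)) [1..<m+1] @ [(1, 1)]
        = map (\<lambda>a. (a, 1)) (as k) @ [(1, 1)]" for k
      by (simp add: as_def)
    show "let as = (\<lambda>k::nat.
               [((of_real (\<alpha> - real k) - s1) / of_real (\<alpha> + real m), 1),
                ((of_real (\<alpha> - real k) - s2) / of_real (\<alpha> + real m), 1)] @
               map (\<lambda>i. (of_real ((\<alpha> - real k + real i) / (\<alpha> + real m)), 1)) [1..<m+1] @
               [(1, 1)])
         in fractional_eq_solution \<alpha> m d A B C
          (\<lambda>x t. of_real (x powr a) *
             (\<Sum>k \<in> {k \<in> {1..nat \<lfloor>\<alpha>\<rfloor> + 1}. wright_defined (as k)}.
                c k * of_real (x powr ((d - 2) * (\<alpha> - real k) / (\<alpha> + real m)) *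
                               t powr (\<alpha> - real k)) *
                wright (as k) [(of_real (1 + \<alpha> - real k), \<alpha> + real m)]
                  (of_real (A * (d - 2)\<^sup>2 * (\<alpha> + real m) ^ m *
                            x powr (d - 2) * t powr (\<alpha> + real m)))))"
      unfolding \<mu>_def[symmetric] full Let_def
    proof (rule wright_series_solution[where as = as and a = a
          and K = "{k \<in> {1..nat \<lfloor>\<alpha>\<rfloor> + 1}. wright_defined (map (\<lambda>a. (a, 1)) (as k) @ [(1, 1)])}"
          and Z = "A * (d - 2)\<^sup>2 * \<mu> ^ m" and c = c], unfold \<mu>_def[symmetric])
      fix k a' n
      assume k: "k \<in> {k \<in> {1..nat \<lfloor>\<alpha>\<rfloor> + 1}. wright_defined (map (\<lambda>a. (a, 1)) (as k) @ [(1, 1)])}"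
      \<comment> \<open>There are m + 2 parameters against \<mu> = \<alpha> + m; here \<alpha> > 2
        is used.\<close>
      show "real (length (as k)) < \<mu>" using \<alpha> by (simp add: as_def \<mu>_def)
      show "a' + of_nat n \<notin> \<int>\<^sub>\<le>\<^sub>0" if "a' \<in> set (as k)"
        using k that by (force simp: wright_defined_def)
      let ?\<sigma> = "\<alpha> - real k + \<mu> * real n"
      let ?\<tau> = "complex_of_real (?\<sigma> / \<mu>)"
      \<comment> \<open>The first two numerator arguments are the two linear factors of the indicial
        polynomial at \<tau> = \<sigma> / \<mu>.\<close>
      have "(of_real (\<alpha> - real k) - s) / of_real \<mu> + of_nat n = ?\<tau> - s / of_real \<mu>" for s
        using \<mu> by (simp add: field_simps)
      hence "of_real (A * (d - 2)\<^sup>2 * \<mu> ^ m) * (\<Prod>a\<leftarrow>as k. a + of_nat n)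
        = ((\<Prod>i\<leftarrow>[1..<m+1]. of_real ((\<alpha> - real k + real i) / \<mu>) + of_nat n) * of_real (\<mu> ^ m))
          * (of_real (A * (d - 2)\<^sup>2) * ((?\<tau> - s1 / of_real \<mu>) * (?\<tau> - s2 / of_real \<mu>)))"
        by (simp add: as_def o_def mult_ac del: upt_Suc)
      also have "\<dots> = of_real (pochhammer (1 + ?\<sigma>) m) *
          (of_real A * (of_real a + of_real (d - 2) * ?\<tau>) * (of_real a + of_real (d - 2) * ?\<tau> - 1)
           + of_real B * (of_real a + of_real (d - 2) * ?\<tau>) + of_real C)"
        using prod_list_arith_pochhammer[of \<mu> "\<alpha> - real k" n m] ind[of ?\<tau>] \<mu> by simp
      also have "of_real a + of_real (d - 2) * ?\<tau> = of_real (a + (d - 2) * ?\<sigma> / \<mu>)"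
        by simp
      finally show "of_real (A * (d - 2)\<^sup>2 * \<mu> ^ m) * (\<Prod>a\<leftarrow>as k. a + of_nat n)
        = of_real (pochhammer (1 + ?\<sigma>) m * (A * (a + (d - 2) * ?\<sigma> / \<mu>) * (a + (d - 2) * ?\<sigma> / \<mu> - 1)
            + B * (a + (d - 2) * ?\<sigma> / \<mu>) + C))"
        by simp
    qed (use \<open>\<alpha> > 0\<close> in auto)
  }
  {
    assume d: "d = 2"
    define as where "as = (\<lambda>k::nat. map (\<lambda>i. complex_of_real ((\<alpha> - real k + real i) / \<mu>)) [1..<m+1])"
    have full: "map (\<lambda>i. (of_real ((\<alpha> - real k + real i) / \<mu>), 1)) [1..<m+1] @ [(1, 1)]
        = map (\<lambda>a. (a, 1)) (as k) @ [(1, 1)]" for k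
      by (simp add: as_def)
    show "let as = (\<lambda>k::nat.
               map (\<lambda>i. (of_real ((\<alpha> - real k + real i) / (\<alpha> + real m)), 1)) [1..<m+1] @ [(1, 1)])
         in fractional_eq_solution \<alpha> m d A B C
          (\<lambda>x t. of_real (x powr a) *
             (\<Sum>k \<in> {k \<in> {1..nat \<lfloor>\<alpha>\<rfloor> + 1}. wright_defined (as k)}.
                c k * of_real (t powr (\<alpha> - real k)) *
                wright (as k) [(of_real (1 + \<alpha> - real k), \<alpha> + real m)]
                  (of_real (K * (\<alpha> + real m) ^ m * t powr (\<alpha> + real m)))))"
      unfolding \<mu>_def[symmetric] full Let_def
    proof (rule wright_series_solution[where as = as and a = a
          and K = "{k \<in> {1..nat \<lfloor>\<alpha>\<rfloor> + 1}. wright_defined (map (\<lambda>a. (a, 1)) (as k) @ [(1, 1)])}"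
          and Z = "K * \<mu> ^ m" and c = c], unfold \<mu>_def[symmetric])
      fix k a' n
      assume k: "k \<in> {k \<in> {1..nat \<lfloor>\<alpha>\<rfloor> + 1}. wright_defined (map (\<lambda>a. (a, 1)) (as k) @ [(1, 1)])}"
      \<comment> \<open>Only the m arithmetic parameters are present, so \<alpha> > 0 gives
        convergence.\<close>
      show "real (length (as k)) < \<mu>" using \<open>\<alpha> > 0\<close> by (simp add: as_def \<mu>_def)
      show "a' + of_nat n \<notin> \<int>\<^sub>\<le>\<^sub>0" if "a' \<in> set (as k)"
        using k that by (force simp: wright_defined_def)
      let ?\<sigma> = "\<alpha> - real k + \<mu> * real n"
      have "of_real (K * \<mu> ^ m) * (\<Prod>a\<leftarrow>as k. a + of_nat n)
        = ((\<Prod>i\<leftarrow>[1..<m+1]. of_real ((\<alpha> - real k + real i) / \<mu>) + of_nat n) * of_real (\<mu> ^ m)) * complex_of_real K"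
        by (simp add: as_def o_def mult_ac del: upt_Suc)
      also have "\<dots> = of_real (pochhammer (1 + ?\<sigma>) m) * of_real K"
        using prod_list_arith_pochhammer[of \<mu> "\<alpha> - real k" n m] \<mu> by simp
      finally have "of_real (K * \<mu> ^ m) * (\<Prod>a\<leftarrow>as k. a + of_nat n) = of_real (pochhammer (1 + ?\<sigma>) m * K)"
        by (simp only: of_real_mult)
      \<comment> \<open>For d = 2 every term has the exponent a in x, so the indicial polynomial
        takes the constant value K.\<close>
      moreover have "A * (a + (d - 2) * ?\<sigma> / \<mu>) * (a + (d - 2) * ?\<sigma> / \<mu> - 1) + B * (a + (d - 2) * ?\<sigma> / \<mu>) + C = K"
        by (simp add: K d power2_eq_square algebra_simps)
      ultimately show "of_real (K * \<mu> ^ m) * (\<Prod>a\<leftarrow>as k. a + of_nat n)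
        = of_real (pochhammer (1 + ?\<sigma>) m * (A * (a + (d - 2) * ?\<sigma> / \<mu>) * (a + (d - 2) * ?\<sigma> / \<mu> - 1)
            + B * (a + (d - 2) * ?\<sigma> / \<mu>) + C))"
        by (simp only:)
    qed (use \<open>\<alpha> > 0\<close> d in auto)
  }
qed

end
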